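(* Let $F=F(x_1,\dots,x_r)\in\mathbb{C}[x_1,\ldots,x_r]$ be a smooth form of degree $d\ge 3$ with $r\ge 3$, and let $G$ be a subgroup of $\mathrm{Aut}(F)$ with decomposition data $V_i,W_{ij},k_i,r_{ij},H_{ij},m$ (as in the context), the underlying basis of $\mathbb{C}^r$ being compatible with $\mathbb{C}^r=\bigoplus_{i,j}W_{ij}$. Suppose $1\le a\le m$ and $k_a\ge 2$. If there is a monomial $\mathfrak{m}\in S^{d-1}(W_{a1}^* )\otimes S^1(W_{a2}^* )$ in $F$, then one of the following holds: (1) $k_a=2$ and $|G|\le\dfrac{B(G,F)}{|H_{a1}|}\le\dfrac{R(l(G),d)\cdot d^r\cdot r!}{\mathrm{JC}(r_{a1})}$; (2) $k_a\ge 3$ and $|G|\le\dfrac{B(G,F)}{2\cdot|H_{a1}|}\le\dfrac{R(l(G),d)\cdot d^r\cdot r!}{2\cdot\mathrm{JC}(r_{a1})}$.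
   Context: A form $F\in\mathbb{C}[x_1,\dots,x_r]$ is smooth if the origin is the only common zero of its first partial derivatives. $\mathrm{Aut}(F)=\{A\in\mathrm{GL}(r,\mathbb{C})\mid A(F)=F\}$ where $A(F)=F(\sum_i a_{1i}x_i,\ldots,\sum_i a_{ri}x_i)$; it is finite. A monomial is "in $F$" if its coefficient in $F$ is non-zero. A finite group acting irreducibly on a complex vector space $W$ acts primitively if $W$ cannot be decomposed as a direct sum of proper subspaces permuted by the group. A finite subgroup of $\mathrm{PGL}(k,\mathbb{C})$ is primitive if it is the image of a finite primitive subgroup of $\mathrm{GL}(k,\mathbb{C})$. $\mathrm{JC}(k)$ is the maximum order of a finite primitive subgroup of $\mathrm{PGL}(k,\mathbb{C})$. (By Collins: $\mathrm{JC}(k)=(k+1)!$ for $k=10,11$ and $k\ge 13$, and $\mathrm{JC}(k)=1,60,360,25920,25920,6531840,1451520,348364800,4199040,448345497600$ for $k=1,2,3,4,5,6,7,8,9,12$.) Decomposition data of a finite subgroup $G\subset\mathrm{GL}(r,\mathbb{C})$ (one choice fixed): $\mathbb{C}^r=V_1\oplus\cdots\oplus V_m$ with $V_i$ irreducible $G$-stable; $V_i=W_{i1}\oplus\cdots\oplus W_{ik_i}$ with subspaces permuted transitively by $G$ and $\mathrm{Stab}_G(W_{ij})=\{g\in G\mid g(W_{ij})=W_{ij}\}$ acting primitively on $W_{ij}$; $r_{ij}=\dim W_{ij}$; $s=\sum_i k_i$; $H_{ij}\subset\mathrm{PGL}(W_{ij})$ is the image of $\mathrm{Stab}_G(W_{ij})$.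 The subdegree sequence $l(G)$ is the tuple of all $r_{ij}$ arranged in non-increasing order. The basis is compatible with the decomposition if it is a union of bases of the $W_{ij}$ (in order), so each coordinate $x_k$ lies in one $W_{ij}^*$ (the dual basis is used on the dual space). Canonical bound: $B(G,F)=d^s\cdot\prod_{i,j}|H_{ij}|\cdot\prod_{i=1}^m k_i!$. Fermat-test ratio: for a non-increasing tuple $l=(r_1',\ldots,r_s')$ of positive integers with sum $r$ whose distinct values occur with multiplicities $a_1,\dots,a_t$, $R(l,d)=\dfrac{d^s\prod_{i=1}^s\mathrm{JC}(r_i')\prod_{j=1}^t a_j!}{d^r\cdot r!}$. *)

theory Defs
  imports
    "HOL-Library.Poly_Mapping"
    "HOL-Combinatorics.Permutations"
    "Jordan_Normal_Form.VS_Connect"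
begin

section \<open>Forms\<close>

text \<open>
  An exponent vector is a finitely supported map from variable indices to exponents. The variables
  of \<open>\<complex>[x\<^sub>1,\<dots>,x\<^sub>r]\<close> carry the indices \<open>0,\<dots>,r-1\<close>, in line with the coordinates of
  \<^term>\<open>carrier_vec r :: complex vec set\<close>.
\<close>

type_synonym monomial = "nat \<Rightarrow>\<^sub>0 nat"
type_synonym cpoly = "monomial \<Rightarrow>\<^sub>0 complex"

definition total_degree :: "monomial \<Rightarrow> nat" where
  "total_degree \<mu> = (\<Sum>i\<in>Poly_Mapping.keys \<mu>. Poly_Mapping.lookup \<mu> i)"

definition is_form :: "nat \<Rightarrow> nat \<Rightarrow> cpoly \<Rightarrow> bool" where
  "is_form r d F \<longleftrightarrow>
     (\<forall>\<mu>\<in>Poly_Mapping.keys F. Poly_Mapping.keys \<mu> \<subseteq> {..<r} \<and> total_degree \<mu> = d)"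

definition poly_var :: "nat \<Rightarrow> cpoly" where
  "poly_var i = Poly_Mapping.single (Poly_Mapping.single i 1) 1"

definition poly_const :: "complex \<Rightarrow> cpoly" where
  "poly_const c = Poly_Mapping.single 0 c"

text \<open>
  The truncated difference below is harmless: if \<open>x\<^sub>i\<close> does not occur in \<open>\<mu>\<close>, the coefficient is 0.
\<close>

definition partial_deriv :: "nat \<Rightarrow> cpoly \<Rightarrow> cpoly" where
  "partial_deriv i F =
     (\<Sum>\<mu>\<in>Poly_Mapping.keys F. Poly_Mapping.single (\<mu> - Poly_Mapping.single i 1)
                    (of_nat (Poly_Mapping.lookup \<mu> i) * Poly_Mapping.lookup F \<mu>))"

definition eval_poly_at :: "cpoly \<Rightarrow> complex vec \<Rightarrow> complex" where
  "eval_poly_at F v =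
     (\<Sum>\<mu>\<in>Poly_Mapping.keys F. Poly_Mapping.lookup F \<mu> *
        (\<Prod>i\<in>Poly_Mapping.keys \<mu>. (v $ i) ^ Poly_Mapping.lookup \<mu> i))"

definition smooth_form :: "nat \<Rightarrow> cpoly \<Rightarrow> bool" where
  "smooth_form r F \<longleftrightarrow>
     {v \<in> carrier_vec r. \<forall>i<r. eval_poly_at (partial_deriv i F) v = 0} = {0\<^sub>v r}"

definition linear_subst :: "nat \<Rightarrow> complex mat \<Rightarrow> cpoly \<Rightarrow> cpoly" where
  "linear_subst r A F =
     (\<Sum>\<mu>\<in>Poly_Mapping.keys F. poly_const (Poly_Mapping.lookup F \<mu>) *
        (\<Prod>k<r. (\<Sum>i<r. poly_const (A $$ (k, i)) * poly_var i) ^ Poly_Mapping.lookup \<mu> k))"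

abbreviation GL :: "nat \<Rightarrow> complex mat monoid" where
  "GL n \<equiv> units_of (ring_mat TYPE(complex) n ())"

text \<open>
  For a smooth form of degree at least 3 this group is finite, so that the cardinalities of its
  subgroups below are genuine orders.
\<close>

definition Aut_form :: "nat \<Rightarrow> cpoly \<Rightarrow> complex mat set" where
  "Aut_form r F = {A \<in> carrier (GL r). linear_subst r A F = F}"

section \<open>Linear group actions on subspaces\<close>

abbreviation is_subspace :: "nat \<Rightarrow> complex vec set \<Rightarrow> bool" where
  "is_subspace n U \<equiv> VectorSpace.subspace class_ring U (module_vec TYPE(complex) n)"

abbreviation sub_vs :: "nat \<Rightarrow> complex vec set \<Rightarrow> (complex, complex vec) module" where
  "sub_vs n U \<equiv> (module_vec TYPE(complex) n)\<lparr>carrier := U\<rparr>"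

abbreviation sub_dim :: "nat \<Rightarrow> complex vec set \<Rightarrow> nat" where
  "sub_dim n U \<equiv> vectorspace.dim class_ring (sub_vs n U)"

abbreviation image_under :: "complex mat \<Rightarrow> complex vec set \<Rightarrow> complex vec set" where
  "image_under g U \<equiv> (\<lambda>v. g *\<^sub>v v) ` U"

definition internal_direct_sum ::
    "nat \<Rightarrow> complex vec set \<Rightarrow> nat set \<Rightarrow> (nat \<Rightarrow> complex vec set) \<Rightarrow> bool" where
  "internal_direct_sum n W I U \<longleftrightarrow>
     finite I \<and> is_subspace n W \<and> (\<forall>i\<in>I. is_subspace n (U i)) \<and>
     bij_betw (\<lambda>u. finsum_vec TYPE(complex) n u I) (\<Pi>\<^sub>E i\<in>I. U i) W"

definition stable :: "complex mat set \<Rightarrow> complex vec set \<Rightarrow> bool" where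
  "stable G U \<longleftrightarrow> (\<forall>g\<in>G. image_under g U \<subseteq> U)"

definition acts_irreducibly :: "nat \<Rightarrow> complex mat set \<Rightarrow> complex vec set \<Rightarrow> bool" where
  "acts_irreducibly n G W \<longleftrightarrow>
     is_subspace n W \<and> stable G W \<and> W \<noteq> {0\<^sub>v n} \<and>
     (\<forall>U. is_subspace n U \<and> U \<subseteq> W \<and> stable G U \<longrightarrow> U = {0\<^sub>v n} \<or> U = W)"

definition permutes_subspaces ::
    "complex mat set \<Rightarrow> nat set \<Rightarrow> (nat \<Rightarrow> complex vec set) \<Rightarrow> bool" where
  "permutes_subspaces G I U \<longleftrightarrow>
     (\<forall>g\<in>G. \<exists>p. p permutes I \<and> (\<forall>i\<in>I. image_under g (U i) = U (p i)))"

definition acts_primitively :: "nat \<Rightarrow> complex mat set \<Rightarrow> complex vec set \<Rightarrow> bool" where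
  "acts_primitively n G W \<longleftrightarrow>
     acts_irreducibly n G W \<and>
     \<not> (\<exists>I U. internal_direct_sum n W I U \<and> (\<forall>i\<in>I. U i \<subset> W) \<and> permutes_subspaces G I U)"

definition stabilizer :: "complex mat set \<Rightarrow> complex vec set \<Rightarrow> complex mat set" where
  "stabilizer G U = {g \<in> G. image_under g U = U}"

text \<open>
  An element of \<open>PGL(W)\<close> is represented as a coset of the non-zero scalars in \<open>GL(W)\<close>, linear maps
  on \<open>W\<close> being represented by functions restricted to \<open>W\<close>. The following is therefore the image in
  \<open>PGL(W)\<close> of a group \<open>S\<close> of matrices that stabilizes \<open>W\<close>.
\<close>

definition projective_image ::
    "complex vec set \<Rightarrow> complex mat set \<Rightarrow> (complex vec \<Rightarrow> complex vec) set set" where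
  "projective_image W S =
     (\<lambda>g. {restrict (\<lambda>w. c \<cdot>\<^sub>v (g *\<^sub>v w)) W |c. c \<noteq> 0}) ` S"

definition primitive_PGL_subgroups :: "nat \<Rightarrow> (complex vec \<Rightarrow> complex vec) set set set" where
  "primitive_PGL_subgroups k =
     {projective_image (carrier_vec k) P |P.
        subgroup P (GL k) \<and> finite P \<and> acts_primitively k P (carrier_vec k)}"

text \<open>The maximum exists for \<open>k \<ge> 1\<close> by Jordan's theorem.\<close>

definition JC :: "nat \<Rightarrow> nat" where
  "JC k = Max (card ` primitive_PGL_subgroups k)"

section \<open>Decomposition data\<close>

text \<open>
  The summands are \<open>V i\<close> for \<open>i \<in> {1..m}\<close> and \<open>W i j\<close> for \<open>i \<in> {1..m}\<close>, \<open>j \<in> {1..k i}\<close>;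
  values outside these ranges are irrelevant.
\<close>

definition decomposition_data ::
    "nat \<Rightarrow> complex mat set \<Rightarrow> nat \<Rightarrow> (nat \<Rightarrow> complex vec set) \<Rightarrow> (nat \<Rightarrow> nat) \<Rightarrow>
     (nat \<Rightarrow> nat \<Rightarrow> complex vec set) \<Rightarrow> bool" where
  "decomposition_data r G m V k W \<longleftrightarrow>
     internal_direct_sum r (carrier_vec r) {1..m} V \<and>
     (\<forall>i\<in>{1..m}.
        acts_irreducibly r G (V i) \<and>
        internal_direct_sum r (V i) {1..k i} (W i) \<and>
        permutes_subspaces G {1..k i} (W i) \<and>
        (\<forall>j\<in>{1..k i}. \<forall>j'\<in>{1..k i}. \<exists>g\<in>G. image_under g (W i j) = W i j') \<and>
        (\<forall>j\<in>{1..k i}. acts_primitively r (stabilizer G (W i j)) (W i j)))"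

definition H_group ::
    "complex mat set \<Rightarrow> (nat \<Rightarrow> nat \<Rightarrow> complex vec set) \<Rightarrow> nat \<Rightarrow> nat \<Rightarrow>
     (complex vec \<Rightarrow> complex vec) set set" where
  "H_group G W i j = projective_image (W i j) (stabilizer G (W i j))"

definition subdegree_sequence ::
    "nat \<Rightarrow> nat \<Rightarrow> (nat \<Rightarrow> nat) \<Rightarrow> (nat \<Rightarrow> nat \<Rightarrow> complex vec set) \<Rightarrow> nat list" where
  "subdegree_sequence r m k W =
     rev (sort (concat (map (\<lambda>i. map (\<lambda>j. sub_dim r (W i j)) [1..<Suc (k i)]) [1..<Suc m])))"

text \<open>
  For a subspace \<open>U\<close> spanned by standard basis vectors, these are the indices of the coordinates
  that belong to \<open>U\<^sup>*\<close>, viewed inside the dual of the whole space via the dual basis.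
\<close>

definition coords :: "nat \<Rightarrow> complex vec set \<Rightarrow> nat set" where
  "coords r U = {t. t < r \<and> unit_vec r t \<in> U}"

text \<open>
  The second conjunct says that the standard basis lists the bases of the \<open>W i j\<close> one after the
  other, in the lexicographic order of \<open>(i, j)\<close>.
\<close>

definition compatible_basis ::
    "nat \<Rightarrow> nat \<Rightarrow> (nat \<Rightarrow> nat) \<Rightarrow> (nat \<Rightarrow> nat \<Rightarrow> complex vec set) \<Rightarrow> bool" where
  "compatible_basis r m k W \<longleftrightarrow>
     (\<forall>i\<in>{1..m}. \<forall>j\<in>{1..k i}.
        vectorspace.basis class_ring (sub_vs r (W i j)) (unit_vec r ` coords r (W i j))) \<and>
     (\<forall>i\<in>{1..m}. \<forall>j\<in>{1..k i}. \<forall>i'\<in>{1..m}. \<forall>j'\<in>{1..k i'}.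
        i < i' \<or> i = i' \<and> j < j' \<longrightarrow>
          (\<forall>t\<in>coords r (W i j). \<forall>t'\<in>coords r (W i' j'). t < t'))"

definition monomial_in_Sym :: "nat \<Rightarrow> nat \<Rightarrow> complex vec set \<Rightarrow> monomial \<Rightarrow> bool" where
  "monomial_in_Sym r p U \<mu> \<longleftrightarrow> Poly_Mapping.keys \<mu> \<subseteq> coords r U \<and> total_degree \<mu> = p"

definition monomial_in_Sym_tensor_Sym ::
    "nat \<Rightarrow> nat \<Rightarrow> complex vec set \<Rightarrow> nat \<Rightarrow> complex vec set \<Rightarrow> monomial \<Rightarrow> bool" where
  "monomial_in_Sym_tensor_Sym r p U q U' \<mu> \<longleftrightarrow>
     (\<exists>\<nu> \<nu>'. \<mu> = \<nu> + \<nu>' \<and> monomial_in_Sym r p U \<nu> \<and> monomial_in_Sym r q U' \<nu>')"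

section \<open>Canonical bound and Fermat-test ratio\<close>

definition canonical_bound ::
    "nat \<Rightarrow> complex mat set \<Rightarrow> nat \<Rightarrow> (nat \<Rightarrow> nat) \<Rightarrow> (nat \<Rightarrow> nat \<Rightarrow> complex vec set) \<Rightarrow> nat" where
  "canonical_bound d G m k W =
     d ^ (\<Sum>i=1..m. k i) * (\<Prod>i=1..m. \<Prod>j=1..k i. card (H_group G W i j)) *
     (\<Prod>i=1..m. fact (k i))"

text \<open>The factor \<open>r!\<close> of the ratio uses that \<open>r\<close> is the sum of the entries of the tuple.\<close>

definition Fermat_ratio :: "nat list \<Rightarrow> nat \<Rightarrow> real" where
  "Fermat_ratio l d =
     (real d ^ length l * (\<Prod>x\<leftarrow>l. real (JC x)) * (\<Prod>x\<in>set l. fact (count_list l x))) /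
     (real d ^ sum_list l * fact (sum_list l))"

end

theory Submission
  imports Defs
begin

text \<open>
  Let \<open>N\<close> be the subgroup of \<open>G\<close> fixing every block \<open>W\<^sub>i\<^sub>j\<close> and \<open>K\<close> the subgroup acting on each block by
  a scalar. Then \<open>G / N\<close> embeds into the product of the symmetric groups, \<open>N / K\<close> into the product of
  the \<open>H\<^sub>i\<^sub>j\<close>, and smoothness makes \<open>K\<close> a subgroup of a torus cut out by one equation
  \<open>\<lambda>\<^sub>b\<^sup>d\<^sup>-\<^sup>1 \<lambda>\<^sub>c = 1\<close> for each block \<open>b\<close>, hence of order at most \<open>d\<^sup>s\<close>.

  The given monomial improves this. The differential of \<open>F\<close> at a point of one block, in the direction of
  another block of \<open>V\<^sub>a\<close>, is a non-zero invariant pairing. By this pairing the elements of \<open>N\<close> that are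
  scalar on all blocks of \<open>V\<^sub>a\<close> but the first commute on the first block, so by primitivity they are
  scalar there: the factor \<open>H\<^sub>a\<^sub>1\<close> can be omitted. If \<open>k\<^sub>a \<ge> 3\<close>, either the image of \<open>G\<close> in the
  symmetric group on the blocks of \<open>V\<^sub>a\<close> is proper, hence of index at least two, or all pairs of
  blocks of \<open>V\<^sub>a\<close> are paired, which forces an element of \<open>K\<close> to be one scalar on \<open>V\<^sub>a\<close>.

  The comparison with the Fermat-test ratio needs \<open>|H\<^sub>i\<^sub>j| \<le> JC(r\<^sub>i\<^sub>j)\<close>. As \<open>JC\<close> is a \<^const>\<open>Max\<close>, this requires
  Jordan's theorem that the orders of the primitive subgroups of \<open>PGL(k)\<close> are bounded. Finiteness of \<open>G\<close> is
  not presupposed: if some \<open>H\<^sub>i\<^sub>j\<close> is infinite, then so is \<open>G\<close>, and the cardinalities of both are 0.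
\<close>

section \<open>Subspaces and matrix groups\<close>

text \<open>Smoothness only links every block to some block, so the equations for \<open>K\<close>
  follow an arbitrary self-map of the blocks. An exponent \<open>d - 1\<close> costs a factor
  \<open>d\<close> per block, and elimination along cycles respects this because xy + 1 \<le> (x +
  1)(y + 1). The pairing of two blocks has degree \<open>d - 1\<close> in its first argument and so
  does not make one block the dual of another. It does give linear functionals on the first block:
  the differentials at points of the other blocks. An element that is scalar on the other blocks
  multiplies each functional by a number, so all of them annihilate the additive commutator of two
  such elements. Their common kernel is invariant under the stabilizer, hence zero. The monomial
  links block 1 to block 2, whereas a link into block 1 is wanted; transitivity supplies it. For
  \<open>k a\<close> at least 3, equal scalars on \<open>V a\<close> turn \<open>k a\<close> torus
  variables into one. Two blocks leave no third block with which to compare their scalars. Jordan's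
  theorem needs a norm that hardly grows under the group, with constants depending on
  \<open>k\<close> alone. It comes from a basis of orbit vectors of maximal determinant and a
  maximum over translates.\<close>

lemma is_subspace_iff:
  "is_subspace n U \<longleftrightarrow> U \<subseteq> carrier_vec n \<and> 0\<^sub>v n \<in> U \<and>
     (\<forall>u\<in>U. \<forall>v\<in>U. u + v \<in> U) \<and> (\<forall>c. \<forall>u\<in>U. c \<cdot>\<^sub>v u \<in> U)"
proof -
  have "vectorspace (class_ring :: complex ring) (module_vec TYPE(complex) n)"
    by (rule vec_vs)
  moreover have "module (class_ring :: complex ring) (module_vec TYPE(complex) n)"
    by (rule vec_module)
  ultimately show ?thesis
    unfolding VectorSpace.subspace_def submodule_def
    by (auto simp: module_vec_simps)
qed

text \<open>Coordinatewise and total: the index lemma holds without carrier conditions on the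
  summands, and the index type is arbitrary, so that eigenvalue functions can serve as indices
  too.\<close>

definition vsum :: "nat \<Rightarrow> ('i \<Rightarrow> complex vec) \<Rightarrow> 'i set \<Rightarrow> complex vec" where
  "vsum n u I = vec n (\<lambda>t. \<Sum>i\<in>I. u i $ t)"

lemma dim_vsum [simp]: "dim_vec (vsum n u I) = n"
  and vsum_carrier [simp]: "vsum n u I \<in> carrier_vec n"
  and vsum_index [simp]: "t < n \<Longrightarrow> vsum n u I $ t = (\<Sum>i\<in>I. u i $ t)"
  by (auto simp: vsum_def)

lemma vsum_cong: "(\<And>i. i \<in> I \<Longrightarrow> u i = u' i) \<Longrightarrow> vsum n u I = vsum n u' I"
  by (simp add: vsum_def)

lemma finsum_vec_eq_vsum:
  assumes "finite I" "\<And>i. i \<in> I \<Longrightarrow> u i \<in> carrier_vec n"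
  shows "finsum_vec TYPE(complex) n u I = vsum n u I"
proof -
  have u: "u \<in> I \<rightarrow> carrier_vec n" using assms(2) by auto
  show ?thesis
    using index_finsum_vec[OF assms(1) _ u] finsum_vec_closed[OF u]
    by (intro eq_vecI) auto
qed

lemma vsum_empty [simp]: "vsum n u {} = 0\<^sub>v n"
  by (auto simp: vsum_def)

lemma vsum_insert:
  assumes "finite I" "i \<notin> I" "u i \<in> carrier_vec n"
  shows "vsum n u (insert i I) = u i + vsum n u I"
  using assms by (intro eq_vecI) auto

lemma vsum_add:
  assumes "\<And>i. i \<in> I \<Longrightarrow> u i \<in> carrier_vec n" "\<And>i. i \<in> I \<Longrightarrow> v i \<in> carrier_vec n"
  shows "vsum n (\<lambda>i. u i + v i) I = vsum n u I + vsum n v I"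
proof (rule eq_vecI)
  fix t assume "t < dim_vec (vsum n u I + vsum n v I)"
  then have t: "t < n" by simp
  have "(u i + v i) $ t = u i $ t + v i $ t" if "i \<in> I" for i
    using assms[OF that] t by auto
  then show "vsum n (\<lambda>i. u i + v i) I $ t = (vsum n u I + vsum n v I) $ t"
    using t by (simp add: sum.distrib)
qed simp

lemma vsum_smult:
  assumes "\<And>i. i \<in> I \<Longrightarrow> u i \<in> carrier_vec n"
  shows "vsum n (\<lambda>i. c \<cdot>\<^sub>v u i) I = c \<cdot>\<^sub>v vsum n u I"
proof (rule eq_vecI)
  fix t assume "t < dim_vec (c \<cdot>\<^sub>v vsum n u I)"
  then have t: "t < n" by simp
  have "(c \<cdot>\<^sub>v u i) $ t = c * u i $ t" if "i \<in> I" for i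
    using assms[OF that] t by auto
  then show "vsum n (\<lambda>i. c \<cdot>\<^sub>v u i) I $ t = (c \<cdot>\<^sub>v vsum n u I) $ t"
    using t by (simp add: sum_distrib_left)
qed simp

lemma vsum_permute:
  assumes "p permutes I"
  shows "vsum n (\<lambda>i. u (p i)) I = vsum n u I"
proof -
  have "(\<Sum>i\<in>I. u (p i) $ t) = (\<Sum>i\<in>I. u i $ t)" for t
    using sum.permute[OF assms, of "\<lambda>i. u i $ t"] by (simp add: comp_def)
  then show ?thesis by (simp add: vsum_def)
qed

lemma subspace_vsum_closed:
  assumes "is_subspace n U" "finite I" "\<And>i. i \<in> I \<Longrightarrow> u i \<in> U"
  shows "vsum n u I \<in> U"
  using assms(2,3)
proof (induction I rule: finite_induct)
  case empty
  then show ?case using assms(1) by (simp add: is_subspace_iff)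
next
  case (insert x I)
  then have "u x \<in> carrier_vec n" using assms(1) by (auto simp: is_subspace_iff)
  with insert assms(1) show ?case by (simp add: vsum_insert is_subspace_iff)
qed

lemma mult_mat_vec_index:
  "A \<in> carrier_mat m n \<Longrightarrow> v \<in> carrier_vec n \<Longrightarrow> t < m \<Longrightarrow>
     (A *\<^sub>v v) $ t = (\<Sum>j<n. A $$ (t, j) * v $ j)"
  by (auto simp: scalar_prod_def atLeast0LessThan intro!: sum.cong)

lemma mult_mat_unit_vec:
  fixes A :: "complex mat"
  shows "A \<in> carrier_mat m n \<Longrightarrow> j < n \<Longrightarrow> A *\<^sub>v unit_vec n j = col A j"
  by (intro eq_vecI) auto

lemma mult_mat_vec_vsum:
  assumes "A \<in> carrier_mat m n" "\<And>i. i \<in> I \<Longrightarrow> u i \<in> carrier_vec n"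
  shows "A *\<^sub>v vsum n u I = vsum m (\<lambda>i. A *\<^sub>v u i) I"
proof (rule eq_vecI)
  fix t assume t: "t < dim_vec (vsum m (\<lambda>i. A *\<^sub>v u i) I)"
  have "(A *\<^sub>v vsum n u I) $ t = (\<Sum>j<n. \<Sum>i\<in>I. A $$ (t, j) * u i $ j)"
    using t assms(1) by (simp add: mult_mat_vec_index sum_distrib_left del: index_mult_mat_vec)
  also have "\<dots> = (\<Sum>i\<in>I. \<Sum>j<n. A $$ (t, j) * u i $ j)"
    by (rule sum.swap)
  also have "\<dots> = vsum m (\<lambda>i. A *\<^sub>v u i) I $ t"
    using t assms by (simp add: mult_mat_vec_index del: index_mult_mat_vec)
  finally show "(A *\<^sub>v vsum n u I) $ t = vsum m (\<lambda>i. A *\<^sub>v u i) I $ t" .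
qed (use assms(1) in auto)

text \<open>The summation map is linear, so its injectivity is triviality of its kernel. Arbitrary
  families replace the extensional ones of the definition, since \<open>vsum\<close> reads a family
  only on \<open>I\<close>.\<close>

lemma internal_direct_sum_iff:
  "internal_direct_sum n W I U \<longleftrightarrow>
     finite I \<and> is_subspace n W \<and> (\<forall>i\<in>I. is_subspace n (U i)) \<and>
     (\<forall>u. (\<forall>i\<in>I. u i \<in> U i) \<longrightarrow> vsum n u I \<in> W) \<and>
     (\<forall>w\<in>W. \<exists>u. (\<forall>i\<in>I. u i \<in> U i) \<and> w = vsum n u I) \<and>
     (\<forall>u. (\<forall>i\<in>I. u i \<in> U i) \<and> vsum n u I = 0\<^sub>v n \<longrightarrow> (\<forall>i\<in>I. u i = 0\<^sub>v n))"
  (is "?L \<longleftrightarrow> ?R")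
proof (cases "finite I \<and> is_subspace n W \<and> (\<forall>i\<in>I. is_subspace n (U i))")
  case False
  then show ?thesis by (auto simp: internal_direct_sum_def)
next
  case True
  then have fin: "finite I" and sW: "is_subspace n W" and sU: "\<And>i. i \<in> I \<Longrightarrow> is_subspace n (U i)"
    by auto
  have Uc: "u \<in> carrier_vec n" if "i \<in> I" "u \<in> U i" for i u
    using sU[OF that(1)] that(2) by (auto simp: is_subspace_iff)
  have eq: "finsum_vec TYPE(complex) n u I = vsum n u I" if "\<forall>i\<in>I. u i \<in> U i" for u
    using that by (intro finsum_vec_eq_vsum fin) (auto intro: Uc)
  have L: "?L \<longleftrightarrow> inj_on (\<lambda>u. vsum n u I) (\<Pi>\<^sub>E i\<in>I. U i) \<and>
      (\<lambda>u. vsum n u I) ` (\<Pi>\<^sub>E i\<in>I. U i) = W"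
    unfolding internal_direct_sum_def bij_betw_def using True
    by (subst inj_on_cong[where g = "\<lambda>u. vsum n u I"], use eq in \<open>fastforce simp: PiE_iff\<close>)
      (subst image_cong[OF refl, where g = "\<lambda>u. vsum n u I"], use eq in \<open>fastforce simp: PiE_iff\<close>, simp)
  have r: "restrict u I \<in> (\<Pi>\<^sub>E i\<in>I. U i)" "vsum n (restrict u I) I = vsum n u I"
    if "\<forall>i\<in>I. u i \<in> U i" for u
    using that by (auto simp: vsum_def intro!: eq_vecI sum.cong)
  show ?thesis
  proof
    assume ?L
    then have inj: "inj_on (\<lambda>u. vsum n u I) (\<Pi>\<^sub>E i\<in>I. U i)"
      and im: "(\<lambda>u. vsum n u I) ` (\<Pi>\<^sub>E i\<in>I. U i) = W" using L by auto
    have "vsum n u I \<in> W" if "\<forall>i\<in>I. u i \<in> U i" for u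
      using im r[OF that] by (metis imageI)
    moreover have "\<exists>u. (\<forall>i\<in>I. u i \<in> U i) \<and> w = vsum n u I" if "w \<in> W" for w
    proof -
      have "w \<in> (\<lambda>u. vsum n u I) ` (\<Pi>\<^sub>E i\<in>I. U i)" using im that by simp
      then obtain u where "u \<in> (\<Pi>\<^sub>E i\<in>I. U i)" "w = vsum n u I" by (elim imageE) simp
      then show ?thesis by (auto simp: PiE_iff)
    qed
    moreover have "u i = 0\<^sub>v n" if "\<forall>i\<in>I. u i \<in> U i" "vsum n u I = 0\<^sub>v n" "i \<in> I" for u i
    proof -
      have z: "\<forall>i\<in>I. 0\<^sub>v n \<in> U i" using sU by (simp add: is_subspace_iff)
      have "vsum n (\<lambda>_. 0\<^sub>v n) I = 0\<^sub>v n" by (intro eq_vecI) auto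
      then have "restrict u I = restrict (\<lambda>_. 0\<^sub>v n) I"
        using inj r[OF that(1)] r[of "\<lambda>_. 0\<^sub>v n", OF z] that(2)
        by (intro inj_onD[OF inj]) simp_all
      then show ?thesis using that(3) by (metis restrict_apply')
    qed
    ultimately show ?R using True by blast
  next
    assume R: ?R
    have "inj_on (\<lambda>u. vsum n u I) (\<Pi>\<^sub>E i\<in>I. U i)"
    proof (rule inj_onI)
      fix u u' assume u: "u \<in> (\<Pi>\<^sub>E i\<in>I. U i)" "u' \<in> (\<Pi>\<^sub>E i\<in>I. U i)" "vsum n u I = vsum n u' I"
      have c: "u i \<in> carrier_vec n" "u' i \<in> carrier_vec n" if "i \<in> I" for i
        using u that by (auto simp: PiE_iff intro: Uc)
      have "\<forall>i\<in>I. u i + (-1) \<cdot>\<^sub>v u' i \<in> U i"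
        using u sU by (auto simp: PiE_iff is_subspace_iff)
      moreover have "vsum n (\<lambda>i. u i + (-1) \<cdot>\<^sub>v u' i) I = 0\<^sub>v n"
      proof (rule eq_vecI)
        fix t assume t: "t < dim_vec (0\<^sub>v n :: complex vec)"
        have "vsum n u I $ t = vsum n u' I $ t" using u by simp
        then have "(\<Sum>i\<in>I. u i $ t - u' i $ t) = 0" using t by (simp add: sum_subtractf)
        moreover have "(u i + (-1) \<cdot>\<^sub>v u' i) $ t = u i $ t - u' i $ t" if "i \<in> I" for i
          using c[OF that] t by auto
        ultimately show "vsum n (\<lambda>i. u i + (-1) \<cdot>\<^sub>v u' i) I $ t = 0\<^sub>v n $ t"
          using t by simp
      qed simp
      ultimately have z: "\<forall>i\<in>I. u i + (-1) \<cdot>\<^sub>v u' i = 0\<^sub>v n" using R by auto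
      show "u = u'"
      proof (rule PiE_ext[OF u(1,2)])
        fix i assume i: "i \<in> I"
        show "u i = u' i"
        proof (rule eq_vecI)
          fix t assume t: "t < dim_vec (u' i)"
          then have "(u i + (-1) \<cdot>\<^sub>v u' i) $ t = 0" using z i c[OF i] by auto
          then show "u i $ t = u' i $ t" using c[OF i] t by auto
        qed (use c[OF i] in auto)
      qed
    qed
    moreover have "(\<lambda>u. vsum n u I) ` (\<Pi>\<^sub>E i\<in>I. U i) = W"
    proof
      show "(\<lambda>u. vsum n u I) ` (\<Pi>\<^sub>E i\<in>I. U i) \<subseteq> W" using R by (auto simp: PiE_iff)
      show "W \<subseteq> (\<lambda>u. vsum n u I) ` (\<Pi>\<^sub>E i\<in>I. U i)"
      proof
        fix w assume "w \<in> W"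
        then obtain u where "\<forall>i\<in>I. u i \<in> U i" "w = vsum n u I" using R by blast
        then show "w \<in> (\<lambda>u. vsum n u I) ` (\<Pi>\<^sub>E i\<in>I. U i)" using r[of u] by (metis imageI)
      qed
    qed
    ultimately show ?L using L by simp
  qed
qed

text \<open>An inverse found inside \<open>S\<close> already witnesses membership in the unit group,
  so conditions on matrices alone suffice.\<close>

lemma subgroup_GL_iff:
  "subgroup S (GL n) \<longleftrightarrow> S \<subseteq> carrier_mat n n \<and> 1\<^sub>m n \<in> S \<and> (\<forall>g\<in>S. \<forall>h\<in>S. g * h \<in> S) \<and>
     (\<forall>g\<in>S. \<exists>h\<in>S. h * g = 1\<^sub>m n \<and> g * h = 1\<^sub>m n)" (is "?L \<longleftrightarrow> ?R")
proof -
  interpret R: ring "ring_mat TYPE(complex) n ()" by (rule ring_mat)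
  interpret G: group "GL n" by (rule R.units_group)
  have car: "carrier (GL n) = {g \<in> carrier_mat n n. \<exists>h\<in>carrier_mat n n. h * g = 1\<^sub>m n \<and> g * h = 1\<^sub>m n}"
    by (auto simp: units_of_def Units_def ring_mat_simps)
  have mult: "mult (GL n) = (*)" and one: "one (GL n) = 1\<^sub>m n"
    by (auto simp: units_of_def ring_mat_simps)
  show ?thesis
  proof
    assume L: ?L
    have "\<exists>h\<in>S. h * g = 1\<^sub>m n \<and> g * h = 1\<^sub>m n" if "g \<in> S" for g
      using subgroup.m_inv_closed[OF L that] G.l_inv[of g] G.r_inv[of g] subgroup.mem_carrier[OF L that]
      unfolding mult one by auto
    then show ?R
      using subgroup.subset[OF L] subgroup.m_closed[OF L] subgroup.one_closed[OF L]
      unfolding car mult one by auto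
  next
    assume R: ?R
    show ?L
    proof (rule G.subgroupI)
      show "S \<subseteq> carrier (GL n)" using R unfolding car by blast
      then have *: "\<And>g. g \<in> S \<Longrightarrow> g \<in> carrier (GL n)" by auto
      fix g assume g: "g \<in> S"
      then obtain h where h: "h \<in> S" "h * g = 1\<^sub>m n" using R by blast
      then have "inv\<^bsub>GL n\<^esub> g = h"
        using * g by (intro G.inv_equality) (auto simp: mult one)
      with h show "inv\<^bsub>GL n\<^esub> g \<in> S" by simp
    qed (use R in \<open>auto simp: mult\<close>)
  qed
qed

section \<open>Commuting normal subsets of primitive groups\<close>

lemma card_power_eq_le:
  assumes "n > 0"
  shows "finite {z :: complex. z ^ n = c} \<and> card {z :: complex. z ^ n = c} \<le> n"
proof -
  define p where "p = monom 1 n + [:- c:]"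
  have deg: "degree p = n"
    unfolding p_def using assms by (subst degree_add_eq_left) (auto simp: degree_monom_eq)
  then have "p \<noteq> 0" using assms by auto
  moreover have "{z. z ^ n = c} = {z. poly p z = 0}" by (auto simp: p_def poly_monom)
  ultimately show ?thesis using poly_roots_finite[of p] card_poly_roots_bound[of p] deg by simp
qed

lemma subgroup_GL_D:
  assumes "subgroup S (GL n)"
  shows "g \<in> S \<Longrightarrow> g \<in> carrier_mat n n" "1\<^sub>m n \<in> S" "g \<in> S \<Longrightarrow> h \<in> S \<Longrightarrow> g * h \<in> S"
    "g \<in> S \<Longrightarrow> \<exists>h\<in>S. h * g = 1\<^sub>m n \<and> g * h = 1\<^sub>m n"
  using assms by (auto simp: subgroup_GL_iff)

lemma mult_mat_zero_vec: "A \<in> carrier_mat m n \<Longrightarrow> A *\<^sub>v 0\<^sub>v n = (0\<^sub>v m :: complex vec)"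
  by (intro eq_vecI) auto

lemma finite_order_mat:
  assumes S: "subgroup S (GL n)" and "finite S" "a \<in> S"
  shows "\<exists>N>0. a ^\<^sub>m N = 1\<^sub>m n"
proof -
  note D = subgroup_GL_D[OF S]
  have a: "a \<in> carrier_mat n n" using D assms by auto
  have pS: "a ^\<^sub>m j \<in> S" for j
    using D a assms(3) by (induction j) auto
  have "\<not> inj_on (\<lambda>j. a ^\<^sub>m j) UNIV"
    using finite_imageD[of "\<lambda>j. a ^\<^sub>m j" UNIV] pS finite_subset[OF _ assms(2)]
    by (metis image_subsetI infinite_UNIV_nat)
  then obtain i j where ij: "i < j" "a ^\<^sub>m i = a ^\<^sub>m j"
    by (metis inj_onI linorder_neqE_nat)
  obtain h where h: "h \<in> S" "h * a ^\<^sub>m i = 1\<^sub>m n" using D(4)[OF pS] by blast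
  have c: "h \<in> carrier_mat n n" "a ^\<^sub>m i \<in> carrier_mat n n" "a ^\<^sub>m (j - i) \<in> carrier_mat n n"
    using D h pS by auto
  have "a ^\<^sub>m (i + k) = a ^\<^sub>m i * a ^\<^sub>m k" for k
    by (induction k) (use a in \<open>auto simp: assoc_mult_mat[of _ n n _ n _ n]\<close>)
  from this[of "j - i"] have "a ^\<^sub>m j = a ^\<^sub>m i * a ^\<^sub>m (j - i)" using ij by simp
  then have "h * a ^\<^sub>m i = (h * a ^\<^sub>m i) * a ^\<^sub>m (j - i)"
    using ij c by simp
  then have "a ^\<^sub>m (j - i) = 1\<^sub>m n" using h c by (metis left_mult_one_mat)
  then show ?thesis using ij by (intro exI[of _ "j - i"]) auto
qed

text \<open>Discrete Fourier transform: for an \<open>N\<close>-th root of unity \<omega> the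
  displayed sum is \<open>N\<close> times the projection of \<open>v\<close> to the eigenspace of
  \<open>a\<close> for \<open>inverse \<omega>\<close>. Summed over all such roots the displayed
  vectors give \<open>N\<close> times \<open>v\<close>, so one of them is non-zero. The explicit
  formula is what makes the vector stay in \<open>a\<close>-stable subspaces and remain an
  eigenvector of commuting elements.\<close>

lemma joint_eigenvector_step:
  assumes a: "a \<in> carrier_mat n n" "a ^\<^sub>m N = 1\<^sub>m n" "N > 0"
    and v: "v \<in> carrier_vec n" "v \<noteq> 0\<^sub>v n"
  shows "\<exists>\<omega>. \<omega> \<noteq> 0 \<and> vsum n (\<lambda>j. \<omega> ^ j \<cdot>\<^sub>v (a ^\<^sub>m j *\<^sub>v v)) {..<N} \<noteq> 0\<^sub>v n \<and>
     a *\<^sub>v vsum n (\<lambda>j. \<omega> ^ j \<cdot>\<^sub>v (a ^\<^sub>m j *\<^sub>v v)) {..<N} =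
       inverse \<omega> \<cdot>\<^sub>v vsum n (\<lambda>j. \<omega> ^ j \<cdot>\<^sub>v (a ^\<^sub>m j *\<^sub>v v)) {..<N}"
proof -
  define \<zeta> where "\<zeta> = cis (2 * pi / N)"
  define w where "w \<omega> = vsum n (\<lambda>j. \<omega> ^ j \<cdot>\<^sub>v (a ^\<^sub>m j *\<^sub>v v)) {..<N}" for \<omega>
  have \<zeta>N: "\<zeta> ^ N = 1" unfolding \<zeta>_def using a(3) by (simp add: DeMoivre)
  have \<zeta>0: "\<zeta> \<noteq> 0" by (simp add: \<zeta>_def)
  have pc: "a ^\<^sub>m j *\<^sub>v v \<in> carrier_vec n" for j using a v by (meson mult_mat_vec_carrier pow_carrier_mat)
  have pd: "dim_vec (a ^\<^sub>m j *\<^sub>v v) = n" for j using pc by (rule carrier_vecD)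
  \<comment> \<open>Orthogonality of characters of a cyclic group; it isolates the term
    \<open>j = 0\<close> below.\<close>
  have geo: "(\<Sum>k<N. (\<zeta> ^ j) ^ k) = 0" if "0 < j" "j < N" for j
  proof -
    have "\<zeta> ^ j \<noteq> 1"
    proof
      assume "\<zeta> ^ j = 1"
      then have "cos (j * (2 * pi / N)) = 1" unfolding \<zeta>_def DeMoivre
        by (metis cis.simps(1) one_complex.simps(1))
      then obtain m :: int where "j * (2 * pi / N) = real_of_int m * 2 * pi" using cos_one_2pi_int by metis
      then have "real j = m * N" using a(3) by (simp add: field_simps)
      then have "int j = m * int N" by (metis of_int_eq_iff of_int_mult of_int_of_nat_eq)
      with that show False
        by (metis dvd_triv_right int_dvd_int_iff nat_dvd_not_less)
    qed
    moreover have "(\<zeta> ^ j) ^ N = 1" using \<zeta>N by (metis mult.commute power_mult power_one)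
    ultimately show ?thesis using geometric_sum[of "\<zeta> ^ j" N] by simp
  qed
  have eig: "a *\<^sub>v w \<omega> = inverse \<omega> \<cdot>\<^sub>v w \<omega>" if "\<omega> ^ N = 1" for \<omega>
  proof (rule eq_vecI)
    have \<omega>0: "\<omega> \<noteq> 0" using that a(3) by (metis power_0_left zero_neq_one less_numeral_extra(3))
    fix t assume "t < dim_vec (inverse \<omega> \<cdot>\<^sub>v w \<omega>)"
    then have t: "t < n" by (simp add: w_def)
    define f where "f j = \<omega> ^ j * (a ^\<^sub>m j *\<^sub>v v) $ t" for j
    have aa: "a *\<^sub>v (\<omega> ^ j \<cdot>\<^sub>v (a ^\<^sub>m j *\<^sub>v v)) = \<omega> ^ j \<cdot>\<^sub>v (a ^\<^sub>m (Suc j) *\<^sub>v v)" for j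
    proof -
      have "a * a ^\<^sub>m j = a ^\<^sub>m Suc j"
      proof (induction j)
        case (Suc j)
        have "a * (a ^\<^sub>m j * a) = (a * a ^\<^sub>m j) * a"
          using a by (intro assoc_mult_mat[symmetric]) auto
        then show ?case using Suc by simp
      qed (use a in auto)
      then show ?thesis using a v pc[of j]
        by (metis assoc_mult_mat_vec mult_mat_vec pow_carrier_mat)
    qed
    have "(a *\<^sub>v w \<omega>) $ t = (\<Sum>j<N. \<omega> ^ j * (a ^\<^sub>m Suc j *\<^sub>v v) $ t)"
      unfolding w_def using t a(1) pc by (subst mult_mat_vec_vsum) (auto simp: aa simp del: index_mult_mat_vec)
    also have "\<dots> = (\<Sum>j<N. inverse \<omega> * f (Suc j))"
      using \<omega>0 by (simp add: f_def field_simps del: index_mult_mat_vec)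
    also have "\<dots> = inverse \<omega> * (\<Sum>j<N. f (Suc j))" by (simp add: sum_distrib_left)
    \<comment> \<open>The cyclic shift closes up because \<open>a\<close> and \<omega> both have
      trivial \<open>N\<close>-th power.\<close>
    also have "(\<Sum>j<N. f (Suc j)) = (\<Sum>j<N. f j)"
    proof -
      have "f N = f 0" using that a by (simp add: f_def)
      then show ?thesis using sum.lessThan_Suc_shift[of f N] sum.lessThan_Suc[of f N] by simp
    qed
    also have "\<dots> = w \<omega> $ t"
      using t pd by (simp add: w_def f_def del: index_mult_mat_vec)
    finally show "(a *\<^sub>v w \<omega>) $ t = (inverse \<omega> \<cdot>\<^sub>v w \<omega>) $ t" using t by (simp add: w_def)
  qed (use a in \<open>auto simp: w_def\<close>)
  have "\<exists>k. w (\<zeta> ^ k) \<noteq> 0\<^sub>v n"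
  proof (rule ccontr)
    assume "\<not> ?thesis"
    then have z: "w (\<zeta> ^ k) = 0\<^sub>v n" for k by auto
    have "v $ t = 0" if t: "t < n" for t
    proof -
      define f where "f j = (a ^\<^sub>m j *\<^sub>v v) $ t" for j
      have "0 = (\<Sum>k<N. w (\<zeta> ^ k) $ t)" using z t by simp
      also have "\<dots> = (\<Sum>k<N. \<Sum>j<N. (\<zeta> ^ k) ^ j * f j)"
        using t pd by (simp add: w_def f_def del: index_mult_mat_vec)
      also have "\<dots> = (\<Sum>j<N. \<Sum>k<N. (\<zeta> ^ k) ^ j * f j)" by (rule sum.swap)
      also have "\<dots> = (\<Sum>j<N. (\<Sum>k<N. (\<zeta> ^ j) ^ k) * f j)"
        by (simp add: sum_distrib_right flip: power_mult) (simp add: mult.commute)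
      also have "\<dots> = (\<Sum>j<N. if j = 0 then N * f j else 0)"
        by (intro sum.cong) (auto simp: geo)
      also have "\<dots> = N * f 0" using a(3) by simp
      finally show ?thesis using a v by (simp add: f_def)
    qed
    then show False using v by (auto intro!: eq_vecI)
  qed
  then obtain k where k: "w (\<zeta> ^ k) \<noteq> 0\<^sub>v n" by blast
  moreover have "(\<zeta> ^ k) ^ N = 1" using \<zeta>N by (metis mult.commute power_mult power_one)
  ultimately show ?thesis using eig[of "\<zeta> ^ k"] \<zeta>0 unfolding w_def
    by (intro exI[of _ "\<zeta> ^ k"]) auto
qed

text \<open>Induction over \<open>B\<close>: a joint eigenvector of the elements treated so far is
  projected to an eigenspace of the new element \<open>a\<close>. The projection combines the
  vectors \<open>a ^\<^sub>m j *\<^sub>v v\<close>, which keep their eigenvalues under the old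
  elements because these commute with \<open>a\<close> on \<open>W\<close>.\<close>

lemma joint_eigenvector:
  assumes S: "subgroup S (GL n)" "finite S" and W: "is_subspace n W" "stable S W" "W \<noteq> {0\<^sub>v n}"
    and A: "finite B" "B \<subseteq> S"
    and comm: "\<And>a b w. a \<in> B \<Longrightarrow> b \<in> B \<Longrightarrow> w \<in> W \<Longrightarrow> a *\<^sub>v (b *\<^sub>v w) = b *\<^sub>v (a *\<^sub>v w)"
  shows "\<exists>v\<in>W. v \<noteq> 0\<^sub>v n \<and> (\<forall>b\<in>B. \<exists>c. b *\<^sub>v v = c \<cdot>\<^sub>v v)"
  using A comm
proof (induction B rule: finite_induct)
  case empty
  have "0\<^sub>v n \<in> W" using W by (simp add: is_subspace_iff)
  then show ?case using W(3) by auto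
next
  case (insert a B)
  obtain v where v: "v \<in> W" "v \<noteq> 0\<^sub>v n" "\<forall>b\<in>B. \<exists>c. b *\<^sub>v v = c \<cdot>\<^sub>v v"
    using insert.IH insert.prems by auto
  note D = subgroup_GL_D[OF S(1)]
  have a: "a \<in> S" "a \<in> carrier_mat n n" using insert.prems D by auto
  have vc: "v \<in> carrier_vec n" using v W by (auto simp: is_subspace_iff)
  obtain N where N: "N > 0" "a ^\<^sub>m N = 1\<^sub>m n" using finite_order_mat[OF S a(1)] by blast
  obtain \<omega> where \<omega>: "\<omega> \<noteq> 0" "vsum n (\<lambda>j. \<omega> ^ j \<cdot>\<^sub>v (a ^\<^sub>m j *\<^sub>v v)) {..<N} \<noteq> 0\<^sub>v n"
     "a *\<^sub>v vsum n (\<lambda>j. \<omega> ^ j \<cdot>\<^sub>v (a ^\<^sub>m j *\<^sub>v v)) {..<N} =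
       inverse \<omega> \<cdot>\<^sub>v vsum n (\<lambda>j. \<omega> ^ j \<cdot>\<^sub>v (a ^\<^sub>m j *\<^sub>v v)) {..<N}" 
    using joint_eigenvector_step[OF a(2) N(2,1) vc v(2)] by blast
  let ?w = "vsum n (\<lambda>j. \<omega> ^ j \<cdot>\<^sub>v (a ^\<^sub>m j *\<^sub>v v)) {..<N}"
  have pS: "a ^\<^sub>m j \<in> S" for j using D a by (induction j) auto
  then have pW: "a ^\<^sub>m j *\<^sub>v v \<in> W" for j using W(2) v(1) by (auto simp: stable_def)
  have pc: "a ^\<^sub>m j *\<^sub>v u \<in> carrier_vec n" if "u \<in> carrier_vec n" for j u
    using a that by (meson mult_mat_vec_carrier pow_carrier_mat)
  have Wc: "u \<in> carrier_vec n" if "u \<in> W" for u using W that by (auto simp: is_subspace_iff)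
  have "?w \<in> W"
    using W(1) pW by (intro subspace_vsum_closed) (auto simp: is_subspace_iff)
  moreover have "\<exists>c. b *\<^sub>v ?w = c \<cdot>\<^sub>v ?w" if b: "b \<in> B" for b
  proof -
    have bS: "b \<in> S" using b insert.prems by auto
    then have bc: "b \<in> carrier_mat n n" using D by auto
    obtain c where c: "b *\<^sub>v v = c \<cdot>\<^sub>v v" using v b by auto
    have "b *\<^sub>v (a ^\<^sub>m j *\<^sub>v u) = a ^\<^sub>m j *\<^sub>v (b *\<^sub>v u)" if "u \<in> W" for j u
      using that
    proof (induction j arbitrary: u)
      case 0
      then show ?case using Wc[of u] Wc[of "b *\<^sub>v u"] bS W(2) bc a
        by (simp add: stable_def image_subset_iff)
    next
      case (Suc j)
      have au: "a *\<^sub>v u \<in> W" "b *\<^sub>v u \<in> W" using Suc.prems a bS W(2) by (auto simp: stable_def)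
      have e: "(a ^\<^sub>m Suc j) *\<^sub>v u = a ^\<^sub>m j *\<^sub>v (a *\<^sub>v u)" if "u \<in> W" for u
        using a Wc[OF that] by (simp add: assoc_mult_mat_vec[OF pow_carrier_mat])
      have "b *\<^sub>v (a ^\<^sub>m j *\<^sub>v (a *\<^sub>v u)) = a ^\<^sub>m j *\<^sub>v (b *\<^sub>v (a *\<^sub>v u))"
        by (rule Suc.IH[OF au(1)])
      also have "b *\<^sub>v (a *\<^sub>v u) = a *\<^sub>v (b *\<^sub>v u)"
        using insert.prems(2) b Suc.prems by auto
      finally show ?case using e[OF Suc.prems] e[OF au(2)] by simp
    qed
    then have e: "b *\<^sub>v (\<omega> ^ j \<cdot>\<^sub>v (a ^\<^sub>m j *\<^sub>v v)) = c \<cdot>\<^sub>v (\<omega> ^ j \<cdot>\<^sub>v (a ^\<^sub>m j *\<^sub>v v))" for j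
      using v(1) c pc[OF vc] a bc vc
      by (simp add: mult_mat_vec[of _ n n] mult_mat_vec[OF pow_carrier_mat] smult_smult_assoc mult.commute)
    have "b *\<^sub>v ?w = vsum n (\<lambda>j. c \<cdot>\<^sub>v (\<omega> ^ j \<cdot>\<^sub>v (a ^\<^sub>m j *\<^sub>v v))) {..<N}"
      using pc[OF vc] bc by (subst mult_mat_vec_vsum) (auto simp: e)
    also have "\<dots> = c \<cdot>\<^sub>v ?w"
      using pc[OF vc, THEN carrier_vecD]
      by (intro eq_vecI) (auto simp: sum_distrib_left simp del: index_mult_mat_vec)
    finally show ?thesis by blast
  qed
  ultimately show ?case using \<omega> by auto
qed

text \<open>Applying \<open>act a\<close> minus \<open>\<chi>0 a\<close> to a relation removes the
  term of \<open>\<chi>0\<close> and multiplies every other term by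
  \<open>\<chi> a - \<chi>0 a\<close>. By induction all these terms vanish, and for each remaining
  \<chi> some \<open>a\<close> makes the factor non-zero.\<close>

lemma joint_eigenspaces_independent:
  fixes X :: "('a \<Rightarrow> complex) set"
  assumes "finite X" "\<And>\<chi>. \<chi> \<in> X \<Longrightarrow> w \<chi> \<in> carrier_vec n"
    and "\<And>\<chi> a. \<chi> \<in> X \<Longrightarrow> a \<in> A \<Longrightarrow> act a \<in> carrier_mat n n \<and> act a *\<^sub>v w \<chi> = \<chi> a \<cdot>\<^sub>v w \<chi>"
    and "\<And>\<chi> \<chi>'. \<chi> \<in> X \<Longrightarrow> \<chi>' \<in> X \<Longrightarrow> (\<And>a. a \<in> A \<Longrightarrow> \<chi> a = \<chi>' a) \<Longrightarrow> \<chi> = \<chi>'"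
    and "vsum n w X = 0\<^sub>v n"
  shows "\<forall>\<chi>\<in>X. w \<chi> = 0\<^sub>v n"
  using assms
proof (induction X arbitrary: w rule: finite_induct)
  case (insert \<chi>0 X)
  have c: "\<And>\<chi>. \<chi> \<in> X \<Longrightarrow> w \<chi> \<in> carrier_vec n" "w \<chi>0 \<in> carrier_vec n" using insert.prems by auto
  have 1: "(\<chi> a - \<chi>0 a) \<cdot>\<^sub>v w \<chi> = 0\<^sub>v n" if a: "a \<in> A" and \<chi>: "\<chi> \<in> X" for a \<chi>
  proof -
    define w' where "w' \<chi> = (\<chi> a - \<chi>0 a) \<cdot>\<^sub>v w \<chi>" for \<chi>
    have aa: "act a \<in> carrier_mat n n" using insert.prems(2)[of \<chi>0 a] a by auto
    have e: "act a *\<^sub>v w \<chi> = \<chi> a \<cdot>\<^sub>v w \<chi>" if "\<chi> \<in> insert \<chi>0 X" for \<chi>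
      using insert.prems(2) a that by blast
    have "vsum n (\<lambda>\<chi>. \<chi> a \<cdot>\<^sub>v w \<chi>) (insert \<chi>0 X) = act a *\<^sub>v vsum n w (insert \<chi>0 X)"
      using aa insert.prems(1) by (subst mult_mat_vec_vsum) (auto simp: e intro!: vsum_cong)
    then have z: "vsum n (\<lambda>\<chi>. \<chi> a \<cdot>\<^sub>v w \<chi>) (insert \<chi>0 X) = 0\<^sub>v n" using insert.prems(4) mult_mat_zero_vec[OF aa] by simp
    have "vsum n w' X = 0\<^sub>v n"
    proof (rule eq_vecI)
      fix t assume "t < dim_vec (0\<^sub>v n :: complex vec)"
      then have t: "t < n" by simp
      have "(\<Sum>\<chi>\<in>insert \<chi>0 X. w \<chi> $ t) = 0" using insert.prems(4) t
        by (metis index_zero_vec(1) vsum_index)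
      then have s1: "(\<Sum>\<chi>\<in>insert \<chi>0 X. \<chi>0 a * w \<chi> $ t) = 0" by (metis mult_zero_right sum_distrib_left)
      have "(\<Sum>\<chi>\<in>insert \<chi>0 X. (\<chi> a \<cdot>\<^sub>v w \<chi>) $ t) = 0" using z t
        by (metis index_zero_vec(1) vsum_index)
      then have s2: "(\<Sum>\<chi>\<in>insert \<chi>0 X. \<chi> a * w \<chi> $ t) = 0"
        using t insert.prems(1) by (simp add: insert.hyps carrier_vecD[OF c(1)] carrier_vecD[OF c(2)])
      have "(\<Sum>\<chi>\<in>insert \<chi>0 X. (\<chi> a - \<chi>0 a) * w \<chi> $ t) = 0"
        using s1 s2 by (simp add: left_diff_distrib sum_subtractf del: sum.insert)
      then have "(\<Sum>\<chi>\<in>X. (\<chi> a - \<chi>0 a) * w \<chi> $ t) = 0" using insert.hyps by simp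
      then show "vsum n w' X $ t = 0\<^sub>v n $ t" using t c(1)[THEN carrier_vecD] by (simp add: w'_def)
    qed simp
    then have "\<forall>\<chi>\<in>X. w' \<chi> = 0\<^sub>v n"
    proof (intro insert.IH[of w'] \<open>vsum n w' X = 0\<^sub>v n\<close>)
      fix \<chi> b assume x: "\<chi> \<in> X" "b \<in> A"
      then have "act b \<in> carrier_mat n n" "act b *\<^sub>v w \<chi> = \<chi> b \<cdot>\<^sub>v w \<chi>"
        using insert.prems(2) by auto
      then show "act b \<in> carrier_mat n n \<and> act b *\<^sub>v w' \<chi> = \<chi> b \<cdot>\<^sub>v w' \<chi>"
        using c(1)[OF x(1)] by (simp add: w'_def mult_mat_vec smult_smult_assoc mult.commute)
    qed (use c insert.prems(3) in \<open>auto simp: w'_def\<close>)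
    then show ?thesis using \<chi> by (simp add: w'_def)
  qed
  have 2: "w \<chi> = 0\<^sub>v n" if \<chi>: "\<chi> \<in> X" for \<chi>
  proof -
    obtain a where a: "a \<in> A" "\<chi> a \<noteq> \<chi>0 a"
      using insert.prems(3)[of \<chi> \<chi>0] insert.hyps \<chi> by blast
    show ?thesis
    proof (rule eq_vecI)
      fix t assume t: "t < dim_vec (0\<^sub>v n :: complex vec)"
      have "((\<chi> a - \<chi>0 a) \<cdot>\<^sub>v w \<chi>) $ t = 0" using 1[OF a(1) \<chi>] t by simp
      then show "w \<chi> $ t = 0\<^sub>v n $ t" using a(2) t c(1)[OF \<chi>] by simp
    qed (use c(1)[OF \<chi>] in auto)
  qed
  have "vsum n w (insert \<chi>0 X) = w \<chi>0 + vsum n w X"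
    using insert.hyps c by (intro vsum_insert)
  moreover have "vsum n w X = 0\<^sub>v n" using 2 by (intro eq_vecI) auto
  ultimately have "w \<chi>0 = 0\<^sub>v n" using insert.prems(4) c(2) by simp
  with 2 show ?case by auto
qed simp

text \<open>Clifford's argument. As \<open>A\<close> is closed under conjugation, \<open>S\<close>
  permutes the joint eigenspaces of \<open>A\<close> in \<open>W\<close>, and these are independent.
  Their sum is stable and non-zero, hence equal to \<open>W\<close>. Such a decomposition is
  excluded by primitivity unless one eigenspace is all of \<open>W\<close>, and then
  \<open>A\<close> acts by scalars.\<close>

lemma primitive_commuting_scalar:
  assumes S: "subgroup S (GL n)" "finite S" and prim: "acts_primitively n S W"
    and A: "A \<subseteq> S" and conj: "\<And>g h a. g \<in> S \<Longrightarrow> h \<in> S \<Longrightarrow> h * g = 1\<^sub>m n \<Longrightarrow> a \<in> A \<Longrightarrow> h * a * g \<in> A"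
    and comm: "\<And>a b w. a \<in> A \<Longrightarrow> b \<in> A \<Longrightarrow> w \<in> W \<Longrightarrow> a *\<^sub>v (b *\<^sub>v w) = b *\<^sub>v (a *\<^sub>v w)"
    and a: "a \<in> A"
  shows "\<exists>c. \<forall>w\<in>W. a *\<^sub>v w = c \<cdot>\<^sub>v w"
proof -
  note D = subgroup_GL_D[OF S(1)]
  have W: "is_subspace n W" "stable S W" "W \<noteq> {0\<^sub>v n}"
    and irr: "\<And>U. is_subspace n U \<Longrightarrow> U \<subseteq> W \<Longrightarrow> stable S U \<Longrightarrow> U = {0\<^sub>v n} \<or> U = W"
    using prim by (auto simp: acts_primitively_def acts_irreducibly_def)
  have Wc: "u \<in> carrier_vec n" if "u \<in> W" for u using W that by (auto simp: is_subspace_iff)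
  have finA: "finite A" using A S(2) finite_subset by blast
  define E where "E \<chi> = {v \<in> W. \<forall>a\<in>A. a *\<^sub>v v = \<chi> a \<cdot>\<^sub>v v}" for \<chi>
  \<comment> \<open>Being extensional on \<open>A\<close>, the function is determined by any
    non-zero vector of its eigenspace; this also lets \<open>X\<close> be finite.\<close>
  define X where "X = {\<chi> \<in> extensional A. E \<chi> \<noteq> {0\<^sub>v n}}"
  have Esub: "is_subspace n (E \<chi>)" for \<chi>
  proof -
    have Ac: "\<And>a. a \<in> A \<Longrightarrow> a \<in> carrier_mat n n" using A D by auto
    have "0\<^sub>v n \<in> W" using W(1) by (simp add: is_subspace_iff)
    moreover have "\<And>a. a \<in> A \<Longrightarrow> a *\<^sub>v 0\<^sub>v n = \<chi> a \<cdot>\<^sub>v 0\<^sub>v n" using Ac by (subst mult_mat_zero_vec[of _ n n]) (auto intro: eq_vecI)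
    moreover have "\<And>a v w. a \<in> A \<Longrightarrow> v \<in> E \<chi> \<Longrightarrow> w \<in> E \<chi> \<Longrightarrow> a *\<^sub>v (v + w) = \<chi> a \<cdot>\<^sub>v (v + w)"
      unfolding E_def using Wc Ac by (simp add: mult_add_distrib_mat_vec[of _ n n] smult_add_distrib_vec[of _ n])
    moreover have "\<And>a v c. a \<in> A \<Longrightarrow> v \<in> E \<chi> \<Longrightarrow> a *\<^sub>v (c \<cdot>\<^sub>v v) = \<chi> a \<cdot>\<^sub>v (c \<cdot>\<^sub>v v)"
      unfolding E_def using Wc Ac by (simp add: mult_mat_vec[of _ n n] smult_smult_assoc mult.commute)
    ultimately show ?thesis using W(1) Wc unfolding is_subspace_iff
      by (simp add: E_def subset_iff)
  qed
  have Enz: "\<exists>v\<in>E \<chi>. v \<noteq> 0\<^sub>v n" if "\<chi> \<in> X" for \<chi>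
    using that Esub[of \<chi>] unfolding X_def is_subspace_iff by auto
  have Euniq: "\<chi> a = \<chi>' a" if "v \<in> E \<chi>" "v \<in> E \<chi>'" "v \<noteq> 0\<^sub>v n" "a \<in> A" for \<chi> \<chi>' v a
  proof -
    have vc: "v \<in> carrier_vec n" using that Wc by (auto simp: E_def)
    then obtain t where t: "t < n" "v $ t \<noteq> 0" using \<open>v \<noteq> 0\<^sub>v n\<close> by (auto simp: vec_eq_iff)
    have "\<chi> a \<cdot>\<^sub>v v = \<chi>' a \<cdot>\<^sub>v v" using that by (auto simp: E_def)
    then have "(\<chi> a \<cdot>\<^sub>v v) $ t = (\<chi>' a \<cdot>\<^sub>v v) $ t" by simp
    then show ?thesis using t vc by simp
  qed
  have "finite X"
  proof -
    \<comment> \<open>Elements of finite order have roots of unity as eigenvalues, so only finitely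
      many functions can occur.\<close>
    obtain N where N: "\<And>a. a \<in> A \<Longrightarrow> N a > 0 \<and> a ^\<^sub>m N a = 1\<^sub>m n"
      using finite_order_mat[OF S] A by (metis subsetD)
    have "X \<subseteq> (\<Pi>\<^sub>E a\<in>A. {z. z ^ N a = 1})"
    proof
      fix \<chi> assume \<chi>: "\<chi> \<in> X"
      then obtain v where v: "v \<in> E \<chi>" "v \<noteq> 0\<^sub>v n" using Enz by blast
      then have vc: "v \<in> carrier_vec n" using Wc by (auto simp: E_def)
      have "\<chi> a ^ N a = 1" if a: "a \<in> A" for a
      proof -
        have ac: "a \<in> carrier_mat n n" using a A D by auto
        have "a ^\<^sub>m j *\<^sub>v v = \<chi> a ^ j \<cdot>\<^sub>v v" for j
        proof (induction j)
          case (Suc j)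
          have "a ^\<^sub>m Suc j *\<^sub>v v = a ^\<^sub>m j *\<^sub>v (a *\<^sub>v v)"
            using ac vc by (simp add: assoc_mult_mat_vec[OF pow_carrier_mat])
          also have "a *\<^sub>v v = \<chi> a \<cdot>\<^sub>v v" using v a by (auto simp: E_def)
          also have "a ^\<^sub>m j *\<^sub>v (\<chi> a \<cdot>\<^sub>v v) = \<chi> a \<cdot>\<^sub>v (a ^\<^sub>m j *\<^sub>v v)"
            using ac vc by (simp add: mult_mat_vec[OF pow_carrier_mat])
          finally show ?case using Suc by (simp add: smult_smult_assoc)
        qed (use ac vc in auto)
        from this[of "N a"] have e: "v = \<chi> a ^ N a \<cdot>\<^sub>v v" using N[OF a] vc by simp
        obtain t where t: "t < n" "v $ t \<noteq> 0" using v(2) vc by (auto simp: vec_eq_iff)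
        have "v $ t = (\<chi> a ^ N a \<cdot>\<^sub>v v) $ t" using e by simp
        then show ?thesis using t vc by simp
      qed
      then show "\<chi> \<in> (\<Pi>\<^sub>E a\<in>A. {z. z ^ N a = 1})" using \<chi> by (auto simp: X_def PiE_iff)
    qed
    moreover have "finite (\<Pi>\<^sub>E a\<in>A. {z :: complex. z ^ N a = 1})"
    proof (intro finite_PiE finA)
      fix a assume "a \<in> A"
      then show "finite {z :: complex. z ^ N a = 1}" using N card_power_eq_le by blast
    qed
    ultimately show ?thesis by (rule finite_subset)
  qed
  \<comment> \<open>The index set of \<open>internal_direct_sum\<close> consists of natural numbers,
    so the eigenvalue functions are enumerated.\<close>
  then obtain e where e: "bij_betw e {0..<card X} X" using ex_bij_betw_nat_finite by blast
  define I where "I = {0..<card X}"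
  define U where "U i = E (e i)" for i
  have eX: "e i \<in> X" if "i \<in> I" for i using e that by (auto simp: I_def bij_betw_def)
  have conjE: "g *\<^sub>v v \<in> E (\<lambda>a. if a \<in> A then \<chi> (h * a * g) else undefined)"
    if gh: "g \<in> S" "h \<in> S" "h * g = 1\<^sub>m n" "g * h = 1\<^sub>m n" and v: "v \<in> E \<chi>" for g h v \<chi>
  proof -
    have c: "g \<in> carrier_mat n n" "h \<in> carrier_mat n n" "v \<in> carrier_vec n"
      using gh D v Wc by (auto simp: E_def)
    have "a *\<^sub>v (g *\<^sub>v v) = \<chi> (h * a * g) \<cdot>\<^sub>v (g *\<^sub>v v)" if a: "a \<in> A" for a
    proof -
      have ac: "a \<in> carrier_mat n n" using a A D by auto
      have "h * a * g \<in> A" using conj gh a by auto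
      then have "(h * a * g) *\<^sub>v v = \<chi> (h * a * g) \<cdot>\<^sub>v v" using v by (auto simp: E_def)
      then have "g *\<^sub>v ((h * a * g) *\<^sub>v v) = \<chi> (h * a * g) \<cdot>\<^sub>v (g *\<^sub>v v)"
        using c by (simp add: mult_mat_vec[of _ n n])
      moreover have "g *\<^sub>v ((h * a * g) *\<^sub>v v) = (g * (h * a * g)) *\<^sub>v v"
        using c ac by (intro assoc_mult_mat_vec[symmetric, of _ n n _ n]) auto
      moreover have "g * (h * a * g) = (g * h) * (a * g)"
        using c ac by (simp add: assoc_mult_mat[of _ n n _ n _ n])
      moreover have "\<dots> = a * g" using gh c ac by (simp add: left_mult_one_mat[of _ n n])
      moreover have "(a * g) *\<^sub>v v = a *\<^sub>v (g *\<^sub>v v)"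
        using c ac by (simp add: assoc_mult_mat_vec[of _ n n _ n])
      ultimately show ?thesis by simp
    qed
    moreover have "g *\<^sub>v v \<in> W" using W(2) gh v by (auto simp: stable_def E_def)
    ultimately show ?thesis by (auto simp: E_def)
  qed
  have inv_app: "h *\<^sub>v (g *\<^sub>v v) = v" if "g \<in> S" "h \<in> S" "h * g = 1\<^sub>m n" "v \<in> carrier_vec n" for g h v
    using that D by (metis assoc_mult_mat_vec one_mult_mat_vec)
  have ds_closed: "vsum n u I \<in> W" if "\<forall>i\<in>I. u i \<in> U i" for u
    using that W(1) by (intro subspace_vsum_closed) (auto simp: I_def U_def E_def)
  have indep: "\<forall>i\<in>I. u i = 0\<^sub>v n" if "\<forall>i\<in>I. u i \<in> U i" "vsum n u I = 0\<^sub>v n" for u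
  proof -
    define f where "f = inv_into I e"
    have bf: "bij_betw f X I" unfolding f_def using e by (intro bij_betw_inv_into) (simp add: I_def)
    have fe: "\<chi> \<in> X \<Longrightarrow> e (f \<chi>) = \<chi>" for \<chi> unfolding f_def using e
      by (auto simp: I_def bij_betw_def f_inv_into_f)
    have fI: "\<chi> \<in> X \<Longrightarrow> f \<chi> \<in> I" for \<chi> using bf by (auto simp: bij_betw_def)
    have uE: "\<chi> \<in> X \<Longrightarrow> u (f \<chi>) \<in> E \<chi>" for \<chi> using that(1) fI[of \<chi>] fe[of \<chi>] by (metis U_def)
    have "vsum n (\<lambda>\<chi>. u (f \<chi>)) X = vsum n u I"
      unfolding vsum_def by (intro eq_vecI) (simp_all add: sum.reindex_bij_betw[OF bf, of "\<lambda>i. u i $ _"])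
    then have "\<forall>\<chi>\<in>X. u (f \<chi>) = 0\<^sub>v n"
    proof (intro joint_eigenspaces_independent[OF \<open>finite X\<close>, where A = A and act = "\<lambda>a. a"])
      fix \<chi> a assume "\<chi> \<in> X" "a \<in> A"
      then show "a \<in> carrier_mat n n \<and> a *\<^sub>v u (f \<chi>) = \<chi> a \<cdot>\<^sub>v u (f \<chi>)"
        using uE[of \<chi>] A D(1) by (auto simp: E_def)
    next
      fix \<chi> \<chi>' assume "\<chi> \<in> X" "\<chi>' \<in> X" "\<And>a. a \<in> A \<Longrightarrow> \<chi> a = \<chi>' a"
      then show "\<chi> = \<chi>'" unfolding X_def by (auto intro: extensionalityI)
    qed (use uE Wc that(2) in \<open>auto simp: E_def\<close>)
    then show ?thesis using bf by (metis bij_betw_imp_surj_on imageE)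
  qed
  define W0 where "W0 = {vsum n u I |u. \<forall>i\<in>I. u i \<in> U i}"
  \<comment> \<open>The action of \<open>g\<close>, with inverse \<open>h\<close>, on eigenvalue
    functions: if \<open>v\<close> belongs to \<chi>, then \<open>g *\<^sub>v v\<close> belongs to
    the conjugated function.\<close>
  define cg where "cg h g \<chi> = (\<lambda>a. if a \<in> A then \<chi> (h * a * g) else undefined)" for h g and \<chi> :: "complex mat \<Rightarrow> complex"
  have cgX: "cg h g \<chi> \<in> X" if gh: "g \<in> S" "h \<in> S" "h * g = 1\<^sub>m n" "g * h = 1\<^sub>m n" and \<chi>: "\<chi> \<in> X" for g h \<chi>
  proof -
    obtain v where v: "v \<in> E \<chi>" "v \<noteq> 0\<^sub>v n" using Enz[OF \<chi>] by blast
    have vc: "v \<in> carrier_vec n" using v Wc by (auto simp: E_def)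
    have "g *\<^sub>v v \<noteq> 0\<^sub>v n"
    proof
      assume "g *\<^sub>v v = 0\<^sub>v n"
      then have "h *\<^sub>v (g *\<^sub>v v) = 0\<^sub>v n" using mult_mat_zero_vec D(1)[OF gh(2)] by simp
      then show False using inv_app[OF gh(1-3) vc] v(2) by simp
    qed
    moreover have "g *\<^sub>v v \<in> E (cg h g \<chi>)" using conjE[OF gh v(1)] by (simp add: cg_def)
    ultimately have "E (cg h g \<chi>) \<noteq> {0\<^sub>v n}" by blast
    then show ?thesis by (auto simp: X_def cg_def extensional_def)
  qed
  have cg_cg: "E (cg g h (cg h g \<chi>)) = E \<chi>"
    if gh: "g \<in> S" "h \<in> S" "h * g = 1\<^sub>m n" "g * h = 1\<^sub>m n" for g h \<chi>
  proof -
    have "cg g h (cg h g \<chi>) a = \<chi> a" if a: "a \<in> A" for a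
    proof -
      have c: "g \<in> carrier_mat n n" "h \<in> carrier_mat n n" "a \<in> carrier_mat n n" using gh a A D by auto
      have "h * (g * a * h) * g = (h * g) * a * (h * g)"
        using c by (simp add: assoc_mult_mat[of _ n n _ n _ n])
      also have "\<dots> = a" using gh(3) c by simp
      finally show ?thesis using a conj[OF gh(2,1,4) a] by (simp add: cg_def)
    qed
    then show ?thesis by (auto simp: E_def)
  qed
  define f where "f = inv_into I e"
  have fe: "\<chi> \<in> X \<Longrightarrow> e (f \<chi>) = \<chi>" "\<chi> \<in> X \<Longrightarrow> f \<chi> \<in> I" for \<chi> unfolding f_def using e
    by (simp_all add: I_def bij_betw_def f_inv_into_f inv_into_into del: atLeastLessThan_iff)
  have perm: "\<exists>p. p permutes I \<and> (\<forall>i\<in>I. image_under g (U i) = U (p i))" if g: "g \<in> S" for g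
  proof -
    obtain h where h: "h \<in> S" "h * g = 1\<^sub>m n" "g * h = 1\<^sub>m n" using D(4)[OF g] by blast
    define p where "p i = (if i \<in> I then f (cg h g (e i)) else i)" for i
    have pI: "p i \<in> I" if "i \<in> I" for i using that cgX[OF g h eX] fe by (simp add: p_def)
    have Up: "U (p i) = E (cg h g (e i))" if "i \<in> I" for i
      using that cgX[OF g h eX] fe by (simp add: p_def U_def)
    have im: "image_under g (U i) = U (p i)" if i: "i \<in> I" for i
    proof
      show "image_under g (U i) \<subseteq> U (p i)" using conjE[OF g h] unfolding Up[OF i] by (auto simp: cg_def U_def)
      show "U (p i) \<subseteq> image_under g (U i)"
      proof
        fix v assume v: "v \<in> U (p i)"
        then have "h *\<^sub>v v \<in> E (cg g h (cg h g (e i)))" unfolding Up[OF i]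
          using conjE[OF h(1) g h(3,2)] unfolding cg_def by blast
        then have "h *\<^sub>v v \<in> U i" using cg_cg[OF g h] by (simp add: U_def)
        moreover have "v = g *\<^sub>v (h *\<^sub>v v)"
          using inv_app[OF h(1) g h(3)] v Wc by (auto simp: U_def E_def)
        ultimately show "v \<in> image_under g (U i)" by blast
      qed
    qed
    have "inj_on p I"
    proof (rule inj_onI)
      fix i j assume ij: "i \<in> I" "j \<in> I" "p i = p j"
      obtain v where v: "v \<in> U i" "v \<noteq> 0\<^sub>v n" using Enz[OF eX[OF ij(1)]] by (auto simp: U_def)
      have "image_under g (U i) = image_under g (U j)" using im[OF ij(1)] im[OF ij(2)] ij(3) by simp
      moreover have "g *\<^sub>v v \<in> image_under g (U i)" using v(1) by (rule imageI)
      ultimately have "g *\<^sub>v v \<in> image_under g (U j)" by simp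
      then obtain v' where v': "v' \<in> U j" "g *\<^sub>v v = g *\<^sub>v v'" by (elim imageE)
      have vc: "v \<in> carrier_vec n" "v' \<in> carrier_vec n"
        using v(1) v'(1) Wc unfolding U_def E_def by blast+
      have "v = h *\<^sub>v (g *\<^sub>v v)" using inv_app[OF g h(1,2) vc(1)] by (rule sym)
      also have "\<dots> = v'" unfolding v'(2) by (rule inv_app[OF g h(1,2) vc(2)])
      finally have "v = v'" .
      then have "\<forall>a\<in>A. e i a = e j a" using Euniq v v' by (auto simp: U_def)
      moreover have "e i \<in> extensional A" "e j \<in> extensional A" using eX ij by (auto simp: X_def)
      ultimately have "e i = e j" by (metis extensionalityI)
      then show "i = j" using e ij by (auto simp: I_def bij_betw_def dest: inj_onD)
    qed
    moreover have "p ` I = I"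
      using pI \<open>inj_on p I\<close> by (intro endo_inj_surj) (auto simp: I_def)
    ultimately have "p permutes I"
      by (intro bij_imp_permutes) (auto simp: bij_betw_def p_def)
    then show ?thesis using im by blast
  qed
  have Uc: "u \<in> carrier_vec n" if "u \<in> U i" for u i using that Wc by (auto simp: U_def E_def)
  have "W0 = W"
  proof -
    have "is_subspace n W0"
      unfolding is_subspace_iff
    proof (intro conjI ballI allI)
      have "0\<^sub>v n = vsum n (\<lambda>_. 0\<^sub>v n) I" by (intro eq_vecI) auto
      moreover have "\<forall>i\<in>I. 0\<^sub>v n \<in> U i" using Esub by (auto simp: U_def is_subspace_iff)
      ultimately show "0\<^sub>v n \<in> W0" unfolding W0_def by blast
    next
      fix u v assume "u \<in> W0" "v \<in> W0"
      then obtain x y where xy: "\<forall>i\<in>I. x i \<in> U i" "\<forall>i\<in>I. y i \<in> U i" "u = vsum n x I" "v = vsum n y I"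
        unfolding W0_def by blast
      have "u + v = vsum n (\<lambda>i. x i + y i) I"
        using xy Uc by (subst vsum_add) blast+
      moreover have "\<forall>i\<in>I. x i + y i \<in> U i" using xy Esub by (auto simp: U_def is_subspace_iff)
      ultimately show "u + v \<in> W0" unfolding W0_def by blast
    next
      fix c u assume "u \<in> W0"
      then obtain x where x: "\<forall>i\<in>I. x i \<in> U i" "u = vsum n x I" unfolding W0_def by blast
      have "c \<cdot>\<^sub>v u = vsum n (\<lambda>i. c \<cdot>\<^sub>v x i) I"
        using x Uc by (subst vsum_smult) blast+
      moreover have "\<forall>i\<in>I. c \<cdot>\<^sub>v x i \<in> U i" using x Esub by (auto simp: U_def is_subspace_iff)
      ultimately show "c \<cdot>\<^sub>v u \<in> W0" unfolding W0_def by blast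
    qed (auto simp: W0_def)
    moreover have "W0 \<subseteq> W" using ds_closed by (auto simp: W0_def)
    moreover have "stable S W0"
      unfolding stable_def
    proof (intro ballI image_subsetI)
      fix g w assume g: "g \<in> S" and "w \<in> W0"
      then obtain x where x: "\<forall>i\<in>I. x i \<in> U i" "w = vsum n x I" unfolding W0_def by blast
      obtain p where p: "p permutes I" "\<forall>i\<in>I. image_under g (U i) = U (p i)" using perm[OF g] by blast
      have "g *\<^sub>v w = vsum n (\<lambda>i. g *\<^sub>v x i) I"
        unfolding x(2) using x(1) Uc D(1)[OF g] by (intro mult_mat_vec_vsum) auto
      also have "\<dots> = vsum n (\<lambda>i. g *\<^sub>v x (Hilbert_Choice.inv p i)) I"
        by (rule vsum_permute[OF permutes_inv[OF p(1)], symmetric])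
      finally have "g *\<^sub>v w = vsum n (\<lambda>i. g *\<^sub>v x (Hilbert_Choice.inv p i)) I" .
      moreover have "g *\<^sub>v x (Hilbert_Choice.inv p i) \<in> U i" if i: "i \<in> I" for i
      proof -
        have "Hilbert_Choice.inv p i \<in> I" using i p(1) by (metis permutes_in_image permutes_inv)
        moreover have "p (Hilbert_Choice.inv p i) = i" using p(1) by (simp add: permutes_inverses)
        ultimately show ?thesis using p(2) x(1) by (metis imageI)
      qed
      ultimately show "g *\<^sub>v w \<in> W0" unfolding W0_def by blast
    qed
    moreover have "W0 \<noteq> {0\<^sub>v n}"
    proof -
      obtain v where v: "v \<in> W" "v \<noteq> 0\<^sub>v n" "\<forall>b\<in>A. \<exists>c. b *\<^sub>v v = c \<cdot>\<^sub>v v"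
        using joint_eigenvector[OF S W finA A] comm by blast
      then obtain c where c: "\<forall>b\<in>A. b *\<^sub>v v = c b \<cdot>\<^sub>v v" by metis
      define \<chi> where "\<chi> = restrict c A"
      have vE: "v \<in> E \<chi>" using v c by (auto simp: E_def \<chi>_def)
      then have \<chi>: "\<chi> \<in> X" using v(2) by (auto simp: X_def \<chi>_def)
      define x where "x i = (if i = f \<chi> then v else 0\<^sub>v n)" for i
      have "\<forall>i\<in>I. x i \<in> U i"
        using fe(1)[OF \<chi>] vE Esub by (auto simp: x_def U_def is_subspace_iff)
      moreover have "vsum n x I = v"
      proof (rule eq_vecI)
        fix t assume "t < dim_vec v"
        then have t: "t < n" using carrier_vecD[OF Wc[OF v(1)]] by simp
        then have "vsum n x I $ t = (\<Sum>i\<in>I. if i = f \<chi> then v $ t else 0)"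
          unfolding vsum_index[OF t] by (intro sum.cong) (auto simp: x_def)
        then show "vsum n x I $ t = v $ t" using fe(2)[OF \<chi>] by (simp add: I_def)
      qed (use carrier_vecD[OF Wc[OF v(1)]] in simp)
      ultimately have "v \<in> W0" unfolding W0_def by blast
      then show ?thesis using v(2) by blast
    qed
    ultimately show ?thesis using irr by blast
  qed
  have "internal_direct_sum n W I U"
    unfolding internal_direct_sum_iff
    using W(1) Esub ds_closed indep \<open>W0 = W\<close> by (auto simp: U_def W0_def I_def)
  moreover have "permutes_subspaces S I U" using perm by (simp add: permutes_subspaces_def)
  \<comment> \<open>Primitivity forbids that all summands are proper.\<close>
  ultimately obtain i where i: "i \<in> I" "\<not> U i \<subset> W" using prim unfolding acts_primitively_def by blast
  then have "U i = W" by (auto simp: U_def E_def)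
  then show ?thesis using a by (auto simp: U_def E_def)
qed

section \<open>Jordan's theorem for primitive groups\<close>

lemma scalar_mat_iff:
  fixes A :: "complex mat"
  assumes "A \<in> carrier_mat n n"
  shows "(\<forall>w\<in>carrier_vec n. A *\<^sub>v w = c \<cdot>\<^sub>v w) \<longleftrightarrow> A = c \<cdot>\<^sub>m 1\<^sub>m n"
proof
  assume L: "\<forall>w\<in>carrier_vec n. A *\<^sub>v w = c \<cdot>\<^sub>v w"
  show "A = c \<cdot>\<^sub>m 1\<^sub>m n"
  proof (rule eq_matI)
    fix i j assume ij: "i < dim_row (c \<cdot>\<^sub>m 1\<^sub>m n)" "j < dim_col (c \<cdot>\<^sub>m 1\<^sub>m n)"
    have "A $$ (i, j) = (A *\<^sub>v unit_vec n j) $ i" using ij assms by simp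
    also have "\<dots> = (c \<cdot>\<^sub>v unit_vec n j) $ i" using L by simp
    finally show "A $$ (i, j) = (c \<cdot>\<^sub>m 1\<^sub>m n) $$ (i, j)" using ij by (simp add: unit_vec_def)
  qed (use assms in auto)
next
  assume A: "A = c \<cdot>\<^sub>m 1\<^sub>m n"
  show "\<forall>w\<in>carrier_vec n. A *\<^sub>v w = c \<cdot>\<^sub>v w"
  proof
    fix w :: "complex vec" assume w: "w \<in> carrier_vec n"
    then show "A *\<^sub>v w = c \<cdot>\<^sub>v w"
      unfolding A by (intro eq_vecI) (auto simp: scalar_prod_def if_distrib[of "\<lambda>x. _ * x * _"] cong: if_cong)
  qed
qed

text \<open>
  Tao's proof of Jordan's theorem: for a non-scalar \<open>h\<close> of minimal distance to the identity, every
  commutator of \<open>h\<close> with a small element is still closer to the identity, hence scalar, hence trivial.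
\<close>

lemma small_element_scalar:
  fixes N :: "complex mat \<Rightarrow> real"
  assumes P: "subgroup P (GL k)" "finite P" "acts_primitively k P (carrier_vec k)"
    and N_left: "\<And>g X. g \<in> P \<Longrightarrow> X \<in> carrier_mat k k \<Longrightarrow> N (g * X) \<le> N X"
    and N_right: "\<And>g X. g \<in> P \<Longrightarrow> X \<in> carrier_mat k k \<Longrightarrow> N (X * g) \<le> N X"
    and N_diff: "\<And>X Y. X \<in> carrier_mat k k \<Longrightarrow> Y \<in> carrier_mat k k \<Longrightarrow> N (X - Y) \<le> N X + N Y"
    and N_mult: "\<And>X Y. X \<in> carrier_mat k k \<Longrightarrow> Y \<in> carrier_mat k k \<Longrightarrow> N (X * Y) \<le> real k * N X * N Y"
    and N_scalar: "\<And>c. cmod c \<le> N (c \<cdot>\<^sub>m 1\<^sub>m k)"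
    and N_pos: "\<And>X. X \<in> carrier_mat k k \<Longrightarrow> X \<noteq> 0\<^sub>m k k \<Longrightarrow> 0 < N X"
    and \<epsilon>: "2 * real k * \<epsilon> \<le> 1" "\<And>\<zeta>. \<zeta> ^ k = 1 \<Longrightarrow> cmod (\<zeta> - 1) < \<epsilon> \<Longrightarrow> \<zeta> = 1"
    and h: "h \<in> P" "N (h - 1\<^sub>m k) < \<epsilon>"
  shows "\<exists>c. h = c \<cdot>\<^sub>m 1\<^sub>m k"
proof -
  note D = subgroup_GL_D[OF P(1)]
  note assoc = assoc_mult_mat[of _ k k _ k _ k]
  have k0: "k > 0"
  proof (rule ccontr)
    assume "\<not> ?thesis"
    then have "carrier_vec k = {0\<^sub>v k :: complex vec}" by (auto intro!: eq_vecI)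
    then show False using P(3) by (auto simp: acts_primitively_def acts_irreducibly_def)
  qed
  \<comment> \<open>Small elements commuting with all small elements. \<open>N\<close> does not
    increase the distance to the identity under conjugation by \<open>P\<close>, so \<open>A\<close>
    is closed under conjugation. Its members commute with each other, and primitivity makes them
    scalar.\<close>
  define A where "A = {z \<in> P. N (z - 1\<^sub>m k) < \<epsilon> \<and> (\<forall>g\<in>P. N (g - 1\<^sub>m k) < \<epsilon> \<longrightarrow> z * g = g * z)}"
  have AD: "z \<in> P" "z \<in> carrier_mat k k" "N (z - 1\<^sub>m k) < \<epsilon>" if "z \<in> A" for z
    using that D(1) by (simp_all add: A_def)
  have A_comm: "z * g = g * z" if "z \<in> A" "g \<in> P" "N (g - 1\<^sub>m k) < \<epsilon>" for z g
    using that unfolding A_def by blast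
  have conj_small: "N (h * z * g - 1\<^sub>m k) \<le> N (z - 1\<^sub>m k)"
    if "g \<in> P" "h \<in> P" "h * g = 1\<^sub>m k" "z \<in> P" for g h z
  proof -
    have c: "g \<in> carrier_mat k k" "h \<in> carrier_mat k k" "z \<in> carrier_mat k k" using that D(1-3) by auto
    have "h * z * g - 1\<^sub>m k = h * (z - 1\<^sub>m k) * g"
      using c that(3) by (simp add: mult_minus_distrib_mat[of _ k k _ k] minus_mult_distrib_mat[of _ k k _ _ k])
    also have "N \<dots> \<le> N (h * (z - 1\<^sub>m k))" using that c by (intro N_right) auto
    also have "\<dots> \<le> N (z - 1\<^sub>m k)" using that c by (intro N_left) auto
    finally show ?thesis .
  qed
  have A_scalar: "\<exists>c. z = c \<cdot>\<^sub>m 1\<^sub>m k" if z: "z \<in> A" for z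
  proof -
    have "\<exists>c. \<forall>w\<in>carrier_vec k. z *\<^sub>v w = c \<cdot>\<^sub>v w"
    proof (rule primitive_commuting_scalar[OF P _ _ _ z])
      show "A \<subseteq> P" using AD(1) by blast
      fix a b and w :: "complex vec" assume ab: "a \<in> A" "b \<in> A" "w \<in> carrier_vec k"
      have "a * b = b * a" using A_comm[OF ab(1) AD(1)[OF ab(2)] AD(3)[OF ab(2)]] by simp
      moreover have "a \<in> carrier_mat k k" "b \<in> carrier_mat k k" using ab AD(2) by blast+
      ultimately show "a *\<^sub>v (b *\<^sub>v w) = b *\<^sub>v (a *\<^sub>v w)"
        using ab(3) assoc_mult_mat_vec[of a k k b k w] assoc_mult_mat_vec[of b k k a k w] by simp
    next
      fix g h a :: "complex mat" assume gh: "g \<in> P" "h \<in> P" "h * g = 1\<^sub>m k" and a: "a \<in> A"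
      have c: "g \<in> carrier_mat k k" "h \<in> carrier_mat k k" "a \<in> carrier_mat k k"
        using D(1)[OF gh(1)] D(1)[OF gh(2)] AD(2)[OF a] by simp_all
      have gh': "g * h = 1\<^sub>m k" using gh(3) c mat_mult_left_right_inverse by blast
      have "h * a * g * x = x * (h * a * g)" if x: "x \<in> P" "N (x - 1\<^sub>m k) < \<epsilon>" for x
      proof -
        have xc: "x \<in> carrier_mat k k" using x D(1-3) by auto
        have "N (g * x * h - 1\<^sub>m k) < \<epsilon>" using conj_small[OF gh(2,1) gh' x(1)] x(2) by simp
        moreover have "g * x * h \<in> P" using gh x D(1-3) by auto
        ultimately have e: "a * (g * x * h) = g * x * h * a" using A_comm[OF a] by blast
        have "h * a * g * x = h * (a * (g * x * h)) * g"
          using c xc gh(3) by (simp add: assoc)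
        also have "\<dots> = (h * g) * (x * (h * (a * g)))" unfolding e using c xc by (simp add: assoc)
        also have "\<dots> = x * (h * a * g)" using c xc gh(3) by (simp add: assoc)
        finally show ?thesis .
      qed
      moreover have "h * a * g \<in> P" using gh AD(1)[OF a] D(3) by blast
      moreover have "N (h * a * g - 1\<^sub>m k) < \<epsilon>"
        using conj_small[OF gh AD(1)[OF a]] AD(3)[OF a] by simp
      ultimately show "h * a * g \<in> A" unfolding A_def by blast
    qed
    then show ?thesis using scalar_mat_iff[OF AD(2)[OF z]] by blast
  qed
  show ?thesis
  proof (rule ccontr)
    assume ns: "\<nexists>c. h = c \<cdot>\<^sub>m 1\<^sub>m k"
    \<comment> \<open>A small non-scalar element closest to the identity will be shown to lie in
      \<open>A\<close>, a contradiction.\<close>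
    define B where "B = {h \<in> P. N (h - 1\<^sub>m k) < \<epsilon> \<and> (\<nexists>c. h = c \<cdot>\<^sub>m 1\<^sub>m k)}"
    have "finite B" "B \<noteq> {}" using P(2) h ns by (auto simp: B_def)
    then obtain b where b: "b \<in> B" "\<And>x. x \<in> B \<Longrightarrow> N (b - 1\<^sub>m k) \<le> N (x - 1\<^sub>m k)"
      using arg_min_if_finite(1)[of B "\<lambda>h. N (h - 1\<^sub>m k)"] arg_min_least[of B _ "\<lambda>h. N (h - 1\<^sub>m k)"] by blast
    have bP: "b \<in> P" and bs: "N (b - 1\<^sub>m k) < \<epsilon>" and bns: "\<nexists>c. b = c \<cdot>\<^sub>m 1\<^sub>m k"
      using b by (auto simp: B_def)
    have bc: "b \<in> carrier_mat k k" using bP D(1-3) by auto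
    have bpos: "N (b - 1\<^sub>m k) > 0"
    proof (rule N_pos)
      show "b - 1\<^sub>m k \<noteq> 0\<^sub>m k k"
      proof
        assume z: "b - 1\<^sub>m k = 0\<^sub>m k k"
        have "b = 1\<^sub>m k"
        proof (rule eq_matI)
          fix i j assume ij: "i < dim_row (1\<^sub>m k :: complex mat)" "j < dim_col (1\<^sub>m k :: complex mat)"
          have "(b - 1\<^sub>m k) $$ (i, j) = 0" using z ij by simp
          then show "b $$ (i, j) = 1\<^sub>m k $$ (i, j)" using ij bc by simp
        qed (use bc in auto)
        then have "b = 1 \<cdot>\<^sub>m 1\<^sub>m k" by auto
        then show False using bns by blast
      qed
    qed (use bc in auto)
    have "b * g = g * b" if g: "g \<in> P" "N (g - 1\<^sub>m k) < \<epsilon>" for g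
    proof -
      obtain g' where g': "g' \<in> P" "g' * g = 1\<^sub>m k" "g * g' = 1\<^sub>m k" using D(4)[OF g(1)] by blast
      obtain b' where b': "b' \<in> P" "b' * b = 1\<^sub>m k" "b * b' = 1\<^sub>m k" using D(4)[OF bP] by blast
      have c: "g \<in> carrier_mat k k" "g' \<in> carrier_mat k k" "b' \<in> carrier_mat k k" using g g' b' D(1-3) by auto
      \<comment> \<open>A group commutator. Up to a factor in the group, \<open>z - 1\<close> is the
        additive commutator of \<open>g\<close> and \<open>b\<close>, which is unchanged when the
        identity is subtracted from both. Its size is thus quadratic, at most 2k times the product
        of the two distances, and smaller than the distance of \<open>b\<close> by the choice of
        \<epsilon>.\<close>
      define z where "z = g * b * g' * b'"
      have zP: "z \<in> P" using D(1-3) g bP g' b' by (auto simp: z_def)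
      have zc: "z \<in> carrier_mat k k" using zP D(1-3) by auto
      have "(b * g) * (g' * b') = b * (g * g') * b'" using c bc by (simp add: assoc)
      also have "\<dots> = 1\<^sub>m k" using g' b' c bc by simp
      finally have e1: "(b * g) * (g' * b') = 1\<^sub>m k" .
      have "z - 1\<^sub>m k = (g * b - b * g) * (g' * b')"
        using e1 c bc by (simp add: minus_mult_distrib_mat[of _ k k _ _ k]) (simp add: z_def assoc)
      moreover have "N ((g * b - b * g) * (g' * b')) \<le> N (g * b - b * g)"
        using c bc D(1-3) g' b' by (intro N_right) auto
      moreover have "g * b - b * g = (g - 1\<^sub>m k) * (b - 1\<^sub>m k) - (b - 1\<^sub>m k) * (g - 1\<^sub>m k)"
      proof -
        have e: "(x - 1\<^sub>m k) * (y - 1\<^sub>m k) = x * y - x - (y - 1\<^sub>m k)"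
          if "x \<in> carrier_mat k k" "y \<in> carrier_mat k k" for x y :: "complex mat"
        proof -
          have "(x - 1\<^sub>m k) * (y - 1\<^sub>m k) = x * (y - 1\<^sub>m k) - 1\<^sub>m k * (y - 1\<^sub>m k)"
            using that by (intro minus_mult_distrib_mat[of _ k k _ _ k] minus_carrier_mat) auto
          also have "x * (y - 1\<^sub>m k) = x * y - x * 1\<^sub>m k"
            using that by (intro mult_minus_distrib_mat[of _ k k _ k]) auto
          also have "1\<^sub>m k * (y - 1\<^sub>m k) = y - 1\<^sub>m k"
            by (intro left_mult_one_mat[of _ k k] minus_carrier_mat) auto
          finally show ?thesis using that by simp
        qed
        show ?thesis unfolding e[OF c(1) bc] e[OF bc c(1)]
          using c bc by (intro eq_matI) (simp_all del: index_mult_mat(1))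
      qed
      moreover have "N ((g - 1\<^sub>m k) * (b - 1\<^sub>m k) - (b - 1\<^sub>m k) * (g - 1\<^sub>m k))
          \<le> N ((g - 1\<^sub>m k) * (b - 1\<^sub>m k)) + N ((b - 1\<^sub>m k) * (g - 1\<^sub>m k))"
        using c bc by (intro N_diff) auto
      moreover have "N ((g - 1\<^sub>m k) * (b - 1\<^sub>m k)) \<le> real k * N (g - 1\<^sub>m k) * N (b - 1\<^sub>m k)"
        using c bc by (intro N_mult) auto
      moreover have "N ((b - 1\<^sub>m k) * (g - 1\<^sub>m k)) \<le> real k * N (b - 1\<^sub>m k) * N (g - 1\<^sub>m k)"
        using c bc by (intro N_mult) auto
      ultimately have "N (z - 1\<^sub>m k) \<le> (2 * real k * N (g - 1\<^sub>m k)) * N (b - 1\<^sub>m k)"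
        by (simp add: algebra_simps)
      also have "\<dots> < 1 * N (b - 1\<^sub>m k)"
      proof (intro mult_strict_right_mono bpos)
        have "2 * real k * N (g - 1\<^sub>m k) < 2 * real k * \<epsilon>" using g(2) k0 by simp
        then show "2 * real k * N (g - 1\<^sub>m k) < 1" using \<epsilon>(1) by linarith
      qed
      finally have lt: "N (z - 1\<^sub>m k) < N (b - 1\<^sub>m k)" by simp
      then have "z \<notin> B" using b(2) by force
      then obtain \<zeta> where \<zeta>: "z = \<zeta> \<cdot>\<^sub>m 1\<^sub>m k" using lt bs zP by (auto simp: B_def)
      \<comment> \<open>A commutator has determinant one, so its scalar is a \<open>k\<close>-th
        root of unity; lying near one, it is one.\<close>
      have "det z = det g * det b * det g' * det b'"
        using c bc unfolding z_def by (simp add: det_mult[of _ k])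
      also have "\<dots> = det (g' * g) * det (b' * b)" using c bc by (simp add: det_mult[of _ k])
      also have "\<dots> = 1" using g' b' by simp
      finally have "\<zeta> ^ k = 1" using \<zeta> by simp
      moreover have "z - 1\<^sub>m k = (\<zeta> - 1) \<cdot>\<^sub>m 1\<^sub>m k" unfolding \<zeta> by (intro eq_matI) auto
      then have "cmod (\<zeta> - 1) < \<epsilon>" using N_scalar[of "\<zeta> - 1"] lt bs by simp
      ultimately have "\<zeta> = 1" using \<epsilon>(2) by blast
      then have z1: "z = 1\<^sub>m k" using \<zeta> by auto
      have "g * b = g * b * (g' * (b' * b) * g)" using g' b' c bc by simp
      also have "\<dots> = z * (b * g)" using c bc by (simp add: z_def assoc)
      also have "\<dots> = b * g" using z1 c bc by simp
      finally show ?thesis by simp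
    qed
    then have "b \<in> A" using bP bs unfolding A_def by blast
    then show False using A_scalar bns by blast
  qed
qed

section \<open>Orbit bases with bounded coordinates\<close>

lemma inverse_mat_exists:
  fixes A :: "complex mat"
  assumes "A \<in> carrier_mat n n" "det A \<noteq> 0"
  shows "\<exists>B\<in>carrier_mat n n. A * B = 1\<^sub>m n \<and> B * A = 1\<^sub>m n"
  using det_non_zero_imp_unit[OF assms, of "()"] unfolding Units_def ring_mat_simps by auto

text \<open>A substitute for an invariant inner product. Among the bases of vectors in the orbit of
  a fixed \<open>e\<close>, one has a determinant of maximal modulus. By Cramer's rule the
  coordinates of a translated basis vector are determinants of orbit vectors divided by the maximal
  one, hence of modulus at most one. \<open>M\<close> has this basis as its columns and
  \<open>L\<close> is the inverse of \<open>M\<close>.\<close>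

lemma bounded_entries_basis:
  assumes P: "subgroup P (GL k)" "finite P" "acts_irreducibly k P (carrier_vec k)"
  shows "\<exists>L\<in>carrier_mat k k. \<exists>M\<in>carrier_mat k k. L * M = 1\<^sub>m k \<and> M * L = 1\<^sub>m k \<and>
    (\<forall>g\<in>P. \<forall>i<k. \<forall>j<k. cmod ((L * g * M) $$ (i, j)) \<le> 1)"
proof -
  note D = subgroup_GL_D(1-3)[OF P(1)]
  have irr: "\<And>U. is_subspace k U \<Longrightarrow> stable P U \<Longrightarrow> U = {0\<^sub>v k} \<or> U = carrier_vec k"
    and nz: "carrier_vec k \<noteq> {0\<^sub>v k :: complex vec}"
    using P(3) unfolding acts_irreducibly_def is_subspace_iff by blast+
  obtain e :: "complex vec" where e: "e \<in> carrier_vec k" "e \<noteq> 0\<^sub>v k"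
    using nz zero_carrier_vec[of k] by blast
  have oc: "g *\<^sub>v e \<in> carrier_vec k" if "g \<in> P" for g using D(1)[OF that] e(1) by simp
  \<comment> \<open>The span of the orbit of \<open>e\<close>, which irreducibility will identify
    with the whole space.\<close>
  define U0 where "U0 = {vsum k (\<lambda>g. c g \<cdot>\<^sub>v (g *\<^sub>v e)) P | c. True}"
  have U0I: "vsum k (\<lambda>g. c g \<cdot>\<^sub>v (g *\<^sub>v e)) P \<in> U0" for c unfolding U0_def by blast
  have "is_subspace k U0"
    unfolding is_subspace_iff
  proof (intro conjI ballI allI)
    have "0\<^sub>v k = vsum k (\<lambda>g. 0 \<cdot>\<^sub>v (g *\<^sub>v e)) P"
      using oc by (subst vsum_smult) (auto intro: eq_vecI)
    then show "0\<^sub>v k \<in> U0" using U0I[of "\<lambda>_. 0"] by simp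
  next
    fix u v assume "u \<in> U0" "v \<in> U0"
    then obtain a b where ab: "u = vsum k (\<lambda>g. a g \<cdot>\<^sub>v (g *\<^sub>v e)) P" "v = vsum k (\<lambda>g. b g \<cdot>\<^sub>v (g *\<^sub>v e)) P"
      unfolding U0_def by blast
    have "u + v = vsum k (\<lambda>g. a g \<cdot>\<^sub>v (g *\<^sub>v e) + b g \<cdot>\<^sub>v (g *\<^sub>v e)) P"
      unfolding ab using oc by (subst vsum_add) auto
    also have "\<dots> = vsum k (\<lambda>g. (a g + b g) \<cdot>\<^sub>v (g *\<^sub>v e)) P"
      using oc by (intro vsum_cong) (metis add_smult_distrib_vec)
    finally show "u + v \<in> U0" using U0I[of "\<lambda>g. a g + b g"] by simp
  next
    fix c u assume "u \<in> U0"
    then obtain a where a: "u = vsum k (\<lambda>g. a g \<cdot>\<^sub>v (g *\<^sub>v e)) P" unfolding U0_def by blast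
    have "c \<cdot>\<^sub>v u = vsum k (\<lambda>g. (c * a g) \<cdot>\<^sub>v (g *\<^sub>v e)) P"
      unfolding a using oc by (subst vsum_smult[symmetric]) (auto simp: smult_smult_assoc)
    then show "c \<cdot>\<^sub>v u \<in> U0" using U0I[of "\<lambda>g. c * a g"] by simp
  qed (auto simp: U0_def)
  moreover have "stable P U0"
    unfolding stable_def
  proof (intro ballI image_subsetI)
    fix h u assume h: "h \<in> P" and "u \<in> U0"
    then obtain a where a: "u = vsum k (\<lambda>g. a g \<cdot>\<^sub>v (g *\<^sub>v e)) P" unfolding U0_def by blast
    obtain h' where h': "h' \<in> P" "h' * h = 1\<^sub>m k" "h * h' = 1\<^sub>m k"
      using subgroup_GL_D(4)[OF P(1) h] by blast
    have hc: "h \<in> carrier_mat k k" "h' \<in> carrier_mat k k" using D h h' by auto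
    have canc: "h' * (h * a) = a" "h * (h' * a) = a" if "a \<in> carrier_mat k k" for a
      using assoc_mult_mat[OF hc(2,1) that] assoc_mult_mat[OF hc that] h'(2,3) that by simp_all
    \<comment> \<open>Left multiplication by \<open>h\<close> permutes \<open>P\<close>, so
      \<open>h\<close> merely reindexes the coefficients of a combination of orbit vectors.\<close>
    have bij: "bij_betw (\<lambda>g. h * g) P P"
    proof (rule bij_betw_byWitness[where f' = "\<lambda>g. h' * g"])
      show "\<forall>a\<in>P. h' * (h * a) = a" "\<forall>a\<in>P. h * (h' * a) = a"
        using canc D(1) by simp_all
    qed (use D(3) h h' in auto)
    have "h *\<^sub>v u = vsum k (\<lambda>g. h *\<^sub>v (a g \<cdot>\<^sub>v (g *\<^sub>v e))) P"
      unfolding a using oc by (intro mult_mat_vec_vsum[OF hc(1)]) auto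
    also have "\<dots> = vsum k (\<lambda>g. a (h' * (h * g)) \<cdot>\<^sub>v ((h * g) *\<^sub>v e)) P"
    proof (intro vsum_cong)
      fix g assume g: "g \<in> P"
      have gc: "g \<in> carrier_mat k k" using g D by auto
      have "h' * (h * g) = g" using canc(1)[OF gc] .
      then show "h *\<^sub>v (a g \<cdot>\<^sub>v (g *\<^sub>v e)) = a (h' * (h * g)) \<cdot>\<^sub>v ((h * g) *\<^sub>v e)"
        using hc(1) gc e(1) oc[OF g] by (simp add: mult_mat_vec[OF hc(1)] assoc_mult_mat_vec[OF hc(1) gc])
    qed
    also have "\<dots> = vsum k (\<lambda>g. a (h' * g) \<cdot>\<^sub>v (g *\<^sub>v e)) P"
    proof -
      have "(\<Sum>g\<in>P. (a (h' * (h * g)) \<cdot>\<^sub>v ((h * g) *\<^sub>v e)) $ t) = (\<Sum>g\<in>P. (a (h' * g) \<cdot>\<^sub>v (g *\<^sub>v e)) $ t)" for t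
        by (rule sum.reindex_bij_betw[OF bij, of "\<lambda>g. (a (h' * g) \<cdot>\<^sub>v (g *\<^sub>v e)) $ t"])
      then show ?thesis by (simp add: vsum_def)
    qed
    finally show "h *\<^sub>v u \<in> U0" using U0I[of "\<lambda>g. a (h' * g)"] by simp
  qed
  moreover have "e \<in> U0"
  proof -
    have "vsum k (\<lambda>g. (if g = 1\<^sub>m k then 1 else 0) \<cdot>\<^sub>v (g *\<^sub>v e)) P = e"
    proof (rule eq_vecI)
      fix t assume "t < dim_vec e"
      then have t: "t < k" using e by auto
      have "vsum k (\<lambda>g. (if g = 1\<^sub>m k then 1 else 0) \<cdot>\<^sub>v (g *\<^sub>v e)) P $ t
        = (\<Sum>g\<in>P. if g = 1\<^sub>m k then e $ t else 0)"
        unfolding vsum_index[OF t] using oc[THEN carrier_vecD] t e(1)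
        by (intro sum.cong) (auto simp del: index_mult_mat_vec)
      then show "vsum k (\<lambda>g. (if g = 1\<^sub>m k then 1 else 0) \<cdot>\<^sub>v (g *\<^sub>v e)) P $ t = e $ t"
        using P(2) D(2) by simp
    qed (use e in auto)
    then show ?thesis using U0I[of "\<lambda>g. if g = 1\<^sub>m k then 1 else 0"] by simp
  qed
  ultimately have U0: "U0 = carrier_vec k" using irr[of U0] e(2) by blast
  have "\<exists>c. unit_vec k i = vsum k (\<lambda>g. c g \<cdot>\<^sub>v (g *\<^sub>v e)) P" for i
  proof -
    have "unit_vec k i \<in> U0" unfolding U0 by simp
    then show ?thesis unfolding U0_def by blast
  qed
  then obtain c where c: "\<And>i. unit_vec k i = vsum k (\<lambda>g. c i g \<cdot>\<^sub>v (g *\<^sub>v e)) P" by metis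
  define R where "R f = mat\<^sub>r k k (\<lambda>i. f i *\<^sub>v e)" for f :: "nat \<Rightarrow> complex mat"
  obtain h where h: "bij_betw h {0..<card P} P" using ex_bij_betw_nat_finite[OF P(2)] by blast
  then have hP: "h s \<in> P" if "s \<in> {0..<card P}" for s using that by (auto simp: bij_betw_def)
  have ch: "unit_vec k i = vsum k (\<lambda>s. c i (h s) \<cdot>\<^sub>v (h s *\<^sub>v e)) {0..<card P}" for i
  proof -
    have "(\<Sum>s\<in>{0..<card P}. (c i (h s) \<cdot>\<^sub>v (h s *\<^sub>v e)) $ t) = (\<Sum>g\<in>P. (c i g \<cdot>\<^sub>v (g *\<^sub>v e)) $ t)" for t
      by (rule sum.reindex_bij_betw[OF h, of "\<lambda>g. (c i g \<cdot>\<^sub>v (g *\<^sub>v e)) $ t"])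
    then show ?thesis unfolding c[of i] by (simp add: vsum_def)
  qed
  have Rc: "R f \<in> carrier_mat k k" for f unfolding R_def by simp
  have R_index: "R f $$ (i, j) = (f i *\<^sub>v e) $ j" if "i < k" "j < k" for f i j
    unfolding R_def using that by simp
  \<comment> \<open>Each row of the identity matrix is expanded in orbit vectors. By multilinearity
    its determinant is a combination of determinants of orbit vectors, which therefore cannot all
    vanish.\<close>
  have "\<exists>f. (\<forall>i<k. f i \<in> P) \<and> det (R f) \<noteq> 0"
  proof (rule ccontr)
    assume neg: "\<not> ?thesis"
    then have neg': "det (R f') = 0" if "\<And>i. i < k \<Longrightarrow> f' i \<in> P" for f' using that by blast
    define A where "A i s = c i (h s) \<cdot>\<^sub>v (h s *\<^sub>v e)" for i s
    have car: "A \<in> {0..<k} \<rightarrow> {0..<card P} \<rightarrow> carrier_vec k" using oc hP by (auto simp: A_def)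
    have "1\<^sub>m k = mat\<^sub>r k k (\<lambda>i. finsum_vec TYPE(complex) k (A i) {0..<card P})"
    proof (rule eq_matI)
      fix i j assume "i < dim_row (mat\<^sub>r k k (\<lambda>i. finsum_vec TYPE(complex) k (A i) {0..<card P}))"
        "j < dim_col (mat\<^sub>r k k (\<lambda>i. finsum_vec TYPE(complex) k (A i) {0..<card P}))"
      then have ij: "i < k" "j < k" by auto
      have "finsum_vec TYPE(complex) k (A i) {0..<card P} = unit_vec k i"
        unfolding ch A_def[abs_def] using oc hP by (intro finsum_vec_eq_vsum) auto
      then show "1\<^sub>m k $$ (i, j) = mat\<^sub>r k k (\<lambda>i. finsum_vec TYPE(complex) k (A i) {0..<card P}) $$ (i, j)"
        using ij by simp
    qed auto
    then have "1 = det (mat\<^sub>r k k (\<lambda>i. finsum_vec TYPE(complex) k (A i) {0..<card P}))"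
      by (metis det_one)
    also have "\<dots> = (\<Sum>f | (\<forall>i\<in>{0..<k}. f i \<in> {0..<card P}) \<and> (\<forall>i. i \<notin> {0..<k} \<longrightarrow> f i = i).
        det (mat\<^sub>r k k (\<lambda>i. A i (f i))))"
      by (rule det_linear_rows_sum[OF _ car]) simp
    also have "\<dots> = 0"
    proof (intro sum.neutral ballI)
      fix f assume "f \<in> {f. (\<forall>i\<in>{0..<k}. f i \<in> {0..<card P}) \<and> (\<forall>i. i \<notin> {0..<k} \<longrightarrow> f i = i)}"
      then have f: "f i \<in> {0..<card P}" if "i < k" for i using that by simp
      have "det (mat\<^sub>r k k (\<lambda>i. A i (f i))) = (\<Prod>i\<in>{0..<k}. c i (h (f i))) * det (R (\<lambda>i. h (f i)))"
        unfolding A_def R_def using oc hP f by (intro det_rows_mul) auto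
      moreover have "det (R (\<lambda>i. h (f i))) = 0" by (rule neg') (rule hP[OF f])
      ultimately show "det (mat\<^sub>r k k (\<lambda>i. A i (f i))) = 0" by simp
    qed
    finally show False by simp
  qed
  then obtain f0 where f0: "\<forall>i<k. f0 i \<in> P" "det (R f0) \<noteq> 0" by blast
  \<comment> \<open>The extensional choices of one group element per index form a finite set, so the
    maximum is attained.\<close>
  define Fs where "Fs = {0..<k} \<rightarrow>\<^sub>E P"
  have R_cong: "R f = R f'" if "\<And>i. i < k \<Longrightarrow> f i = f' i" for f f'
    using that carrier_matD[OF Rc] by (intro eq_matI) (simp_all add: R_index del: index_mult_mat_vec)
  have "finite Fs" "Fs \<noteq> {}" using P(2) f0(1) unfolding Fs_def
    by (auto intro!: finite_PiE simp: PiE_eq_empty_iff)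
  then obtain f where f: "f \<in> Fs" "\<And>f'. f' \<in> Fs \<Longrightarrow> cmod (det (R f')) \<le> cmod (det (R f))"
    using arg_min_if_finite(1)[of Fs "\<lambda>f. - cmod (det (R f))"] arg_min_least[of Fs _ "\<lambda>f. - cmod (det (R f))"]
    by (metis (no_types, lifting) neg_le_iff_le)
  have max: "cmod (det (R f')) \<le> cmod (det (R f))" if "\<And>i. i < k \<Longrightarrow> f' i \<in> P" for f'
  proof -
    have "restrict f' {0..<k} \<in> Fs" using that by (auto simp: Fs_def)
    moreover have "R (restrict f' {0..<k}) = R f'" by (intro R_cong) auto
    ultimately show ?thesis using f(2) by metis
  qed
  have fP: "f i \<in> P" if "i < k" for i using f(1) that by (auto simp: Fs_def PiE_iff)
  have "cmod (det (R f)) \<ge> cmod (det (R f0))" using max f0(1) by blast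
  then have detf: "det (R f) \<noteq> 0" using f0(2) by auto
  define M where "M = transpose_mat (R f)"
  have Mc: "M \<in> carrier_mat k k" using Rc by (simp add: M_def)
  have detM: "det M = det (R f)" unfolding M_def using Rc by (rule det_transpose)
  then obtain L where L: "L \<in> carrier_mat k k" "M * L = 1\<^sub>m k" "L * M = 1\<^sub>m k"
    using inverse_mat_exists[OF Mc] detf by auto
  have "cmod ((L * g * M) $$ (i, j)) \<le> 1" if g: "g \<in> P" and ij: "i < k" "j < k" for g i j
  proof -
    have gc: "g \<in> carrier_mat k k" using g D by auto
    define x where "x = col (L * g * M) j"
    have Tc: "L * g * M \<in> carrier_mat k k" using L(1) gc Mc by simp
    have xc: "x \<in> carrier_vec k" unfolding x_def using Tc by (intro col_carrier_vec[OF ij(2)])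
    have xj: "x = (L * g * M) *\<^sub>v unit_vec k j" unfolding x_def using Tc ij(2)
      by (simp add: mult_mat_unit_vec)
    have Mx: "M *\<^sub>v x = g *\<^sub>v (f j *\<^sub>v e)"
    proof -
      have "M * (L * g * M) = (M * L) * (g * M)"
        using L(1) gc Mc by (simp add: assoc_mult_mat[of _ k k _ k _ k])
      then have "M * (L * g * M) = g * M" using L gc Mc by simp
      then have "M *\<^sub>v x = (g * M) *\<^sub>v unit_vec k j"
        unfolding xj using Mc L gc by (simp add: assoc_mult_mat_vec[of M k k _ k, symmetric])
      also have "\<dots> = g *\<^sub>v (M *\<^sub>v unit_vec k j)" using gc Mc by (intro assoc_mult_mat_vec) auto
      also have "M *\<^sub>v unit_vec k j = f j *\<^sub>v e"
        using Mc ij oc[OF fP[OF ij(2)], THEN carrier_vecD] carrier_matD[OF Rc]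
        by (intro eq_vecI) (simp_all add: M_def R_index del: index_mult_mat_vec(1), simp add: M_def R_index)
      finally show ?thesis .
    qed
    \<comment> \<open>Replacing a basis vector by a translated one leaves a tuple of orbit vectors,
      because \<open>g * f j\<close> is in \<open>P\<close>; maximality is applied to this
      tuple.\<close>
    have "replace_col M (M *\<^sub>v x) i = transpose_mat (R (f(i := g * f j)))"
    proof (rule eq_matI)
      fix s t assume "s < dim_row (transpose_mat (R (f(i := g * f j))))" "t < dim_col (transpose_mat (R (f(i := g * f j))))"
      then have st: "s < k" "t < k" using carrier_matD[OF Rc] by auto
      have "(g * f j) *\<^sub>v e = g *\<^sub>v (f j *\<^sub>v e)"
        using gc D(1)[OF fP[OF ij(2)]] e(1) by (intro assoc_mult_mat_vec) auto
      then show "replace_col M (M *\<^sub>v x) i $$ (s, t) = transpose_mat (R (f(i := g * f j))) $$ (s, t)"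
        using st carrier_matD[OF Rc] carrier_matD[OF Mc] unfolding Mx replace_col_def
        by (simp add: R_index M_def del: index_mult_mat_vec)
    qed (use carrier_matD[OF Rc] carrier_matD[OF Mc] in \<open>simp_all add: replace_col_def\<close>)
    then have "det (R (f(i := g * f j))) = x $ i * det (R f)" 
      using cramer_lemma_mat[OF Mc xc ij(1)] detM det_transpose[OF Rc] by simp
    moreover have "cmod (det (R (f(i := g * f j)))) \<le> cmod (det (R f))"
      using fP g D(3) ij by (intro max) auto
    ultimately have "cmod (x $ i) * cmod (det (R f)) \<le> 1 * cmod (det (R f))" by (simp add: norm_mult)
    then have "cmod (x $ i) \<le> 1" using detf by (simp del: mult_1)
    then show ?thesis using ij L gc Mc by (simp add: x_def del: index_mult_mat(1))
  qed
  then show ?thesis using L Mc by blast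
qed

text \<open>On \<open>S\<close> the function \<open>f\<close> factors through \<open>h\<close>. It
  serves to pass from grid cells to projective classes and from matrices on a subspace to the group
  itself.\<close>

lemma card_image_le_factor:
  assumes "finite (h ` S)" "\<And>x y. x \<in> S \<Longrightarrow> y \<in> S \<Longrightarrow> h x = h y \<Longrightarrow> f x = f y"
  shows "finite (f ` S) \<and> card (f ` S) \<le> card (h ` S)"
proof -
  have "f ` S = (\<lambda>z. f (SOME x. x \<in> S \<and> h x = z)) ` h ` S"
    unfolding image_image
  proof (intro image_cong refl)
    fix x assume "x \<in> S"
    then have "(SOME y. y \<in> S \<and> h y = h x) \<in> S \<and> h (SOME y. y \<in> S \<and> h y = h x) = h x"
      by (intro someI[of "\<lambda>y. y \<in> S \<and> h y = h x" x]) simp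
    then show "f x = f (SOME y. y \<in> S \<and> h y = h x)" using assms(2) \<open>x \<in> S\<close> by metis
  qed
  then show ?thesis using assms(1) card_image_le[OF assms(1)] by simp
qed

section \<open>Projective classes and discretization\<close>

definition proj_class :: "complex vec set \<Rightarrow> complex mat \<Rightarrow> (complex vec \<Rightarrow> complex vec) set" where
  "proj_class U g = {restrict (\<lambda>w. c \<cdot>\<^sub>v (g *\<^sub>v w)) U |c. c \<noteq> 0}"

lemma projective_image_eq: "projective_image U S = proj_class U ` S"
  by (simp add: projective_image_def proj_class_def)

lemma proj_class_iff: "x \<in> proj_class U g \<longleftrightarrow> (\<exists>c. x = restrict (\<lambda>w. c \<cdot>\<^sub>v (g *\<^sub>v w)) U \<and> c \<noteq> 0)"
  by (simp add: proj_class_def)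

lemma proj_class_eq_iff:
  "proj_class U g = proj_class U g' \<longleftrightarrow> (\<exists>c. c \<noteq> 0 \<and> (\<forall>w\<in>U. g *\<^sub>v w = c \<cdot>\<^sub>v (g' *\<^sub>v w)))"
proof
  assume eq: "proj_class U g = proj_class U g'"
  have "restrict (\<lambda>w. 1 \<cdot>\<^sub>v (g *\<^sub>v w)) U \<in> proj_class U g"
    unfolding proj_class_iff by (rule exI[of _ 1]) simp
  then obtain c where c: "restrict (\<lambda>w. 1 \<cdot>\<^sub>v (g *\<^sub>v w)) U = restrict (\<lambda>w. c \<cdot>\<^sub>v (g' *\<^sub>v w)) U" "c \<noteq> 0"
    unfolding eq proj_class_iff by (elim exE conjE)
  have "g *\<^sub>v w = c \<cdot>\<^sub>v (g' *\<^sub>v w)" if "w \<in> U" for w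
    using fun_cong[OF c(1), of w] that by simp
  then show "\<exists>c. c \<noteq> 0 \<and> (\<forall>w\<in>U. g *\<^sub>v w = c \<cdot>\<^sub>v (g' *\<^sub>v w))" using c(2) by (intro exI[of _ c]) simp
next
  assume "\<exists>c. c \<noteq> 0 \<and> (\<forall>w\<in>U. g *\<^sub>v w = c \<cdot>\<^sub>v (g' *\<^sub>v w))"
  then obtain c where c: "c \<noteq> 0" "\<forall>w\<in>U. g *\<^sub>v w = c \<cdot>\<^sub>v (g' *\<^sub>v w)" by (elim exE conjE)
  have e: "restrict (\<lambda>w. b \<cdot>\<^sub>v (g *\<^sub>v w)) U = restrict (\<lambda>w. (b * c) \<cdot>\<^sub>v (g' *\<^sub>v w)) U" for b
    by (intro restrict_ext) (simp add: c(2) smult_smult_assoc)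
  show "proj_class U g = proj_class U g'"
  proof (intro equalityI subsetI)
    fix x assume "x \<in> proj_class U g"
    then obtain b where b: "x = restrict (\<lambda>w. b \<cdot>\<^sub>v (g *\<^sub>v w)) U" "b \<noteq> 0" unfolding proj_class_iff by (elim exE conjE)
    then show "x \<in> proj_class U g'"
      unfolding proj_class_iff using c(1) e[of b] by (intro exI[of _ "b * c"]) simp
  next
    fix x assume "x \<in> proj_class U g'"
    then obtain b where b: "x = restrict (\<lambda>w. b \<cdot>\<^sub>v (g' *\<^sub>v w)) U" "b \<noteq> 0" unfolding proj_class_iff by (elim exE conjE)
    then show "x \<in> proj_class U g"
      unfolding proj_class_iff using c(1) e[of "b / c"] by (intro exI[of _ "b / c"]) simp
  qed
qed

lemma cmod_mult_mat_entry_le: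
  assumes "A \<in> carrier_mat k k" "B \<in> carrier_mat k k" "i < k" "j < k"
    and "\<And>i j. i < k \<Longrightarrow> j < k \<Longrightarrow> cmod (A $$ (i, j)) \<le> a"
    and "\<And>i j. i < k \<Longrightarrow> j < k \<Longrightarrow> cmod (B $$ (i, j)) \<le> b"
  shows "cmod ((A * B) $$ (i, j)) \<le> real k * a * b"
proof -
  have "(A * B) $$ (i, j) = (\<Sum>t<k. A $$ (i, t) * B $$ (t, j))"
    using assms(1-4) by (auto simp: scalar_prod_def atLeast0LessThan intro!: sum.cong)
  also have "cmod \<dots> \<le> (\<Sum>t<k. cmod (A $$ (i, t)) * cmod (B $$ (t, j)))"
    by (rule order_trans[OF norm_sum]) (simp add: norm_mult)
  also have "\<dots> \<le> (\<Sum>t<k. a * b)"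
    using assms(3-6) by (intro sum_mono mult_mono) (auto intro: order_trans[OF norm_ge_zero])
  finally show ?thesis by simp
qed

lemma floor_eq_imp_close:
  fixes x y K :: real
  assumes "\<lfloor>K * x\<rfloor> = \<lfloor>K * y\<rfloor>" "K > 0"
  shows "\<bar>x - y\<bar> \<le> 1 / K"
proof -
  have "\<bar>K * x - K * y\<bar> \<le> 1" using assms(1) by linarith
  then have "K * \<bar>x - y\<bar> \<le> 1" using assms(2) by (simp add: abs_mult flip: right_diff_distrib)
  then show ?thesis using assms(2) by (simp add: field_simps)
qed

lemma root_unity_gap: "\<exists>\<epsilon>>0. \<forall>\<zeta>::complex. \<zeta> ^ k = 1 \<and> cmod (\<zeta> - 1) < \<epsilon> \<longrightarrow> \<zeta> = 1" if "k > 0"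
proof -
  have "finite {\<zeta> :: complex. \<zeta> ^ k = 1}" using card_power_eq_le[OF that] by blast
  then have fin: "finite {\<zeta> :: complex. \<zeta> ^ k = 1 \<and> \<zeta> \<noteq> 1}" by (rule rev_finite_subset) auto
  \<comment> \<open>The inserted 1 keeps the minimum defined when one is the only
    \<open>k\<close>-th root of unity.\<close>
  define \<epsilon> where "\<epsilon> = Min (insert 1 ((\<lambda>\<zeta>. cmod (\<zeta> - 1)) ` {\<zeta>. \<zeta> ^ k = 1 \<and> \<zeta> \<noteq> 1}))"
  have "\<epsilon> > 0" unfolding \<epsilon>_def using fin by (subst Min_gr_iff) auto
  moreover have "\<zeta> = 1" if "\<zeta> ^ k = 1" "cmod (\<zeta> - 1) < \<epsilon>" for \<zeta>
  proof (rule ccontr)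
    assume "\<zeta> \<noteq> 1"
    then have "\<epsilon> \<le> cmod (\<zeta> - 1)" unfolding \<epsilon>_def using fin that(1) by (intro Min_le) auto
    then show False using that(2) by simp
  qed
  ultimately show ?thesis by blast
qed

text \<open>\<open>N X\<close> is the largest modulus of an entry of
  \<open>L * (g * X * h) * M\<close> for \<open>g\<close> and \<open>h\<close> in \<open>P\<close>;
  the maximum over translates on both sides makes it non-increasing under translation. In the basis
  with bounded entries it exceeds the entries of \<open>L * X * M\<close> by a factor of at most k
  squared, which does not involve \<open>P\<close>. A bound uniform in \<open>P\<close> depends on
  this.\<close>

lemma primitive_translation_norm:
  assumes P: "subgroup P (GL k)" "finite P" "acts_irreducibly k P (carrier_vec k)" and k: "k > 0"
  obtains L M and N :: "complex mat \<Rightarrow> real" where "L \<in> carrier_mat k k" "M \<in> carrier_mat k k"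
    "\<And>g X. g \<in> P \<Longrightarrow> X \<in> carrier_mat k k \<Longrightarrow> N (g * X) \<le> N X"
    "\<And>g X. g \<in> P \<Longrightarrow> X \<in> carrier_mat k k \<Longrightarrow> N (X * g) \<le> N X"
    "\<And>X Y. X \<in> carrier_mat k k \<Longrightarrow> Y \<in> carrier_mat k k \<Longrightarrow> N (X - Y) \<le> N X + N Y"
    "\<And>X Y. X \<in> carrier_mat k k \<Longrightarrow> Y \<in> carrier_mat k k \<Longrightarrow> N (X * Y) \<le> real k * N X * N Y"
    "\<And>c. cmod c \<le> N (c \<cdot>\<^sub>m 1\<^sub>m k)"
    "\<And>X. X \<in> carrier_mat k k \<Longrightarrow> X \<noteq> 0\<^sub>m k k \<Longrightarrow> 0 < N X"
    "\<And>X c. X \<in> carrier_mat k k \<Longrightarrow> (\<And>i j. i < k \<Longrightarrow> j < k \<Longrightarrow> cmod ((L * X * M) $$ (i, j)) \<le> c) \<Longrightarrow>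
      N X \<le> real k * (real k * c)"
    "\<And>g i j. g \<in> P \<Longrightarrow> i < k \<Longrightarrow> j < k \<Longrightarrow> cmod ((L * g * M) $$ (i, j)) \<le> 1"
proof -
  note D = subgroup_GL_D(1-3)[OF P(1)]
  note assoc = assoc_mult_mat[of _ k k _ k _ k]
  obtain L M where LM: "L \<in> carrier_mat k k" "M \<in> carrier_mat k k" "L * M = 1\<^sub>m k" "M * L = 1\<^sub>m k"
    and ent: "\<And>g i j. g \<in> P \<Longrightarrow> i < k \<Longrightarrow> j < k \<Longrightarrow> cmod ((L * g * M) $$ (i, j)) \<le> 1"
    using bounded_entries_basis[OF P] by blast
  define T where "T g X h = L * (g * X * h) * M" for g X h
  have Tc: "T g X h \<in> carrier_mat k k" for g X h using LM by (auto simp: T_def)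
  define I where "I = P \<times> P \<times> {..<k} \<times> {..<k}"
  define N where "N X = Max ((\<lambda>(g, h, i, j). cmod (T g X h $$ (i, j))) ` I)" for X
  have finI: "finite I" "I \<noteq> {}" using P(2) D(2) k by (auto simp: I_def)
  have N_leI: "N X \<le> c" if "\<And>g h i j. g \<in> P \<Longrightarrow> h \<in> P \<Longrightarrow> i < k \<Longrightarrow> j < k \<Longrightarrow> cmod (T g X h $$ (i, j)) \<le> c" for X c
    unfolding N_def using finI that by (subst Max_le_iff) (auto simp: I_def)
  have N_geI: "cmod (T g X h $$ (i, j)) \<le> N X" if "g \<in> P" "h \<in> P" "i < k" "j < k" for X g h i j
    unfolding N_def using finI that by (intro Max_ge) (force simp: I_def)+
  have N_nonneg: "N X \<ge> 0" for X
    using N_geI[OF D(2) D(2), of 0 0 X] k by (meson norm_ge_zero order_trans)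
  have n1: "N (g * X) \<le> N X" if g: "g \<in> P" and X: "X \<in> carrier_mat k k" for g X
  proof (rule N_leI)
    fix g' h i j assume a: "g' \<in> P" "h \<in> P" "i < k" "j < k"
    have "g' * (g * X) * h = (g' * g) * X * h" using D(1)[OF a(1)] D(1)[OF a(2)] D(1)[OF g] X by (simp add: assoc)
    then show "cmod (T g' (g * X) h $$ (i, j)) \<le> N X"
      using N_geI[OF D(3)[OF a(1) g] a(2-4)] by (simp add: T_def)
  qed
  have n2: "N (X * g) \<le> N X" if g: "g \<in> P" and X: "X \<in> carrier_mat k k" for g X
  proof (rule N_leI)
    fix g' h i j assume a: "g' \<in> P" "h \<in> P" "i < k" "j < k"
    have "g' * (X * g) * h = g' * X * (g * h)" using D(1)[OF a(1)] D(1)[OF a(2)] D(1)[OF g] X by (simp add: assoc)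
    then show "cmod (T g' (X * g) h $$ (i, j)) \<le> N X"
      using N_geI[OF a(1) D(3)[OF g a(2)] a(3,4)] by (simp add: T_def)
  qed
  have n3: "N (X - Y) \<le> N X + N Y" if X: "X \<in> carrier_mat k k" "Y \<in> carrier_mat k k" for X Y
  proof (rule N_leI)
    fix g h i j assume a: "g \<in> P" "h \<in> P" "i < k" "j < k"
    have c: "g \<in> carrier_mat k k" "h \<in> carrier_mat k k" using a D(1) by auto
    have "T g (X - Y) h = T g X h - T g Y h"
      unfolding T_def using c X LM(1,2)
      by (simp add: minus_mult_distrib_mat[of _ k k _ _ k] mult_minus_distrib_mat[of _ k k _ k] minus_carrier_mat)
    then have "T g (X - Y) h $$ (i, j) = T g X h $$ (i, j) - T g Y h $$ (i, j)"
      using carrier_matD[OF Tc] a by simp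
    then show "cmod (T g (X - Y) h $$ (i, j)) \<le> N X + N Y"
      using norm_triangle_ineq4[of "T g X h $$ (i, j)" "T g Y h $$ (i, j)"]
        N_geI[OF a, of X] N_geI[OF a, of Y] by simp
  qed
  have n4: "N (X * Y) \<le> real k * N X * N Y" if X: "X \<in> carrier_mat k k" "Y \<in> carrier_mat k k" for X Y
  proof (rule N_leI)
    fix g h i j assume a: "g \<in> P" "h \<in> P" "i < k" "j < k"
    have c: "g \<in> carrier_mat k k" "h \<in> carrier_mat k k" using a D(1) by auto
    \<comment> \<open>The changes of basis cancel in the middle, so that each factor receives one of
      the two translations; \<open>k\<close> comes from the matrix product.\<close>
    have "T g X (1\<^sub>m k) * T (1\<^sub>m k) Y h = L * (g * X) * (M * L) * (Y * h) * M"
      unfolding T_def using c X LM(1,2) by (simp add: assoc)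
    also have "\<dots> = T g (X * Y) h" unfolding LM(4) T_def using c X LM(1,2) by (simp add: assoc)
    finally have e: "T g (X * Y) h = T g X (1\<^sub>m k) * T (1\<^sub>m k) Y h" by simp
    show "cmod (T g (X * Y) h $$ (i, j)) \<le> real k * N X * N Y"
      unfolding e using a D(2) by (intro cmod_mult_mat_entry_le Tc N_geI)
  qed
  have n5: "cmod c \<le> N (c \<cdot>\<^sub>m 1\<^sub>m k)" for c
  proof -
    have "T (1\<^sub>m k) (c \<cdot>\<^sub>m 1\<^sub>m k) (1\<^sub>m k) = L * (c \<cdot>\<^sub>m 1\<^sub>m k) * M"
      unfolding T_def by (simp add: left_mult_one_mat[of _ k k] right_mult_one_mat[of _ k k])
    also have "\<dots> = c \<cdot>\<^sub>m 1\<^sub>m k"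
      using LM mult_smult_distrib[OF LM(1) one_carrier_mat] mult_smult_assoc_mat[OF LM(1,2)] by simp
    finally show ?thesis using N_geI[OF D(2) D(2) k k, of "c \<cdot>\<^sub>m 1\<^sub>m k"] k by simp
  qed
  have n6: "0 < N X" if X: "X \<in> carrier_mat k k" "X \<noteq> 0\<^sub>m k k" for X
  proof (rule ccontr)
    assume "\<not> 0 < N X"
    then have N0: "N X = 0" using N_nonneg[of X] by simp
    have "T (1\<^sub>m k) X (1\<^sub>m k) = 0\<^sub>m k k"
    proof (rule eq_matI)
      fix i j assume "i < dim_row (0\<^sub>m k k :: complex mat)" "j < dim_col (0\<^sub>m k k :: complex mat)"
      then show "T (1\<^sub>m k) X (1\<^sub>m k) $$ (i, j) = 0\<^sub>m k k $$ (i, j)"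
        using N_geI[OF D(2) D(2), of i j X] N0 by simp
    qed (use carrier_matD[OF Tc] in auto)
    then have z: "L * X * M = 0\<^sub>m k k" using X by (simp add: T_def)
    have "X = (M * L) * X * (M * L)" using LM(4) X by simp
    also have "\<dots> = M * (L * X * M) * L" using LM(1,2) X(1) by (simp add: assoc)
    also have "\<dots> = 0\<^sub>m k k" unfolding z using LM(1,2) by simp
    finally show False using X(2) by simp
  qed
  have n7: "N X \<le> real k * (real k * c)"
    if X: "X \<in> carrier_mat k k" and b: "\<And>i j. i < k \<Longrightarrow> j < k \<Longrightarrow> cmod ((L * X * M) $$ (i, j)) \<le> c" for X c
  proof (rule N_leI)
    fix g h i j assume a: "g \<in> P" "h \<in> P" "i < k" "j < k"
    have c: "g \<in> carrier_mat k k" "h \<in> carrier_mat k k" using a D(1) by auto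
    \<comment> \<open>Inserting \<open>M * L\<close> splits the translate into three matrices, the
      outer two with entries of modulus at most one. Each of the two products costs a factor
      \<open>k\<close>.\<close>
    have "L * g * M * ((L * X * M) * (L * h * M)) = L * g * (M * L) * X * (M * L) * h * M"
      using LM(1,2) X c by (simp add: assoc)
    also have "\<dots> = T g X h" unfolding LM(4) T_def using LM(1,2) X c by (simp add: assoc)
    finally have e: "T g X h = L * g * M * ((L * X * M) * (L * h * M))" by simp
    have "cmod (T g X h $$ (i, j)) \<le> real k * 1 * (real k * c * 1)"
      unfolding e using LM(1,2) c X a b
      by (intro cmod_mult_mat_entry_le[where k = k] ent) auto
    then show "cmod (T g X h $$ (i, j)) \<le> real k * (real k * c)" by simp
  qed
  show thesis by (rule that[OF LM(1,2) n1 n2 n3 n4 n5 n6 n7 ent])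
qed

text \<open>Pigeonhole on the matrices in the basis with bounded entries. If two elements fall into
  the same cell of a fine grid, their quotient is near the identity, hence scalar, and their
  projective classes agree. The number of cells depends on \<open>k\<close> alone, as \<epsilon> and
  \<open>K\<close> do.\<close>

theorem Jordan_primitive_bound:
  "\<exists>C. \<forall>P. subgroup P (GL k) \<and> finite P \<and> acts_primitively k P (carrier_vec k) \<longrightarrow>
     card (projective_image (carrier_vec k) P) \<le> C"
proof (cases "k = 0")
  case True
  have "\<not> acts_primitively k P (carrier_vec k)" for P
    using True by (auto simp: acts_primitively_def acts_irreducibly_def)
  then show ?thesis by blast
next
  case False
  then have k: "k > 0" by simp
  obtain \<epsilon>0 where \<epsilon>0: "\<epsilon>0 > 0" "\<And>\<zeta>::complex. \<zeta> ^ k = 1 \<Longrightarrow> cmod (\<zeta> - 1) < \<epsilon>0 \<Longrightarrow> \<zeta> = 1"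
    using root_unity_gap[OF k] by blast
  \<comment> \<open>The first bound separates one from the other \<open>k\<close>-th roots of unity,
    the second makes commutators contract.\<close>
  define \<epsilon> where "\<epsilon> = min \<epsilon>0 (1 / (2 * real k))"
  have \<epsilon>: "\<epsilon> > 0" "2 * real k * \<epsilon> \<le> 1" "\<And>\<zeta>::complex. \<zeta> ^ k = 1 \<Longrightarrow> cmod (\<zeta> - 1) < \<epsilon> \<Longrightarrow> \<zeta> = 1"
  proof -
    show "\<epsilon> > 0" using \<epsilon>0(1) k by (simp add: \<epsilon>_def)
    have "\<epsilon> \<le> 1 / (2 * real k)" by (simp add: \<epsilon>_def)
    then show "2 * real k * \<epsilon> \<le> 1" using k by (simp add: field_simps)
    show "\<And>\<zeta>::complex. \<zeta> ^ k = 1 \<Longrightarrow> cmod (\<zeta> - 1) < \<epsilon> \<Longrightarrow> \<zeta> = 1" using \<epsilon>0(2) by (simp add: \<epsilon>_def)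
  qed
  \<comment> \<open>Entries in the same cell of side 1/K differ by at most 2/K in modulus, and
    passing to \<open>N\<close> costs at most the factor k squared.\<close>
  obtain K :: nat where "real K > 2 * real k * real k / \<epsilon>" using reals_Archimedean2 by blast
  then have K: "real k * (real k * (2 / real K)) < \<epsilon>" "real K > 0"
  proof -
    have "2 * real k * real k / \<epsilon> > 0" using k \<epsilon>(1) by simp
    then show "real K > 0" using \<open>real K > 2 * real k * real k / \<epsilon>\<close> by linarith
    then show "real k * (real k * (2 / real K)) < \<epsilon>"
      using \<open>real K > 2 * real k * real k / \<epsilon>\<close> \<epsilon>(1) by (simp add: field_simps)
  qed
  define Z where "Z = ({..<k} \<times> {..<k}) \<rightarrow>\<^sub>E ({- int K..int K} \<times> {- int K..int K})"
  have finZ: "finite Z" unfolding Z_def by (intro finite_PiE) auto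
  have "card (projective_image (carrier_vec k) P) \<le> card Z"
    if P: "subgroup P (GL k)" "finite P" "acts_primitively k P (carrier_vec k)" for P
  proof -
    have irr: "acts_irreducibly k P (carrier_vec k)" using P(3) by (simp add: acts_primitively_def)
    obtain L M and N :: "complex mat \<Rightarrow> real" where LM: "L \<in> carrier_mat k k" "M \<in> carrier_mat k k"
      and N: "\<And>g X. g \<in> P \<Longrightarrow> X \<in> carrier_mat k k \<Longrightarrow> N (g * X) \<le> N X"
      "\<And>g X. g \<in> P \<Longrightarrow> X \<in> carrier_mat k k \<Longrightarrow> N (X * g) \<le> N X"
      "\<And>X Y. X \<in> carrier_mat k k \<Longrightarrow> Y \<in> carrier_mat k k \<Longrightarrow> N (X - Y) \<le> N X + N Y"
      "\<And>X Y. X \<in> carrier_mat k k \<Longrightarrow> Y \<in> carrier_mat k k \<Longrightarrow> N (X * Y) \<le> real k * N X * N Y"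
      "\<And>c. cmod c \<le> N (c \<cdot>\<^sub>m 1\<^sub>m k)"
      "\<And>X. X \<in> carrier_mat k k \<Longrightarrow> X \<noteq> 0\<^sub>m k k \<Longrightarrow> 0 < N X"
      and N_entries: "\<And>X c. X \<in> carrier_mat k k \<Longrightarrow> (\<And>i j. i < k \<Longrightarrow> j < k \<Longrightarrow> cmod ((L * X * M) $$ (i, j)) \<le> c) \<Longrightarrow>
      N X \<le> real k * (real k * c)"
      and ent: "\<And>g i j. g \<in> P \<Longrightarrow> i < k \<Longrightarrow> j < k \<Longrightarrow> cmod ((L * g * M) $$ (i, j)) \<le> 1"
    proof (rule primitive_translation_norm[OF P(1,2) irr k])
      fix L M and N :: "complex mat \<Rightarrow> real"
      assume * : "L \<in> carrier_mat k k" "M \<in> carrier_mat k k"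
    "\<And>g X. g \<in> P \<Longrightarrow> X \<in> carrier_mat k k \<Longrightarrow> N (g * X) \<le> N X"
    "\<And>g X. g \<in> P \<Longrightarrow> X \<in> carrier_mat k k \<Longrightarrow> N (X * g) \<le> N X"
    "\<And>X Y. X \<in> carrier_mat k k \<Longrightarrow> Y \<in> carrier_mat k k \<Longrightarrow> N (X - Y) \<le> N X + N Y"
    "\<And>X Y. X \<in> carrier_mat k k \<Longrightarrow> Y \<in> carrier_mat k k \<Longrightarrow> N (X * Y) \<le> real k * N X * N Y"
    "\<And>c. cmod c \<le> N (c \<cdot>\<^sub>m 1\<^sub>m k)"
    "\<And>X. X \<in> carrier_mat k k \<Longrightarrow> X \<noteq> 0\<^sub>m k k \<Longrightarrow> 0 < N X"
    "\<And>X c. X \<in> carrier_mat k k \<Longrightarrow> (\<And>i j. i < k \<Longrightarrow> j < k \<Longrightarrow> cmod ((L * X * M) $$ (i, j)) \<le> c) \<Longrightarrow>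
      N X \<le> real k * (real k * c)"
    "\<And>g i j. g \<in> P \<Longrightarrow> i < k \<Longrightarrow> j < k \<Longrightarrow> cmod ((L * g * M) $$ (i, j)) \<le> 1"
      show thesis by (rule that[OF *])
    qed
    note D = subgroup_GL_D[OF P(1)]
    define x where "x g p = (L * g * M) $$ p" for g p
    define cell where "cell g = (\<lambda>p\<in>{..<k} \<times> {..<k}. (\<lfloor>real K * Re (x g p)\<rfloor>, \<lfloor>real K * Im (x g p)\<rfloor>))" for g
    define \<pi> where "\<pi> g = proj_class (carrier_vec k) g" for g
    \<comment> \<open>Both endpoints belong to the range, as the real or imaginary part of an entry
      may equal one.\<close>
    have fl: "\<lfloor>real K * t\<rfloor> \<in> {- int K..int K}" if "\<bar>t\<bar> \<le> 1" for t
    proof -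
      have "- real K \<le> real K * t" "real K * t \<le> real K"
        using that K(2) mult_left_mono[of "-1" t "real K"] mult_left_mono[of t 1 "real K"] by auto
      then show ?thesis by (simp add: le_floor_iff floor_le_iff)
    qed
    have "cell g \<in> Z" if "g \<in> P" for g
    proof -
      have "\<lfloor>real K * Re (x g p)\<rfloor> \<in> {- int K..int K} \<and> \<lfloor>real K * Im (x g p)\<rfloor> \<in> {- int K..int K}"
        if "p \<in> {..<k} \<times> {..<k}" for p
        using ent[OF \<open>g \<in> P\<close>, of "fst p" "snd p"] that abs_Re_le_cmod[of "x g p"] abs_Im_le_cmod[of "x g p"]
        by (intro conjI fl) (auto simp: x_def)
      then show ?thesis unfolding Z_def cell_def by (auto simp: PiE_iff)
    qed
    then have "card (cell ` P) \<le> card Z" by (intro card_mono finZ) auto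
    moreover have "\<pi> g = \<pi> g'" if g: "g \<in> P" "g' \<in> P" and eq: "cell g = cell g'" for g g'
    proof -
      have c: "g \<in> carrier_mat k k" "g' \<in> carrier_mat k k" using g D(1) by auto
      obtain h where h: "h \<in> P" "h * g = 1\<^sub>m k" "g * h = 1\<^sub>m k" using D(4)[OF g(1)] by blast
      have hc: "h \<in> carrier_mat k k" using h D(1) by auto
      have "cmod ((L * (g' - g) * M) $$ (i, j)) \<le> 2 / real K" if ij: "i < k" "j < k" for i j
      proof -
        have "cell g (i, j) = cell g' (i, j)" using eq by simp
        then have "\<lfloor>real K * Re (x g (i, j))\<rfloor> = \<lfloor>real K * Re (x g' (i, j))\<rfloor>"
          "\<lfloor>real K * Im (x g (i, j))\<rfloor> = \<lfloor>real K * Im (x g' (i, j))\<rfloor>"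
          using ij by (auto simp: cell_def)
        then have "\<bar>Re (x g (i, j)) - Re (x g' (i, j))\<bar> \<le> 1 / real K"
          "\<bar>Im (x g (i, j)) - Im (x g' (i, j))\<bar> \<le> 1 / real K"
          using floor_eq_imp_close K(2) by blast+
        then have "cmod (x g' (i, j) - x g (i, j)) \<le> 1 / real K + 1 / real K"
          using cmod_le[of "x g' (i, j) - x g (i, j)"] by simp
        moreover have "L * (g' - g) * M = L * g' * M - L * g * M"
          using c LM by (simp add: minus_mult_distrib_mat[of _ k k _ _ k] mult_minus_distrib_mat[of _ k k _ k])
        ultimately show ?thesis using ij LM c by (simp add: x_def del: index_mult_mat(1))
      qed
      then have "N (g' - g) \<le> real k * (real k * (2 / real K))"
        using c by (intro N_entries) (auto intro: minus_carrier_mat)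
      then have "N (g' - g) < \<epsilon>" using K(1) by simp
      moreover have "h * g' - 1\<^sub>m k = h * (g' - g)"
        using mult_minus_distrib_mat[OF hc c(2,1)] h(2) by simp
      moreover have "N (h * (g' - g)) \<le> N (g' - g)" using N(1)[OF h(1)] c minus_carrier_mat by blast
      ultimately have "N (h * g' - 1\<^sub>m k) < \<epsilon>" by simp
      then obtain c0 where c0: "h * g' = c0 \<cdot>\<^sub>m 1\<^sub>m k"
        using small_element_scalar[OF P N \<epsilon>(2,3) D(3)[OF h(1) g(2)]] by blast
      have hg': "h * g' \<in> carrier_mat k k" using hc c by simp
      have "g' = g * (h * g')" using assoc_mult_mat[OF c(1) hc c(2)] h(3) c by simp
      then have gw: "g' *\<^sub>v w = c0 \<cdot>\<^sub>v (g *\<^sub>v w)" if w: "w \<in> carrier_vec k" for w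
      proof -
        have "g' *\<^sub>v w = g *\<^sub>v ((h * g') *\<^sub>v w)"
          using \<open>g' = g * (h * g')\<close> assoc_mult_mat_vec[OF c(1) hg' w] by simp
        also have "(h * g') *\<^sub>v w = c0 \<cdot>\<^sub>v w" using scalar_mat_iff[OF hg', of c0] c0 w by blast
        finally show ?thesis using mult_mat_vec[OF c(1) w] by simp
      qed
      have "c0 \<noteq> 0"
      proof
        assume "c0 = 0"
        then have "h * g' = 0\<^sub>m k k" using c0 by auto
        then have "g' = 0\<^sub>m k k" using \<open>g' = g * (h * g')\<close> c by simp
        moreover obtain h' where "h' * g' = 1\<^sub>m k" "h' \<in> P" using D(4)[OF g(2)] by blast
        ultimately have "1\<^sub>m k = (0\<^sub>m k k :: complex mat)" using D(1)[OF \<open>h' \<in> P\<close>] by simp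
        then have "(1\<^sub>m k :: complex mat) $$ (0, 0) = 0\<^sub>m k k $$ (0, 0)" by simp
        then show False using k by simp
      qed
      have "\<pi> g' = \<pi> g" unfolding \<pi>_def proj_class_eq_iff using gw \<open>c0 \<noteq> 0\<close> by (intro exI[of _ c0]) simp
      then show ?thesis by simp
    qed
    then have "card (\<pi> ` P) \<le> card (cell ` P)"
      using card_image_le_factor[of cell P \<pi>] P(2) by blast
    moreover have "projective_image (carrier_vec k) P = \<pi> ` P" by (simp add: projective_image_eq \<pi>_def)
    ultimately show ?thesis by simp
  qed
  then show ?thesis by blast
qed

lemma card_primitive_PGL_le_JC:
  assumes "H \<in> primitive_PGL_subgroups k"
  shows "card H \<le> JC k"
proof -
  obtain C where C: "\<And>P. subgroup P (GL k) \<and> finite P \<and> acts_primitively k P (carrier_vec k) \<Longrightarrow>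
     card (projective_image (carrier_vec k) P) \<le> C" using Jordan_primitive_bound by metis
  have "card ` primitive_PGL_subgroups k \<subseteq> {..C}" unfolding primitive_PGL_subgroups_def using C by auto
  then have "finite (card ` primitive_PGL_subgroups k)" using finite_subset by blast
  then show ?thesis unfolding JC_def using assms by (intro Max_ge) auto
qed

section \<open>Restriction to a coordinate subspace\<close>

definition coord_subspace :: "nat \<Rightarrow> nat set \<Rightarrow> complex vec set" where
  "coord_subspace r T = {v \<in> carrier_vec r. \<forall>t<r. t \<notin> T \<longrightarrow> v $ t = 0}"

lemma coord_subspace_is_subspace: "is_subspace r (coord_subspace r T)"
  unfolding is_subspace_iff coord_subspace_def by auto

lemma mat_eqI_vec:
  fixes A :: "complex mat"
  assumes "A \<in> carrier_mat m n" "B \<in> carrier_mat m n" "\<And>v. v \<in> carrier_vec n \<Longrightarrow> A *\<^sub>v v = B *\<^sub>v v"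
  shows "A = B"
proof (rule mat_col_eqI)
  fix j assume "j < dim_col B"
  then have "j < n" using assms(2) by simp
  then show "col A j = col B j"
    using assms(3)[of "unit_vec n j"] assms(1,2) by (simp add: mult_mat_unit_vec)
qed (use assms in auto)

text \<open>\<open>JC\<close> concerns groups acting on a full space of column vectors, so the
  action is transported there: \<open>\<rho> g\<close> is the submatrix of \<open>g\<close> with
  rows and columns in \<open>T\<close>. On elements stabilizing the subspace \<rho> is
  multiplicative, and stable subspaces as well as systems of imprimitivity correspond along
  \<open>emb\<close>.\<close>

lemma card_projective_image_le_JC:
  assumes S: "subgroup S (GL r)" "finite S" and T: "T \<subseteq> {..<r}"
    and stab: "\<And>g. g \<in> S \<Longrightarrow> image_under g (coord_subspace r T) = coord_subspace r T"
    and prim: "acts_primitively r S (coord_subspace r T)"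
  shows "card (projective_image (coord_subspace r T) S) \<le> JC (card T)"
proof -
  note D = subgroup_GL_D[OF S(1)]
  define U where "U = coord_subspace r T"
  define k where "k = card T"
  have fT: "finite T" using T finite_subset by blast
  obtain \<tau> where \<tau>: "bij_betw \<tau> {..<k} T"
    using ex_bij_betw_nat_finite[OF fT] by (auto simp: k_def atLeast0LessThan)
  define \<iota> where "\<iota> = inv_into {..<k} \<tau>"
  have \<tau>T: "\<tau> a \<in> T" "\<tau> a < r" if "a < k" for a
    using \<tau> T that by (auto simp: bij_betw_def)
  have \<iota>: "t \<in> T \<Longrightarrow> \<iota> t < k" "t \<in> T \<Longrightarrow> \<tau> (\<iota> t) = t" "a < k \<Longrightarrow> \<iota> (\<tau> a) = a" for t a
    using \<tau> bij_betw_inv_into[OF \<tau>] unfolding \<iota>_def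
    by (auto simp: bij_betw_def f_inv_into_f)
  have Uc: "u \<in> carrier_vec r" "t < r \<Longrightarrow> t \<notin> T \<Longrightarrow> u $ t = 0" if "u \<in> U" for u t
    using that by (auto simp: U_def coord_subspace_def)
  define emb where "emb v = vec r (\<lambda>t. if t \<in> T then v $ \<iota> t else 0)" for v :: "complex vec"
  define res where "res u = vec k (\<lambda>a. u $ \<tau> a)" for u :: "complex vec"
  define \<rho> where "\<rho> g = mat k k (\<lambda>(a, b). g $$ (\<tau> a, \<tau> b))" for g :: "complex mat"
  have \<rho>c: "\<rho> g \<in> carrier_mat k k" for g by (simp add: \<rho>_def)
  have emb_U: "emb v \<in> U" for v by (auto simp: emb_def U_def coord_subspace_def)
  have res_c: "res u \<in> carrier_vec k" for u by (simp add: res_def)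
  have emb_res: "emb (res u) = u" if "u \<in> U" for u
    using Uc[OF that] \<iota> by (intro eq_vecI) (auto simp: emb_def res_def)
  have res_emb: "res (emb v) = v" if "v \<in> carrier_vec k" for v
    using that \<iota>(3) \<tau>T by (intro eq_vecI) (auto simp: emb_def res_def)
  have emb_add: "emb (v + w) = emb v + emb w" if "v \<in> carrier_vec k" "w \<in> carrier_vec k" for v w
    using that \<iota>(1) by (intro eq_vecI) (auto simp: emb_def)
  have emb_smult: "emb (c \<cdot>\<^sub>v v) = c \<cdot>\<^sub>v emb v" if "v \<in> carrier_vec k" for c v
    using that \<iota>(1) by (intro eq_vecI) (auto simp: emb_def)
  have emb_0: "emb (0\<^sub>v k) = 0\<^sub>v r" using \<iota>(1) by (intro eq_vecI) (auto simp: emb_def)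
  have emb_inj: "v = w" if "emb v = emb w" "v \<in> carrier_vec k" "w \<in> carrier_vec k" for v w
    using that res_emb by metis
  have emb_surj: "emb ` carrier_vec k = U" using emb_U emb_res res_c by (metis image_subset_iff subsetI subset_antisym image_eqI)
  have gU: "g *\<^sub>v u \<in> U" if "g \<in> S" "u \<in> U" for g u using stab[OF that(1)] that(2) by (auto simp: U_def)
  have \<rho>_res: "\<rho> g *\<^sub>v v = res (g *\<^sub>v emb v)" if g: "g \<in> S" and v: "v \<in> carrier_vec k" for g v
  proof (rule eq_vecI)
    fix a assume "a < dim_vec (res (g *\<^sub>v emb v))"
    then have a: "a < k" by (simp add: res_def)
    have ec: "emb v \<in> carrier_vec r" using Uc(1)[OF emb_U] .
    have "(g *\<^sub>v emb v) $ \<tau> a = (\<Sum>t<r. g $$ (\<tau> a, t) * emb v $ t)"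
      by (rule mult_mat_vec_index[OF D(1)[OF g] ec \<tau>T(2)[OF a]])
    also have "\<dots> = (\<Sum>t\<in>T. g $$ (\<tau> a, t) * v $ \<iota> t)"
      using T by (intro sum.mono_neutral_cong_right) (auto simp: emb_def)
    also have "\<dots> = (\<Sum>b<k. g $$ (\<tau> a, \<tau> b) * v $ \<iota> (\<tau> b))"
      by (rule sum.reindex_bij_betw[OF \<tau>, symmetric])
    also have "\<dots> = (\<Sum>b<k. \<rho> g $$ (a, b) * v $ b)"
      using a \<iota>(3) by (intro sum.cong) (auto simp: \<rho>_def)
    also have "\<dots> = (\<rho> g *\<^sub>v v) $ a" by (rule mult_mat_vec_index[OF \<rho>c v a, symmetric])
    finally show "(\<rho> g *\<^sub>v v) $ a = res (g *\<^sub>v emb v) $ a" using a by (simp add: res_def del: index_mult_mat_vec)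
  qed (simp add: res_def \<rho>_def)
  have emb_\<rho>: "emb (\<rho> g *\<^sub>v v) = g *\<^sub>v emb v" if "g \<in> S" "v \<in> carrier_vec k" for g v
    unfolding \<rho>_res[OF that] by (rule emb_res[OF gU[OF that(1) emb_U]])
  have \<rho>_mult: "\<rho> (g * h) = \<rho> g * \<rho> h" if "g \<in> S" "h \<in> S" for g h
  proof (rule mat_eqI_vec[of _ k k])
    fix v :: "complex vec" assume v: "v \<in> carrier_vec k"
    have hv: "\<rho> h *\<^sub>v v \<in> carrier_vec k" using \<rho>c v by (rule mult_mat_vec_carrier)
    have "\<rho> (g * h) *\<^sub>v v = res ((g * h) *\<^sub>v emb v)" by (rule \<rho>_res[OF D(3)[OF that] v])
    also have "(g * h) *\<^sub>v emb v = g *\<^sub>v (h *\<^sub>v emb v)"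
      by (rule assoc_mult_mat_vec[OF D(1)[OF that(1)] D(1)[OF that(2)] Uc(1)[OF emb_U]])
    also have "h *\<^sub>v emb v = emb (\<rho> h *\<^sub>v v)" using emb_\<rho>[OF that(2) v] by (rule sym)
    also have "res (g *\<^sub>v emb (\<rho> h *\<^sub>v v)) = \<rho> g *\<^sub>v (\<rho> h *\<^sub>v v)" using \<rho>_res[OF that(1) hv] by (rule sym)
    also have "\<dots> = (\<rho> g * \<rho> h) *\<^sub>v v" using assoc_mult_mat_vec[OF \<rho>c \<rho>c v] by (rule sym)
    finally show "\<rho> (g * h) *\<^sub>v v = (\<rho> g * \<rho> h) *\<^sub>v v" .
  qed (use \<rho>c mult_carrier_mat[OF \<rho>c \<rho>c] in auto)
  have \<rho>_one: "\<rho> (1\<^sub>m r) = 1\<^sub>m k"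
    using \<tau>T \<iota>(3) by (intro eq_matI) (auto simp: \<rho>_def, metis)
  define P where "P = \<rho> ` S"
  have P: "subgroup P (GL k)"
    unfolding subgroup_GL_iff
  proof (intro conjI ballI)
    show "1\<^sub>m k \<in> P" unfolding P_def using \<rho>_one D(2) by (metis imageI)
  next
    fix g h assume "g \<in> P" "h \<in> P"
    then obtain g' h' where "g = \<rho> g'" "h = \<rho> h'" "g' \<in> S" "h' \<in> S" unfolding P_def by blast
    then show "g * h \<in> P" unfolding P_def using \<rho>_mult D(3) by (metis imageI)
  next
    fix g assume "g \<in> P"
    then obtain g' where g': "g = \<rho> g'" "g' \<in> S" unfolding P_def by blast
    obtain h' where h': "h' \<in> S" "h' * g' = 1\<^sub>m r" "g' * h' = 1\<^sub>m r" using D(4)[OF g'(2)] by blast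
    show "\<exists>h\<in>P. h * g = 1\<^sub>m k \<and> g * h = 1\<^sub>m k"
    proof (intro bexI conjI)
      show "\<rho> h' * g = 1\<^sub>m k" unfolding g'(1) \<rho>_mult[OF h'(1) g'(2), symmetric] h'(2) by (rule \<rho>_one)
      show "g * \<rho> h' = 1\<^sub>m k" unfolding g'(1) \<rho>_mult[OF g'(2) h'(1), symmetric] h'(3) by (rule \<rho>_one)
      show "\<rho> h' \<in> P" unfolding P_def using h'(1) by (rule imageI)
    qed
  qed (use \<rho>c in \<open>auto simp: P_def\<close>)
  have emb_image: "image_under g (emb ` X) = emb ` image_under (\<rho> g) X"
    if "g \<in> S" "X \<subseteq> carrier_vec k" for g X
    unfolding image_image using emb_\<rho>[OF that(1)] that(2) by (intro image_cong) auto
  have emb_sub: "is_subspace r (emb ` X)" if "is_subspace k X" for X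
  proof -
    have X: "X \<subseteq> carrier_vec k" "0\<^sub>v k \<in> X" "\<And>u v. u \<in> X \<Longrightarrow> v \<in> X \<Longrightarrow> u + v \<in> X" "\<And>c u. u \<in> X \<Longrightarrow> c \<cdot>\<^sub>v u \<in> X"
      using that unfolding is_subspace_iff by blast+
    show ?thesis
      unfolding is_subspace_iff
    proof (intro conjI ballI allI)
      show "emb ` X \<subseteq> carrier_vec r" using Uc(1)[OF emb_U] by blast
      show "0\<^sub>v r \<in> emb ` X" using emb_0 X(2) by (metis imageI)
    next
      fix u v assume "u \<in> emb ` X" "v \<in> emb ` X"
      then obtain u' v' where "u = emb u'" "v = emb v'" "u' \<in> X" "v' \<in> X" by blast
      then show "u + v \<in> emb ` X" using emb_add[of u' v'] X(1,3) by (metis imageI subsetD)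
    next
      fix c u assume "u \<in> emb ` X"
      then obtain u' where "u = emb u'" "u' \<in> X" by blast
      then show "c \<cdot>\<^sub>v u \<in> emb ` X" using emb_smult[of u' c] X(1,4) by (metis imageI subsetD)
    qed
  qed
  have emb_image_inj: "X = Y" if "emb ` X = emb ` Y" "X \<subseteq> carrier_vec k" "Y \<subseteq> carrier_vec k" for X Y
    using inj_on_image_eq_iff[of emb "carrier_vec k" X Y] emb_inj that by (auto simp: inj_on_def)
  have irr: "acts_irreducibly r S U" using prim by (simp add: acts_primitively_def U_def)
  have sub_car: "is_subspace k (carrier_vec k)" unfolding is_subspace_iff by auto
  have "acts_irreducibly k P (carrier_vec k)"
    unfolding acts_irreducibly_def
  proof (intro conjI allI impI)
    show "is_subspace k (carrier_vec k)" by (rule sub_car)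
    show "stable P (carrier_vec k)" unfolding stable_def P_def using \<rho>c by (auto intro: mult_mat_vec_carrier)
    show "carrier_vec k \<noteq> {0\<^sub>v k :: complex vec}"
    proof
      assume "carrier_vec k = {0\<^sub>v k :: complex vec}"
      then have "U = {0\<^sub>v r}" using emb_surj emb_0 by simp
      then show False using irr by (simp add: acts_irreducibly_def)
    qed
  next
    fix X assume X: "is_subspace k X \<and> X \<subseteq> carrier_vec k \<and> stable P X"
    have "stable S (emb ` X)"
      unfolding stable_def
    proof
      fix g assume g: "g \<in> S"
      have "image_under (\<rho> g) X \<subseteq> X" using X g by (auto simp: stable_def P_def)
      then show "image_under g (emb ` X) \<subseteq> emb ` X" using emb_image[OF g] X by (simp add: image_mono)
    qed
    moreover have "is_subspace r (emb ` X)" "emb ` X \<subseteq> U" using emb_sub X emb_U by auto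
    ultimately have "emb ` X = {0\<^sub>v r} \<or> emb ` X = U" using irr unfolding acts_irreducibly_def by blast
    then have "emb ` X = emb ` {0\<^sub>v k} \<or> emb ` X = emb ` carrier_vec k" using emb_0 emb_surj by simp
    then show "X = {0\<^sub>v k} \<or> X = carrier_vec k" using emb_image_inj X by (metis empty_subsetI insert_subset order_refl zero_carrier_vec)
  qed
  \<comment> \<open>\<open>emb\<close> carries a system of imprimitivity for the submatrices to one
    for \<open>S\<close> on the subspace.\<close>
  moreover have "\<not> (\<exists>I X. internal_direct_sum k (carrier_vec k) I X \<and> (\<forall>i\<in>I. X i \<subset> carrier_vec k) \<and> permutes_subspaces P I X)"
  proof
    assume "\<exists>I X. internal_direct_sum k (carrier_vec k) I X \<and> (\<forall>i\<in>I. X i \<subset> carrier_vec k) \<and> permutes_subspaces P I X"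
    then obtain I X where ids: "internal_direct_sum k (carrier_vec k) I X"
      and pr: "\<And>i. i \<in> I \<Longrightarrow> X i \<subset> carrier_vec k" and pm: "permutes_subspaces P I X" by blast
    have ids': "finite I" "\<And>i. i \<in> I \<Longrightarrow> is_subspace k (X i)"
      "\<And>w. w \<in> carrier_vec k \<Longrightarrow> \<exists>u. (\<forall>i\<in>I. u i \<in> X i) \<and> w = vsum k u I"
      "\<And>u. (\<forall>i\<in>I. u i \<in> X i) \<Longrightarrow> vsum k u I = 0\<^sub>v k \<Longrightarrow> (\<forall>i\<in>I. u i = 0\<^sub>v k)"
      using ids unfolding internal_direct_sum_iff by blast+
    have emb_vsum: "emb (vsum k u J) = vsum r (\<lambda>i. emb (u i)) J" if "\<And>i. i \<in> J \<Longrightarrow> u i \<in> carrier_vec k" for u and J :: "nat set"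
    proof (rule eq_vecI)
      fix t assume "t < dim_vec (vsum r (\<lambda>i. emb (u i)) J)"
      then show "emb (vsum k u J) $ t = vsum r (\<lambda>i. emb (u i)) J $ t" using \<iota>(1) by (simp add: emb_def)
    qed (simp add: emb_def)
    have "internal_direct_sum r U I (\<lambda>i. emb ` X i)"
      unfolding internal_direct_sum_iff
    proof (intro conjI ballI allI impI)
      show "finite I" by (rule ids'(1))
      show sU: "is_subspace r U" unfolding U_def by (rule coord_subspace_is_subspace)
      show "is_subspace r (emb ` X i)" if "i \<in> I" for i using emb_sub ids'(2)[OF that] .
      have eU: "emb ` X i \<subseteq> U" for i using emb_U by (rule image_subsetI)
      show "vsum r u I \<in> U" if "\<forall>i\<in>I. u i \<in> emb ` X i" for u
        by (rule subspace_vsum_closed[OF sU ids'(1) subsetD[OF eU]]) (rule that[rule_format])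
    next
      fix w assume w: "w \<in> U"
      obtain u where u: "\<forall>i\<in>I. u i \<in> X i" "res w = vsum k u I" using ids'(3)[OF res_c] by blast
      have "w = emb (vsum k u I)" using emb_res[OF w] u(2) by simp
      also have "\<dots> = vsum r (\<lambda>i. emb (u i)) I" using u(1) pr by (intro emb_vsum) blast
      finally show "\<exists>u. (\<forall>i\<in>I. u i \<in> emb ` X i) \<and> w = vsum r u I"
        using u(1) by (intro exI[of _ "\<lambda>i. emb (u i)"]) blast
    next
      fix u i assume u: "(\<forall>i\<in>I. u i \<in> emb ` X i) \<and> vsum r u I = 0\<^sub>v r" and i: "i \<in> I"
      then have "\<forall>i\<in>I. \<exists>x\<in>X i. u i = emb x" by blast
      then obtain x where x: "\<forall>i\<in>I. x i \<in> X i \<and> u i = emb (x i)" by metis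
      have "emb (vsum k x I) = vsum r (\<lambda>i. emb (x i)) I" using x pr by (intro emb_vsum) blast
      also have "\<dots> = vsum r u I" using x by (intro vsum_cong) simp
      also have "\<dots> = emb (0\<^sub>v k)" using u emb_0 by simp
      finally have "vsum k x I = 0\<^sub>v k" by (rule emb_inj) simp_all
      then have "x i = 0\<^sub>v k" using ids'(4) x i by blast
      then show "u i = 0\<^sub>v r" using x i emb_0 by simp
    qed
    moreover have "\<forall>i\<in>I. emb ` X i \<subset> U"
    proof
      fix i assume i: "i \<in> I"
      have "emb ` X i \<noteq> emb ` carrier_vec k" using emb_image_inj[of "X i" "carrier_vec k"] pr[OF i] by blast
      then show "emb ` X i \<subset> U" using emb_U emb_surj by blast
    qed
    moreover have "permutes_subspaces S I (\<lambda>i. emb ` X i)"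
      unfolding permutes_subspaces_def
    proof
      fix g assume g: "g \<in> S"
      obtain p where p: "p permutes I" "\<forall>i\<in>I. image_under (\<rho> g) (X i) = X (p i)"
        using pm g unfolding permutes_subspaces_def P_def by blast
      have "image_under g (emb ` X i) = emb ` X (p i)" if "i \<in> I" for i
        using emb_image[OF g] pr[OF that] p(2) that by auto
      then show "\<exists>p. p permutes I \<and> (\<forall>i\<in>I. image_under g (emb ` X i) = emb ` X (p i))" using p(1) by blast
    qed
    ultimately show False using prim unfolding acts_primitively_def U_def by blast
  qed
  ultimately have primP: "acts_primitively k P (carrier_vec k)" by (simp add: acts_primitively_def)
  have finP: "finite P" using S(2) by (simp add: P_def)
  \<comment> \<open>Proportional submatrices come from elements that are proportional on the
    subspace, so no class is lost.\<close>
  have "card (proj_class U ` S) \<le> card ((\<lambda>g. proj_class (carrier_vec k) (\<rho> g)) ` S)"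
  proof (rule card_image_le_factor[THEN conjunct2])
    fix g g' assume g: "g \<in> S" "g' \<in> S" and "proj_class (carrier_vec k) (\<rho> g) = proj_class (carrier_vec k) (\<rho> g')"
    then obtain c where c: "c \<noteq> 0" "\<And>w. w \<in> carrier_vec k \<Longrightarrow> \<rho> g *\<^sub>v w = c \<cdot>\<^sub>v (\<rho> g' *\<^sub>v w)"
      unfolding proj_class_eq_iff by blast
    have "g *\<^sub>v u = c \<cdot>\<^sub>v (g' *\<^sub>v u)" if u: "u \<in> U" for u
    proof -
      have "g *\<^sub>v u = emb (\<rho> g *\<^sub>v res u)" using emb_\<rho>[OF g(1) res_c] emb_res[OF u] by simp
      also have "\<dots> = c \<cdot>\<^sub>v emb (\<rho> g' *\<^sub>v res u)"
        unfolding c(2)[OF res_c] by (rule emb_smult[OF mult_mat_vec_carrier[OF \<rho>c res_c]])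
      also have "\<dots> = c \<cdot>\<^sub>v (g' *\<^sub>v u)" using emb_\<rho>[OF g(2) res_c] emb_res[OF u] by simp
      finally show ?thesis .
    qed
    then show "proj_class U g = proj_class U g'" unfolding proj_class_eq_iff using c(1) by blast
  qed (use S(2) in simp)
  also have "(\<lambda>g. proj_class (carrier_vec k) (\<rho> g)) ` S = projective_image (carrier_vec k) P"
    by (simp add: projective_image_eq P_def image_image)
  also have "card \<dots> \<le> JC k"
    by (rule card_primitive_PGL_le_JC) (use P finP primP in \<open>auto simp: primitive_PGL_subgroups_def\<close>)
  finally show ?thesis by (simp add: projective_image_eq U_def k_def)
qed

section \<open>The polar form\<close>

definition mono_val :: "complex vec \<Rightarrow> monomial \<Rightarrow> complex" where
  "mono_val v \<mu> = (\<Prod>i\<in>Poly_Mapping.keys \<mu>. (v $ i) ^ Poly_Mapping.lookup \<mu> i)"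

lemma mono_val_superset:
  "finite S \<Longrightarrow> Poly_Mapping.keys \<mu> \<subseteq> S \<Longrightarrow> mono_val v \<mu> = (\<Prod>i\<in>S. (v $ i) ^ Poly_Mapping.lookup \<mu> i)"
  unfolding mono_val_def by (intro prod.mono_neutral_left) (auto simp: in_keys_iff)

lemma mono_val_add: "mono_val v (\<mu> + \<nu>) = mono_val v \<mu> * mono_val v \<nu>"
proof -
  let ?S = "Poly_Mapping.keys \<mu> \<union> Poly_Mapping.keys \<nu>"
  have "Poly_Mapping.keys (\<mu> + \<nu>) \<subseteq> ?S" by (rule Poly_Mapping.keys_add)
  then show ?thesis
    by (simp add: mono_val_superset[of ?S] lookup_add power_add prod.distrib)
qed

lemma eval_poly_at_superset:
  "finite S \<Longrightarrow> Poly_Mapping.keys F \<subseteq> S \<Longrightarrow>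
    eval_poly_at F v = (\<Sum>\<mu>\<in>S. Poly_Mapping.lookup F \<mu> * mono_val v \<mu>)"
  unfolding eval_poly_at_def mono_val_def by (intro sum.mono_neutral_left) (auto simp: in_keys_iff)

lemma eval_poly_at_add: "eval_poly_at (F + G) v = eval_poly_at F v + eval_poly_at G v"
proof -
  let ?S = "Poly_Mapping.keys F \<union> Poly_Mapping.keys G"
  have "Poly_Mapping.keys (F + G) \<subseteq> ?S" by (rule Poly_Mapping.keys_add)
  then show ?thesis
    by (simp add: eval_poly_at_superset[of ?S] lookup_add distrib_right sum.distrib)
qed

lemma eval_poly_at_zero [simp]: "eval_poly_at 0 v = 0"
  by (simp add: eval_poly_at_def)

lemma eval_poly_at_sum: "eval_poly_at (sum f S) v = (\<Sum>x\<in>S. eval_poly_at (f x) v)"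
  by (induction S rule: infinite_finite_induct) (simp_all add: eval_poly_at_add)

lemma eval_poly_at_single: "eval_poly_at (Poly_Mapping.single \<mu> c) v = c * mono_val v \<mu>"
  by (subst eval_poly_at_superset[of "{\<mu>}"]) auto

lemma poly_mapping_eq_sum_single:
  "F = (\<Sum>\<mu>\<in>Poly_Mapping.keys F. Poly_Mapping.single \<mu> (Poly_Mapping.lookup F \<mu>))"
  by (intro poly_mapping_eqI) (auto simp: lookup_sum lookup_single when_def in_keys_iff)

lemma eval_poly_at_mult: "eval_poly_at (F * G) v = eval_poly_at F v * eval_poly_at G v"
proof -
  have "F * G = (\<Sum>\<mu>\<in>Poly_Mapping.keys F. Poly_Mapping.single \<mu> (Poly_Mapping.lookup F \<mu>)) *
      (\<Sum>\<nu>\<in>Poly_Mapping.keys G. Poly_Mapping.single \<nu> (Poly_Mapping.lookup G \<nu>))"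
    by (simp flip: poly_mapping_eq_sum_single)
  also have "\<dots> = (\<Sum>\<mu>\<in>Poly_Mapping.keys F. \<Sum>\<nu>\<in>Poly_Mapping.keys G.
      Poly_Mapping.single (\<mu> + \<nu>) (Poly_Mapping.lookup F \<mu> * Poly_Mapping.lookup G \<nu>))"
    by (simp add: sum_product mult_single)
  finally have "eval_poly_at (F * G) v = (\<Sum>\<mu>\<in>Poly_Mapping.keys F. \<Sum>\<nu>\<in>Poly_Mapping.keys G.
      Poly_Mapping.lookup F \<mu> * Poly_Mapping.lookup G \<nu> * (mono_val v \<mu> * mono_val v \<nu>))"
    by (simp add: eval_poly_at_sum eval_poly_at_single mono_val_add)
  then show ?thesis
    by (simp add: eval_poly_at_superset[OF finite_keys order_refl] sum_product mult_ac)
qed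

lemma eval_poly_const [simp]: "eval_poly_at (poly_const c) v = c"
  by (simp add: poly_const_def eval_poly_at_single mono_val_def)

lemma eval_poly_var [simp]: "eval_poly_at (poly_var i) v = v $ i"
  by (simp add: poly_var_def eval_poly_at_single mono_val_def)

lemma eval_poly_at_one [simp]: "eval_poly_at 1 v = 1"
  using eval_poly_const[of 1 v] by (simp add: poly_const_def single_one)

lemma eval_poly_at_power: "eval_poly_at (F ^ n) v = eval_poly_at F v ^ n"
  by (induction n) (simp_all add: eval_poly_at_mult)

lemma eval_poly_at_prod: "eval_poly_at (prod f S) v = (\<Prod>x\<in>S. eval_poly_at (f x) v)"
  by (induction S rule: infinite_finite_induct) (simp_all add: eval_poly_at_mult)

lemma is_formD:
  assumes "is_form r d F" "\<mu> \<in> Poly_Mapping.keys F"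
  shows "Poly_Mapping.keys \<mu> \<subseteq> {..<r}" "total_degree \<mu> = d"
  using assms by (simp_all add: is_form_def)

text \<open>The \<open>k\<close>-th variable is replaced by the linear form of row \<open>k\<close>
  of \<open>A\<close>, so substitution is composition of the polynomial function with
  \<open>A\<close>.\<close>

lemma eval_linear_subst:
  assumes F: "is_form r d F" and A: "A \<in> carrier_mat r r" and v: "v \<in> carrier_vec r"
  shows "eval_poly_at (linear_subst r A F) v = eval_poly_at F (A *\<^sub>v v)"
proof -
  have e: "mono_val (A *\<^sub>v v) \<mu> = (\<Prod>k<r. (\<Sum>i<r. A $$ (k, i) * v $ i) ^ Poly_Mapping.lookup \<mu> k)"
    if "\<mu> \<in> Poly_Mapping.keys F" for \<mu>
  proof -
    have "Poly_Mapping.keys \<mu> \<subseteq> {..<r}" by (rule is_formD(1)[OF F that])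
    then show ?thesis
      unfolding mono_val_superset[OF finite_lessThan \<open>Poly_Mapping.keys \<mu> \<subseteq> {..<r}\<close>]
      using mult_mat_vec_index[OF A v] by (intro prod.cong) simp_all
  qed
  have "eval_poly_at (linear_subst r A F) v = (\<Sum>\<mu>\<in>Poly_Mapping.keys F. Poly_Mapping.lookup F \<mu> *
      (\<Prod>k<r. (\<Sum>i<r. A $$ (k, i) * v $ i) ^ Poly_Mapping.lookup \<mu> k))"
    by (simp add: linear_subst_def eval_poly_at_sum eval_poly_at_mult eval_poly_at_prod eval_poly_at_power)
  also have "\<dots> = eval_poly_at F (A *\<^sub>v v)"
    unfolding eval_poly_at_superset[OF finite_keys order_refl, of F] using e by (intro sum.cong) simp_all
  finally show ?thesis .
qed

text \<open>The derivative of \<open>F\<close> at the point \<open>v\<close> in the direction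
  \<open>w\<close>: for a form of degree \<open>d\<close>, homogeneous of degree
  \<open>d - 1\<close> in the point and linear in the direction.\<close>

definition polar :: "nat \<Rightarrow> cpoly \<Rightarrow> complex vec \<Rightarrow> complex vec \<Rightarrow> complex" where
  "polar r F v w = (\<Sum>u<r. eval_poly_at (partial_deriv u F) v * w $ u)"

lemma eval_partial_deriv:
  "eval_poly_at (partial_deriv i F) v =
    (\<Sum>\<mu>\<in>Poly_Mapping.keys F. of_nat (Poly_Mapping.lookup \<mu> i) * Poly_Mapping.lookup F \<mu> *
       mono_val v (\<mu> - Poly_Mapping.single i 1))"
  unfolding partial_deriv_def eval_poly_at_sum eval_poly_at_single ..

lemma lookup_minus_single:
  fixes \<mu> :: monomial
  shows "Poly_Mapping.lookup (\<mu> - Poly_Mapping.single i 1) j =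
    (if j = i then Poly_Mapping.lookup \<mu> j - 1 else Poly_Mapping.lookup \<mu> j)"
  by (simp add: lookup_minus lookup_single when_def)

lemma keys_minus_single_subset:
  fixes \<mu> :: monomial
  shows "Poly_Mapping.keys (\<mu> - Poly_Mapping.single i 1) \<subseteq> Poly_Mapping.keys \<mu>"
  by (intro subsetI) (simp add: in_keys_iff lookup_minus)

text \<open>This identifies the formal expression with a derivative along a line. Invariance under
  an automorphism of \<open>F\<close> then reduces to uniqueness of derivatives.\<close>

lemma polar_has_derivative:
  assumes F: "is_form r d F" and v: "v \<in> carrier_vec r" and w: "w \<in> carrier_vec r"
  shows "((\<lambda>t. eval_poly_at F (v + t \<cdot>\<^sub>v w)) has_field_derivative polar r F v w) (at 0)"
proof -
  define f where "f \<mu> i t = (v $ i + t * w $ i) ^ Poly_Mapping.lookup \<mu> i" for \<mu> :: monomial and i t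
  have "eval_poly_at F (v + t \<cdot>\<^sub>v w) = (\<Sum>\<mu>\<in>Poly_Mapping.keys F. Poly_Mapping.lookup F \<mu> * (\<Prod>i<r. f \<mu> i t))" for t
    unfolding eval_poly_at_superset[OF finite_keys order_refl]
  proof (intro sum.cong refl)
    fix \<mu> assume "\<mu> \<in> Poly_Mapping.keys F"
    then have k: "Poly_Mapping.keys \<mu> \<subseteq> {..<r}" by (rule is_formD(1)[OF F])
    have "(v + t \<cdot>\<^sub>v w) $ i = v $ i + t * w $ i" if "i < r" for i
      using that carrier_vecD[OF v] carrier_vecD[OF w] by simp
    then show "Poly_Mapping.lookup F \<mu> * mono_val (v + t \<cdot>\<^sub>v w) \<mu> = Poly_Mapping.lookup F \<mu> * (\<Prod>i<r. f \<mu> i t)"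
      unfolding mono_val_superset[OF finite_lessThan k] f_def
      by (intro arg_cong2[where f = "(*)"] prod.cong refl) simp_all
  qed
  moreover have "((\<lambda>t. \<Sum>\<mu>\<in>Poly_Mapping.keys F. Poly_Mapping.lookup F \<mu> * (\<Prod>i<r. f \<mu> i t)) has_field_derivative
     (\<Sum>\<mu>\<in>Poly_Mapping.keys F. Poly_Mapping.lookup F \<mu> *
       (\<Sum>i<r. of_nat (Poly_Mapping.lookup \<mu> i) * (v $ i) ^ (Poly_Mapping.lookup \<mu> i - 1) * w $ i *
          (\<Prod>j\<in>{..<r} - {i}. (v $ j) ^ Poly_Mapping.lookup \<mu> j)))) (at 0)"
  proof (intro DERIV_sum DERIV_cmult)
    fix \<mu> assume "\<mu> \<in> Poly_Mapping.keys F"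
    have "(f \<mu> i has_derivative (\<lambda>y. y * (of_nat (Poly_Mapping.lookup \<mu> i) * (v $ i) ^ (Poly_Mapping.lookup \<mu> i - 1) * w $ i))) (at 0)" for i
    proof -
      have "(f \<mu> i has_field_derivative (of_nat (Poly_Mapping.lookup \<mu> i) * (v $ i) ^ (Poly_Mapping.lookup \<mu> i - 1) * w $ i)) (at 0)"
        unfolding f_def by (auto intro!: derivative_eq_intros)
      then show ?thesis by (simp add: has_field_derivative_def mult_commute_abs)
    qed
    then have "((\<lambda>t. \<Prod>i<r. f \<mu> i t) has_derivative
      (\<lambda>y. \<Sum>i<r. (y * (of_nat (Poly_Mapping.lookup \<mu> i) * (v $ i) ^ (Poly_Mapping.lookup \<mu> i - 1) * w $ i)) *
         (\<Prod>j\<in>{..<r} - {i}. f \<mu> j 0))) (at 0)"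
      by (intro has_derivative_prod)
    then show "((\<lambda>t. \<Prod>i<r. f \<mu> i t) has_field_derivative
      (\<Sum>i<r. of_nat (Poly_Mapping.lookup \<mu> i) * (v $ i) ^ (Poly_Mapping.lookup \<mu> i - 1) * w $ i *
          (\<Prod>j\<in>{..<r} - {i}. (v $ j) ^ Poly_Mapping.lookup \<mu> j))) (at 0)"
      unfolding has_field_derivative_def
      by (rule has_derivative_eq_rhs) (auto simp: f_def sum_distrib_right sum_distrib_left mult_ac intro!: ext sum.cong)
  qed
  moreover have "(\<Sum>\<mu>\<in>Poly_Mapping.keys F. Poly_Mapping.lookup F \<mu> *
       (\<Sum>i<r. of_nat (Poly_Mapping.lookup \<mu> i) * (v $ i) ^ (Poly_Mapping.lookup \<mu> i - 1) * w $ i *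
          (\<Prod>j\<in>{..<r} - {i}. (v $ j) ^ Poly_Mapping.lookup \<mu> j))) = polar r F v w"
  proof -
    have "(of_nat (Poly_Mapping.lookup \<mu> i) :: complex) * (v $ i) ^ (Poly_Mapping.lookup \<mu> i - 1) *
          (\<Prod>j\<in>{..<r} - {i}. (v $ j) ^ Poly_Mapping.lookup \<mu> j) =
        of_nat (Poly_Mapping.lookup \<mu> i) * mono_val v (\<mu> - Poly_Mapping.single i 1)"
      if \<mu>: "\<mu> \<in> Poly_Mapping.keys F" and i: "i < r" for \<mu> i
    proof -
      have k: "Poly_Mapping.keys \<mu> \<subseteq> {..<r}" by (rule is_formD(1)[OF F \<mu>])
      have "Poly_Mapping.keys (\<mu> - Poly_Mapping.single i 1) \<subseteq> {..<r}"
        using k keys_minus_single_subset by blast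
      then have "mono_val v (\<mu> - Poly_Mapping.single i 1) =
         (\<Prod>j<r. (v $ j) ^ Poly_Mapping.lookup (\<mu> - Poly_Mapping.single i 1) j)"
        by (rule mono_val_superset[OF finite_lessThan])
      also have "\<dots> = (v $ i) ^ (Poly_Mapping.lookup \<mu> i - 1) * (\<Prod>j\<in>{..<r} - {i}. (v $ j) ^ Poly_Mapping.lookup \<mu> j)"
        using i by (subst prod.remove[of _ i]) (auto simp: lookup_minus_single[unfolded One_nat_def] intro!: prod.cong)
      finally show ?thesis by simp
    qed
    then have "(\<Sum>\<mu>\<in>Poly_Mapping.keys F. Poly_Mapping.lookup F \<mu> *
       (\<Sum>i<r. of_nat (Poly_Mapping.lookup \<mu> i) * (v $ i) ^ (Poly_Mapping.lookup \<mu> i - 1) * w $ i *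
          (\<Prod>j\<in>{..<r} - {i}. (v $ j) ^ Poly_Mapping.lookup \<mu> j))) =
      (\<Sum>\<mu>\<in>Poly_Mapping.keys F. \<Sum>i<r. Poly_Mapping.lookup F \<mu> *
        (of_nat (Poly_Mapping.lookup \<mu> i) * mono_val v (\<mu> - Poly_Mapping.single i 1)) * w $ i)"
      unfolding sum_distrib_left by (intro sum.cong refl) (simp add: mult_ac)
    also have "\<dots> = polar r F v w"
      unfolding polar_def eval_partial_deriv sum_distrib_right
      by (subst sum.swap) (intro sum.cong refl, simp add: mult_ac)
    finally show ?thesis .
  qed
  ultimately show ?thesis by simp
qed

lemma polar_invariant:
  assumes F: "is_form r d F" and A: "A \<in> carrier_mat r r" "linear_subst r A F = F"
    and v: "v \<in> carrier_vec r" and w: "w \<in> carrier_vec r"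
  shows "polar r F (A *\<^sub>v v) (A *\<^sub>v w) = polar r F v w"
proof -
  have "eval_poly_at F (A *\<^sub>v v + t \<cdot>\<^sub>v (A *\<^sub>v w)) = eval_poly_at F (v + t \<cdot>\<^sub>v w)" for t
  proof -
    have "A *\<^sub>v v + t \<cdot>\<^sub>v (A *\<^sub>v w) = A *\<^sub>v (v + t \<cdot>\<^sub>v w)"
      using A(1) v w by (simp add: mult_add_distrib_mat_vec[of _ r r] mult_mat_vec[of _ r r])
    then show ?thesis
      using eval_linear_subst[OF F A(1), of "v + t \<cdot>\<^sub>v w"] A(2) v w by simp
  qed
  then have "((\<lambda>t. eval_poly_at F (v + t \<cdot>\<^sub>v w)) has_field_derivative polar r F (A *\<^sub>v v) (A *\<^sub>v w)) (at 0)"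
    using polar_has_derivative[OF F, of "A *\<^sub>v v" "A *\<^sub>v w"] A(1) v w by simp
  then show ?thesis using polar_has_derivative[OF F v w] DERIV_unique by blast
qed

lemma polar_smult_left:
  assumes F: "is_form r d F" and v: "v \<in> carrier_vec r"
  shows "polar r F (c \<cdot>\<^sub>v v) w = c ^ (d - 1) * polar r F v w"
proof -
  have "eval_poly_at (partial_deriv i F) (c \<cdot>\<^sub>v v) = c ^ (d - 1) * eval_poly_at (partial_deriv i F) v" if i: "i < r" for i
    unfolding eval_partial_deriv sum_distrib_left
  proof (intro sum.cong refl)
    fix \<mu> assume \<mu>: "\<mu> \<in> Poly_Mapping.keys F"
    then have k: "Poly_Mapping.keys \<mu> \<subseteq> {..<r}" and deg: "total_degree \<mu> = d"
      using is_formD[OF F \<mu>] by simp_all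
    let ?\<nu> = "\<mu> - Poly_Mapping.single i 1"
    show "of_nat (Poly_Mapping.lookup \<mu> i) * Poly_Mapping.lookup F \<mu> * mono_val (c \<cdot>\<^sub>v v) ?\<nu> =
       c ^ (d - 1) * (of_nat (Poly_Mapping.lookup \<mu> i) * Poly_Mapping.lookup F \<mu> * mono_val v ?\<nu>)"
    \<comment> \<open>If the exponent is zero, the truncated difference has the wrong degree, but
      its coefficient vanishes.\<close>
    proof (cases "Poly_Mapping.lookup \<mu> i = 0")
      case False
      have k': "Poly_Mapping.keys ?\<nu> \<subseteq> {..<r}"
        using k keys_minus_single_subset by blast
      have "d = (\<Sum>j<r. Poly_Mapping.lookup \<mu> j)"
        unfolding deg[symmetric] total_degree_def using k by (intro sum.mono_neutral_left) (auto simp: in_keys_iff)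
      also have "\<dots> = Poly_Mapping.lookup \<mu> i + (\<Sum>j\<in>{..<r} - {i}. Poly_Mapping.lookup \<mu> j)"
        using i by (intro sum.remove) auto
      also have "(\<Sum>j\<in>{..<r} - {i}. Poly_Mapping.lookup \<mu> j) = (\<Sum>j\<in>{..<r} - {i}. Poly_Mapping.lookup ?\<nu> j)"
        by (intro sum.cong) (auto simp: lookup_minus_single[unfolded One_nat_def])
      also have "Poly_Mapping.lookup \<mu> i = Poly_Mapping.lookup ?\<nu> i + 1" using False by (simp add: lookup_minus_single[unfolded One_nat_def])
      finally have "d - 1 = (\<Sum>j<r. Poly_Mapping.lookup ?\<nu> j)"
        using i sum.remove[of "{..<r}" i "Poly_Mapping.lookup ?\<nu>"] by simp
      moreover have "mono_val (c \<cdot>\<^sub>v v) ?\<nu> = (\<Prod>j<r. c ^ Poly_Mapping.lookup ?\<nu> j) * mono_val v ?\<nu>"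
        unfolding mono_val_superset[OF finite_lessThan k'] prod.distrib[symmetric]
        using carrier_vecD[OF v] by (intro prod.cong refl) (simp add: power_mult_distrib)
      ultimately show ?thesis by (simp add: power_sum)
    qed simp
  qed
  then show ?thesis by (simp add: polar_def sum_distrib_left mult_ac)
qed

lemma polar_add_right:
  "w \<in> carrier_vec r \<Longrightarrow> w' \<in> carrier_vec r \<Longrightarrow> polar r F v (w + w') = polar r F v w + polar r F v w'"
  by (simp add: polar_def distrib_left sum.distrib)

lemma polar_smult_right: "w \<in> carrier_vec r \<Longrightarrow> polar r F v (c \<cdot>\<^sub>v w) = c * polar r F v w"
  by (simp add: polar_def sum_distrib_left mult_ac)

lemma polar_unit_vec: "u < r \<Longrightarrow> polar r F v (unit_vec r u) = eval_poly_at (partial_deriv u F) v"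
  by (simp add: polar_def unit_vec_def if_distrib cong: if_cong)

section \<open>Non-vanishing of the polar form\<close>

lemma smooth_form_polar:
  assumes "smooth_form r F" "v \<in> carrier_vec r" "v \<noteq> 0\<^sub>v r"
  shows "\<exists>u<r. polar r F v (unit_vec r u) \<noteq> 0"
proof -
  have "v \<notin> {v \<in> carrier_vec r. \<forall>i<r. eval_poly_at (partial_deriv i F) v = 0}"
    using assms(1,3) unfolding smooth_form_def by simp
  then obtain u where "u < r" "eval_poly_at (partial_deriv u F) v \<noteq> 0" using assms(2) by blast
  then show ?thesis using polar_unit_vec[of u r F v] by metis
qed

text \<open>Independence of characters: monomials are multiplicative for the pointwise product of
  points. Comparing the relation at the product of \<open>x\<close> and \<open>y\<close> with its
  multiple by the value of \<open>\<mu>0\<close> at \<open>y\<close> eliminates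
  \<open>\<mu>0\<close>.\<close>

lemma monomials_independent:
  assumes "finite S" "finite T" "\<And>\<mu>. \<mu> \<in> S \<Longrightarrow> Poly_Mapping.keys \<mu> \<subseteq> T"
    and "\<And>x :: nat \<Rightarrow> complex. (\<Sum>\<mu>\<in>S. c \<mu> * (\<Prod>i\<in>T. x i ^ Poly_Mapping.lookup \<mu> i)) = 0"
  shows "\<forall>\<mu>\<in>S. c (\<mu> :: monomial) = 0"
  using assms(1,3,4)
proof (induction S arbitrary: c rule: finite_induct)
  case (insert \<mu>0 S)
  define \<chi> where "\<chi> \<mu> x = (\<Prod>i\<in>T. x i ^ Poly_Mapping.lookup \<mu> i)" for \<mu> :: monomial and x :: "nat \<Rightarrow> complex"
  have \<chi>_mult: "\<chi> \<mu> (\<lambda>i. x i * y i) = \<chi> \<mu> x * \<chi> \<mu> y" for \<mu> x y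
    by (simp add: \<chi>_def power_mult_distrib prod.distrib)
  have eq: "c \<mu>0 * \<chi> \<mu>0 x + (\<Sum>\<mu>\<in>S. c \<mu> * \<chi> \<mu> x) = 0" for x
    using insert.prems(2)[of x] insert.hyps by (simp add: \<chi>_def)
  have 1: "\<forall>\<mu>\<in>S. c \<mu> * (\<chi> \<mu> y - \<chi> \<mu>0 y) = 0" for y
  proof (rule insert.IH)
    show "Poly_Mapping.keys \<mu> \<subseteq> T" if "\<mu> \<in> S" for \<mu> using insert.prems(1) that by blast
    fix x
    have "(\<Sum>\<mu>\<in>S. c \<mu> * (\<chi> \<mu> y - \<chi> \<mu>0 y) * \<chi> \<mu> x) =
        (\<Sum>\<mu>\<in>S. c \<mu> * \<chi> \<mu> (\<lambda>i. y i * x i)) - \<chi> \<mu>0 y * (\<Sum>\<mu>\<in>S. c \<mu> * \<chi> \<mu> x)"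
      by (simp add: \<chi>_mult sum_distrib_left algebra_simps sum_subtractf)
    also have "\<dots> = - (c \<mu>0 * \<chi> \<mu>0 (\<lambda>i. y i * x i)) - \<chi> \<mu>0 y * (- (c \<mu>0 * \<chi> \<mu>0 x))"
      using eq[of x] eq[of "\<lambda>i. y i * x i"] by (simp add: add_eq_0_iff)
    also have "\<dots> = 0" by (simp add: \<chi>_mult)
    finally show "(\<Sum>\<mu>\<in>S. c \<mu> * (\<chi> \<mu> y - \<chi> \<mu>0 y) * (\<Prod>i\<in>T. x i ^ Poly_Mapping.lookup \<mu> i)) = 0"
      by (simp add: \<chi>_def)
  qed
  have 2: "c \<mu> = 0" if \<mu>: "\<mu> \<in> S" for \<mu>
  proof -
    have "\<mu> \<noteq> \<mu>0" using insert.hyps \<mu> by blast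
    then obtain i where i: "Poly_Mapping.lookup \<mu> i \<noteq> Poly_Mapping.lookup \<mu>0 i" by (metis poly_mapping_eqI)
    then have "i \<in> Poly_Mapping.keys \<mu> \<or> i \<in> Poly_Mapping.keys \<mu>0" by (auto simp: in_keys_iff)
    then have "i \<in> T" using insert.prems(1)[of \<mu>] insert.prems(1)[of \<mu>0] \<mu> by blast
    \<comment> \<open>At this point a monomial has the value 2 to the power of its exponent at
      \<open>i\<close>, which separates \<mu> from \<open>\<mu>0\<close>.\<close>
    define y :: "nat \<Rightarrow> complex" where "y j = (if j = i then 2 else 1)" for j
    have "\<chi> \<nu> y = 2 ^ Poly_Mapping.lookup \<nu> i" for \<nu>
    proof -
      have "\<chi> \<nu> y = (\<Prod>j\<in>T. if j = i then 2 ^ Poly_Mapping.lookup \<nu> j else 1)"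
        unfolding \<chi>_def y_def by (intro prod.cong) auto
      then show ?thesis using \<open>i \<in> T\<close> assms(2) by simp
    qed
    moreover have "(2 :: complex) ^ a \<noteq> 2 ^ b" if "a \<noteq> b" for a b
    proof
      assume "(2 :: complex) ^ a = 2 ^ b"
      then have "norm ((2 :: complex) ^ a) = norm ((2 :: complex) ^ b)" by simp
      then have "(2 :: real) ^ a = 2 ^ b" by (simp add: norm_power)
      then show False using that by simp
    qed
    ultimately have "\<chi> \<mu> y - \<chi> \<mu>0 y \<noteq> 0" using i by simp
    then show ?thesis using 1[of y] \<mu> by auto
  qed
  have "c \<mu>0 = 0" using eq[of "\<lambda>_. 1"] 2 by (simp add: \<chi>_def)
  with 2 show ?case by auto
qed simp

text \<open>On vectors supported in \<open>T\<close> only the monomials in variables from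
  \<open>T\<close> survive, and these are independent functions.\<close>

lemma eval_poly_at_nonzero:
  assumes p: "\<And>\<mu>. \<mu> \<in> Poly_Mapping.keys p \<Longrightarrow> Poly_Mapping.keys \<mu> \<subseteq> {..<r}"
    and \<nu>: "\<nu> \<in> Poly_Mapping.keys p" "Poly_Mapping.keys \<nu> \<subseteq> T" and T: "T \<subseteq> {..<r}"
  shows "\<exists>v\<in>carrier_vec r. (\<forall>i<r. i \<notin> T \<longrightarrow> v $ i = 0) \<and> eval_poly_at p v \<noteq> 0"
proof (rule ccontr)
  assume neg: "\<not> ?thesis"
  define S where "S = {\<mu> \<in> Poly_Mapping.keys p. Poly_Mapping.keys \<mu> \<subseteq> T}"
  have fT: "finite T" using T finite_subset by blast
  have "\<forall>\<mu>\<in>S. Poly_Mapping.lookup p \<mu> = 0"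
  proof (rule monomials_independent[OF _ fT])
    fix x :: "nat \<Rightarrow> complex"
    define v where "v = vec r (\<lambda>i. if i \<in> T then x i else 0)"
    have "v \<in> carrier_vec r" "\<forall>i<r. i \<notin> T \<longrightarrow> v $ i = 0" by (simp_all add: v_def)
    then have "eval_poly_at p v = 0" using neg by blast
    moreover have "eval_poly_at p v = (\<Sum>\<mu>\<in>S. Poly_Mapping.lookup p \<mu> * mono_val v \<mu>)"
      unfolding eval_poly_at_superset[OF finite_keys order_refl]
    proof (rule sum.mono_neutral_right)
      show "\<forall>\<mu>\<in>Poly_Mapping.keys p - S. Poly_Mapping.lookup p \<mu> * mono_val v \<mu> = 0"
      proof
        fix \<mu> assume \<mu>: "\<mu> \<in> Poly_Mapping.keys p - S"
        then obtain i where i: "i \<in> Poly_Mapping.keys \<mu>" "i \<notin> T" by (auto simp: S_def)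
        then have "v $ i = 0" using p[of \<mu>] \<mu> by (auto simp: v_def)
        then have "\<exists>i\<in>Poly_Mapping.keys \<mu>. (v $ i) ^ Poly_Mapping.lookup \<mu> i = 0"
          using i(1) by (intro bexI[of _ i]) (auto simp: in_keys_iff)
        then show "Poly_Mapping.lookup p \<mu> * mono_val v \<mu> = 0" by (simp add: mono_val_def)
      qed
    qed (auto simp: S_def)
    moreover have "mono_val v \<mu> = (\<Prod>i\<in>T. x i ^ Poly_Mapping.lookup \<mu> i)" if "\<mu> \<in> S" for \<mu>
    proof -
      have "Poly_Mapping.keys \<mu> \<subseteq> T" using that by (simp add: S_def)
      moreover have "v $ i = x i" if "i \<in> T" for i using that T by (auto simp: v_def)
      ultimately show ?thesis using fT by (simp add: mono_val_superset[of T])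
    qed
    ultimately show "(\<Sum>\<mu>\<in>S. Poly_Mapping.lookup p \<mu> * (\<Prod>i\<in>T. x i ^ Poly_Mapping.lookup \<mu> i)) = 0"
      by simp
  qed (auto simp: S_def)
  then show False using \<nu> by (auto simp: S_def in_keys_iff)
qed

text \<open>The derivative by the variable of the linear factor contains the complementary monomial,
  which involves only the coordinates of \<open>U\<close>; hence it does not vanish at all vectors
  supported there. The direction can be taken to be a unit vector.\<close>

lemma monomial_polar_nonzero:
  assumes F: "is_form r d F" and \<mu>: "\<mu> \<in> Poly_Mapping.keys F" "monomial_in_Sym_tensor_Sym r p U 1 U' \<mu>"
  shows "\<exists>v\<in>carrier_vec r. \<exists>u\<in>coords r U'.
    (\<forall>i<r. i \<notin> coords r U \<longrightarrow> v $ i = 0) \<and> polar r F v (unit_vec r u) \<noteq> 0"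
proof -
  obtain \<nu> \<nu>' where \<nu>: "\<mu> = \<nu> + \<nu>'" "Poly_Mapping.keys \<nu> \<subseteq> coords r U" "Poly_Mapping.keys \<nu>' \<subseteq> coords r U'" "total_degree \<nu>' = 1"
    using \<mu>(2) by (auto simp: monomial_in_Sym_tensor_Sym_def monomial_in_Sym_def)
  have "\<exists>u. \<nu>' = Poly_Mapping.single u 1"
  proof -
    have "(\<Sum>i\<in>Poly_Mapping.keys \<nu>'. Poly_Mapping.lookup \<nu>' i) = 1" using \<nu>(4) by (simp add: total_degree_def)
    then obtain u where u: "u \<in> Poly_Mapping.keys \<nu>'" "Poly_Mapping.lookup \<nu>' u = 1"
      "\<forall>i\<in>Poly_Mapping.keys \<nu>'. i \<noteq> u \<longrightarrow> Poly_Mapping.lookup \<nu>' i = 0"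
      by (auto simp: sum_eq_Suc0_iff)
    have "Poly_Mapping.lookup \<nu>' i = Poly_Mapping.lookup (Poly_Mapping.single u 1) i" for i
      using u by (cases "i \<in> Poly_Mapping.keys \<nu>'") (auto simp: lookup_single when_def in_keys_iff)
    then show ?thesis by (metis poly_mapping_eqI)
  qed
  then obtain u where u: "\<nu>' = Poly_Mapping.single u 1" by blast
  have uU: "u \<in> coords r U'" using \<nu>(3) u by simp
  then have ur: "u < r" by (simp add: coords_def)
  define p' where "p' = partial_deriv u F"
  have lk: "Poly_Mapping.lookup p' \<rho> = (\<Sum>\<mu>\<in>Poly_Mapping.keys F.
      (of_nat (Poly_Mapping.lookup \<mu> u) * Poly_Mapping.lookup F \<mu> when \<mu> - Poly_Mapping.single u 1 = \<rho>))" for \<rho>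
    by (simp add: p'_def partial_deriv_def lookup_sum lookup_single)
  \<comment> \<open>Lowering the exponent of \<open>u\<close> is injective on monomials that contain
    \<open>u\<close>, and the others contribute zero. So nothing cancels the contribution of
    \<mu>.\<close>
  have recover: "\<mu>' = \<rho> + Poly_Mapping.single u 1"
    if "\<mu>' - Poly_Mapping.single u 1 = \<rho>" "Poly_Mapping.lookup \<mu>' u \<noteq> 0" for \<mu>' \<rho> :: monomial
    using that(2) unfolding that(1)[symmetric]
    by (intro poly_mapping_eqI) (auto simp: lookup_add lookup_minus_single[unfolded One_nat_def] lookup_single when_def)
  have "Poly_Mapping.lookup p' \<nu> = of_nat (Poly_Mapping.lookup \<mu> u) * Poly_Mapping.lookup F \<mu>"
  proof -
    have "Poly_Mapping.lookup p' \<nu> = (\<Sum>\<mu>'\<in>Poly_Mapping.keys F.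
        if \<mu>' = \<mu> then of_nat (Poly_Mapping.lookup \<mu> u) * Poly_Mapping.lookup F \<mu> else 0)"
      unfolding lk
    proof (intro sum.cong refl)
      fix \<mu>'
      have m: "\<mu> - Poly_Mapping.single u 1 = \<nu>" unfolding \<nu>(1) u by (rule add_diff_cancel_right')
      show "(of_nat (Poly_Mapping.lookup \<mu>' u) * Poly_Mapping.lookup F \<mu>' when \<mu>' - Poly_Mapping.single u 1 = \<nu>) =
         (if \<mu>' = \<mu> then of_nat (Poly_Mapping.lookup \<mu> u) * Poly_Mapping.lookup F \<mu> else 0)"
      proof (cases "\<mu>' = \<mu>")
        case True
        then show ?thesis using m by (simp only: when_simps if_True simp_thms)
      next
        case False
        then have "\<not> (\<mu>' - Poly_Mapping.single u 1 = \<nu> \<and> Poly_Mapping.lookup \<mu>' u \<noteq> 0)"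
          using recover[of \<mu>' \<nu>] unfolding \<nu>(1) u by blast
        then show ?thesis using False by (auto simp: when_def)
      qed
    qed
    then show ?thesis using \<mu>(1) by simp
  qed
  moreover have "Poly_Mapping.lookup \<mu> u \<noteq> 0" unfolding \<nu>(1) u by (simp add: lookup_add)
  ultimately have "\<nu> \<in> Poly_Mapping.keys p'" using \<mu>(1) by (simp add: in_keys_iff)
  moreover have "Poly_Mapping.keys \<rho> \<subseteq> {..<r}" if "\<rho> \<in> Poly_Mapping.keys p'" for \<rho>
  proof -
    have "\<exists>\<mu>'\<in>Poly_Mapping.keys F. \<mu>' - Poly_Mapping.single u 1 = \<rho>"
    proof (rule ccontr)
      assume "\<not> ?thesis"
      then have "Poly_Mapping.lookup p' \<rho> = 0" unfolding lk by (intro sum.neutral) (auto simp: when_def)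
      then show False using that by (simp add: in_keys_iff)
    qed
    then obtain \<mu>' where "\<mu>' \<in> Poly_Mapping.keys F" "\<rho> = \<mu>' - Poly_Mapping.single u 1" by blast
    moreover from this have "Poly_Mapping.keys \<mu>' \<subseteq> {..<r}" using is_formD(1)[OF F] by blast
    ultimately show ?thesis using keys_minus_single_subset by blast
  qed
  moreover have "coords r U \<subseteq> {..<r}" by (auto simp: coords_def)
  ultimately obtain v where "v \<in> carrier_vec r" "\<forall>i<r. i \<notin> coords r U \<longrightarrow> v $ i = 0" "eval_poly_at p' v \<noteq> 0"
    using eval_poly_at_nonzero[of p' r \<nu> "coords r U"] \<nu>(2) by blast
  then show ?thesis using uU polar_unit_vec[OF ur] by (metis p'_def)
qed

section \<open>Monomial equations on a torus\<close>

text \<open>Exponents are integers because eliminating a variable along a cycle changes signs. A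
  negative exponent puts the constant on the other side of the equation.\<close>

lemma card_power_int_eq_le:
  assumes "e \<noteq> 0" "c \<noteq> 0"
  shows "finite {z :: complex. z \<noteq> 0 \<and> z powi e * c = 1} \<and>
    card {z :: complex. z \<noteq> 0 \<and> z powi e * c = 1} \<le> nat \<bar>e\<bar>"
proof -
  obtain c' where sub: "{z. z \<noteq> 0 \<and> z powi e * c = 1} \<subseteq> {z. z ^ nat \<bar>e\<bar> = c'}"
  proof (cases "e > 0")
    case True
    then have "{z. z \<noteq> 0 \<and> z powi e * c = 1} \<subseteq> {z. z ^ nat \<bar>e\<bar> = 1 / c}"
      using assms by (auto simp: power_int_def field_simps)
    then show ?thesis by (rule that)
  next
    case False
    then have "{z. z \<noteq> 0 \<and> z powi e * c = 1} \<subseteq> {z. z ^ nat \<bar>e\<bar> = c}"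
      using assms by (auto simp: power_int_def field_simps)
    then show ?thesis by (rule that)
  qed
  have "nat \<bar>e\<bar> > 0" using assms by simp
  from card_power_eq_le[OF this, of c'] sub show ?thesis
    by (meson card_mono finite_subset order_trans)
qed

text \<open>
  Solutions of \<open>\<lambda>\<^sub>b ^ e\<^sub>b \<lambda>\<^bsub>\<phi> b\<^esub> = 1\<close>. If some \<open>b\<close> is not the image of another index, it can be dropped;
  otherwise \<open>\<phi>\<close> is a permutation without fixed points, and one variable of a cycle is eliminated
  at the price of changing an exponent.
\<close>

lemma card_torus_solutions_le:
  fixes S :: "'b set" and e :: "'b \<Rightarrow> int"
  assumes "finite S" "\<And>b. b \<in> S \<Longrightarrow> \<phi> b \<in> S" "\<And>b. b \<in> S \<Longrightarrow> \<bar>e b\<bar> \<ge> 2"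
  defines "Z \<equiv> \<lambda>S \<phi> e. {l \<in> S \<rightarrow>\<^sub>E - {0::complex}. \<forall>b\<in>S. l b powi e b * l (\<phi> b) = 1}"
  shows "finite (Z S \<phi> e) \<and> card (Z S \<phi> e) \<le> (\<Prod>b\<in>S. nat \<bar>e b\<bar> + 1)"
  using assms(1-3)
proof (induction "card S" arbitrary: S \<phi> e)
  case 0
  then have "S = {}" by simp
  then have "Z S \<phi> e = {\<lambda>_. undefined}" by (auto simp: Z_def)
  then show ?case using \<open>S = {}\<close> by simp
next
  case (Suc n)
  have ZD: "l b \<noteq> 0" "l b powi e b * l (\<phi> b) = 1" if "l \<in> Z S \<phi> e" "b \<in> S" for l b S \<phi> e
    using that by (auto simp: Z_def PiE_iff)
  show ?case
  proof (cases "\<exists>b\<in>S. b \<notin> \<phi> ` (S - {b})")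
    case True
    then obtain b where b: "b \<in> S" "b \<notin> \<phi> ` (S - {b})" by blast
    define S' where "S' = S - {b}"
    have IH: "finite (Z S' \<phi> e) \<and> card (Z S' \<phi> e) \<le> (\<Prod>b\<in>S'. nat \<bar>e b\<bar> + 1)"
    proof (rule Suc.hyps(1))
      show "\<phi> x \<in> S'" if "x \<in> S'" for x
        using that Suc.prems(2)[of x] b by (auto simp: S'_def)
    qed (use Suc.hyps(2) Suc.prems b(1) in \<open>auto simp: S'_def\<close>)
    \<comment> \<open>The possible values of the dropped variable once the others are fixed. If
      \<open>\<phi> b = b\<close>, its equation has the exponent \<open>e b + 1\<close>.\<close>
    define R where "R l' = {z :: complex. z \<noteq> 0 \<and> z powi e b * (if \<phi> b = b then z else l' (\<phi> b)) = 1}" for l'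
    have R: "finite (R l') \<and> card (R l') \<le> nat \<bar>e b\<bar> + 1" if l': "l' \<in> Z S' \<phi> e" for l'
    proof (cases "\<phi> b = b")
      case True
      \<comment> \<open>An exponent \<open>e b + 1 = 0\<close> would allow every value; the lower
        bound 2 on the exponents rules it out.\<close>
      have "e b \<noteq> -1" "e b \<noteq> 0" using Suc.prems(3)[OF b(1)] by auto
      have "R l' = {z. z \<noteq> 0 \<and> z powi (e b + 1) * 1 = 1}"
        unfolding R_def by (rule Collect_cong) (simp add: True power_int_add_1 cong: conj_cong)
      moreover have "nat \<bar>e b + 1\<bar> \<le> nat \<bar>e b\<bar> + 1" by simp
      ultimately show ?thesis using card_power_int_eq_le[of "e b + 1" 1] \<open>e b \<noteq> -1\<close>
        by (metis add_eq_0_iff2 order_trans zero_neq_one)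
    next
      case False
      then have "\<phi> b \<in> S'" using Suc.prems(2)[OF b(1)] by (auto simp: S'_def)
      then have "l' (\<phi> b) \<noteq> 0" using ZD(1)[OF l'] by blast
      moreover have "e b \<noteq> 0" using Suc.prems(3)[OF b(1)] by auto
      ultimately show ?thesis using card_power_int_eq_le[of "e b" "l' (\<phi> b)"] False by (auto simp: R_def)
    qed
    define h where "h l = (restrict l S', l b)" for l :: "'b \<Rightarrow> complex"
    have "inj_on h (Z S \<phi> e)"
    proof (rule inj_onI)
      fix l m assume lm: "l \<in> Z S \<phi> e" "m \<in> Z S \<phi> e" "h l = h m"
      show "l = m"
      proof (rule PiE_ext)
        show "l \<in> S \<rightarrow>\<^sub>E - {0}" "m \<in> S \<rightarrow>\<^sub>E - {0}" using lm by (auto simp: Z_def)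
        fix x assume "x \<in> S"
        then show "l x = m x" using lm(3) by (cases "x = b") (auto simp: h_def S'_def dest: fun_cong[of _ _ x])
      qed
    qed
    moreover have "h ` Z S \<phi> e \<subseteq> Sigma (Z S' \<phi> e) R"
    proof (rule image_subsetI)
      fix l assume l: "l \<in> Z S \<phi> e"
      have "\<phi> x \<in> S'" if "x \<in> S'" for x
        using that Suc.prems(2)[of x] b by (auto simp: S'_def)
      then have "restrict l S' \<in> Z S' \<phi> e" using l by (auto simp: Z_def S'_def PiE_iff)
      moreover have "l b \<in> R (restrict l S')"
        using ZD[OF l b(1)] Suc.prems(2)[OF b(1)] by (auto simp: R_def S'_def)
      ultimately show "h l \<in> Sigma (Z S' \<phi> e) R" by (simp add: h_def)
    qed
    moreover have fin: "finite (Sigma (Z S' \<phi> e) R)" using IH R by (intro finite_SigmaI) auto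
    ultimately have fZ: "finite (Z S \<phi> e)" and le: "card (Z S \<phi> e) \<le> card (Sigma (Z S' \<phi> e) R)"
      using inj_on_finite card_inj_on_le by blast+
    note le
    also have "\<dots> = (\<Sum>l'\<in>Z S' \<phi> e. card (R l'))" using IH R by (intro card_SigmaI) auto
    also have "\<dots> \<le> (\<Sum>l'\<in>Z S' \<phi> e. nat \<bar>e b\<bar> + 1)" using R by (intro sum_mono) auto
    also have "\<dots> = card (Z S' \<phi> e) * (nat \<bar>e b\<bar> + 1)" by simp
    also have "\<dots> \<le> (\<Prod>b\<in>S'. nat \<bar>e b\<bar> + 1) * (nat \<bar>e b\<bar> + 1)" using IH by (intro mult_right_mono) auto
    also have "\<dots> = (\<Prod>b\<in>S. nat \<bar>e b\<bar> + 1)"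
      using prod.remove[OF Suc.prems(1) b(1), of "\<lambda>b. nat \<bar>e b\<bar> + 1"] by (simp add: S'_def mult.commute)
    finally show ?thesis using fZ by blast
  next
    case False
    then have pre: "c \<in> \<phi> ` (S - {c})" if "c \<in> S" for c using that by simp
    have "S \<subseteq> \<phi> ` S" using pre image_mono[of "S - {_}" S \<phi>] by fast
    then have "\<phi> ` S = S" using Suc.prems(2) by (intro equalityI image_subsetI) auto
    then have inj: "inj_on \<phi> S" using Suc.prems(1) by (simp add: eq_card_imp_inj_on)
    obtain c where c: "c \<in> S" using Suc.hyps(2) by fastforce
    obtain b where b: "b \<in> S" "b \<noteq> c" "\<phi> b = c" using pre[OF c] by (elim imageE) auto
    define S' where "S' = S - {c}"
    define \<phi>' where "\<phi>' = \<phi>(b := \<phi> c)"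
    \<comment> \<open>The equation of \<open>b\<close> yields \<open>l c = l b powi (- e b)\<close>;
      inserted into the equation of \<open>c\<close>, it produces this exponent, again of modulus at
      least 2.\<close>
    define e' where "e' = e(b := - (e b * e c))"
    have bS': "b \<in> S'" using b by (simp add: S'_def)
    have \<phi>c: "\<phi> c \<noteq> c" using inj_onD[OF inj, of c b] b c by auto
    have \<phi>'S': "\<phi>' x \<in> S'" if "x \<in> S'" for x
      using that Suc.prems(2)[of x] Suc.prems(2)[OF c] \<phi>c inj_onD[OF inj, of x b] b c
      by (auto simp: \<phi>'_def S'_def)
    have e2: "\<bar>e b\<bar> \<ge> 2" "\<bar>e c\<bar> \<ge> 2" using Suc.prems(3) b c by auto
    have IH: "finite (Z S' \<phi>' e') \<and> card (Z S' \<phi>' e') \<le> (\<Prod>b\<in>S'. nat \<bar>e' b\<bar> + 1)"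
    proof (rule Suc.hyps(1))
      show "\<bar>e' x\<bar> \<ge> 2" if "x \<in> S'" for x
      proof (cases "x = b")
        case True
        have "2 * 2 \<le> \<bar>e b\<bar> * \<bar>e c\<bar>" using e2 by (intro mult_mono) auto
        then show ?thesis using True by (simp add: e'_def abs_mult)
      qed (use that Suc.prems(3) in \<open>auto simp: e'_def S'_def\<close>)
    qed (use Suc.hyps(2) Suc.prems c \<phi>'S' in \<open>auto simp: S'_def\<close>)
    have lc: "l c = l b powi (- e b)" if l: "l \<in> Z S \<phi> e" for l
      using ZD[OF l b(1)] b(3) by (simp add: power_int_minus field_simps)
    have "inj_on (\<lambda>l. restrict l S') (Z S \<phi> e)"
    proof (rule inj_onI)
      fix l m assume lm: "l \<in> Z S \<phi> e" "m \<in> Z S \<phi> e" "restrict l S' = restrict m S'"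
      have x: "l x = m x" if "x \<in> S'" for x using fun_cong[OF lm(3), of x] that by simp
      show "l = m"
      proof (rule PiE_ext)
        show "l \<in> S \<rightarrow>\<^sub>E - {0}" "m \<in> S \<rightarrow>\<^sub>E - {0}" using lm by (auto simp: Z_def)
        fix y assume "y \<in> S"
        then show "l y = m y" using x lc[OF lm(1)] lc[OF lm(2)] bS' by (cases "y = c") (auto simp: S'_def)
      qed
    qed
    moreover have "(\<lambda>l. restrict l S') ` Z S \<phi> e \<subseteq> Z S' \<phi>' e'"
    proof (rule image_subsetI)
      fix l assume l: "l \<in> Z S \<phi> e"
      have "l x powi e' x * l (\<phi>' x) = 1" if x: "x \<in> S'" for x
      proof (cases "x = b")
        case True
        have "l b powi e' b = l c powi e c"
          unfolding lc[OF l] by (simp add: e'_def flip: power_int_mult)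
        then show ?thesis using ZD(2)[OF l c] True by (simp add: \<phi>'_def)
      next
        case False
        then show ?thesis using ZD(2)[OF l, of x] x by (simp add: e'_def \<phi>'_def S'_def)
      qed
      then show "restrict l S' \<in> Z S' \<phi>' e'" using l \<phi>'S' by (auto simp: Z_def S'_def PiE_iff)
    qed
    ultimately have fZ: "finite (Z S \<phi> e)" and le: "card (Z S \<phi> e) \<le> card (Z S' \<phi>' e')"
      using inj_on_finite card_inj_on_le IH by blast+
    note le
    also have "\<dots> \<le> (\<Prod>b\<in>S'. nat \<bar>e' b\<bar> + 1)" using IH by blast
    also have "\<dots> = (nat \<bar>e b * e c\<bar> + 1) * (\<Prod>x\<in>S' - {b}. nat \<bar>e x\<bar> + 1)"
      using Suc.prems(1) bS' by (subst prod.remove[of _ b]) (auto simp: S'_def e'_def intro!: prod.cong)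
    \<comment> \<open>Here xy + 1 \<le> (x + 1)(y + 1): the merged exponent costs no more than the
      two it replaces.\<close>
    also have "\<dots> \<le> ((nat \<bar>e b\<bar> + 1) * (nat \<bar>e c\<bar> + 1)) * (\<Prod>x\<in>S' - {b}. nat \<bar>e x\<bar> + 1)"
      by (intro mult_right_mono) (auto simp: abs_mult nat_mult_distrib)
    also have "\<dots> = (\<Prod>b\<in>S. nat \<bar>e b\<bar> + 1)"
    proof -
      have "(\<Prod>b\<in>S. nat \<bar>e b\<bar> + 1) = (nat \<bar>e c\<bar> + 1) * (\<Prod>b\<in>S'. nat \<bar>e b\<bar> + 1)"
        unfolding S'_def by (rule prod.remove[OF Suc.prems(1) c])
      also have "(\<Prod>b\<in>S'. nat \<bar>e b\<bar> + 1) = (nat \<bar>e b\<bar> + 1) * (\<Prod>x\<in>S' - {b}. nat \<bar>e x\<bar> + 1)"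
        using Suc.prems(1) bS' by (intro prod.remove) (auto simp: S'_def)
      finally show ?thesis by (simp only: mult_ac)
    qed
    finally show ?thesis using fZ by blast
  qed
qed

section \<open>Counting lemmas\<close>

lemma basis_unit_vecs_coord_subspace:
  assumes U: "is_subspace r U"
    and basis: "vectorspace.basis class_ring (sub_vs r U) (unit_vec r ` coords r U)"
  shows "U = coord_subspace r (coords r U)" "sub_dim r U = card (coords r U)"
proof -
  interpret V: vec_space "TYPE(complex)" r .
  let ?B = "unit_vec r ` coords r U :: complex vec set"
  have vs: "vectorspace class_ring (sub_vs r U)" by (rule V.subspace_is_vs[OF U])
  have sub: "submodule class_ring U (module_vec TYPE(complex) r)" using U by (rule V.is_module)
  have BU: "?B \<subseteq> U" by (auto simp: coords_def)
  have fin: "finite (coords r U)" by (simp add: coords_def)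
  have Uc: "U \<subseteq> carrier_vec r" using U by (simp add: is_subspace_iff)
  have Bc: "?B \<subseteq> carrier_vec r" by auto
  have span: "V.span ?B = U"
    using basis V.span_li_not_depend(1)[OF BU sub]
    unfolding vectorspace.basis_def[OF vs] by simp
  show "U = coord_subspace r (coords r U)"
  proof (intro equalityI subsetI)
    fix u assume u: "u \<in> U"
    then obtain a where a: "u = V.lincomb a ?B"
      using V.finite_in_span[OF _ Bc, of u] fin span by auto
    have "u $ t = 0" if t: "t < r" "t \<notin> coords r U" for t
    proof -
      have "u $ t = (\<Sum>x\<in>?B. a x * x $ t)" unfolding a by (rule V.lincomb_index[OF t(1) Bc])
      also have "\<dots> = 0" using t by (intro sum.neutral) (auto simp: coords_def unit_vec_def)
      finally show ?thesis .
    qed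
    then show "u \<in> coord_subspace r (coords r U)" using u Uc by (auto simp: coord_subspace_def)
  next
    fix v assume v: "v \<in> coord_subspace r (coords r U)"
    have "vsum r (\<lambda>t. v $ t \<cdot>\<^sub>v unit_vec r t) (coords r U) = v"
    proof (rule eq_vecI)
      fix t assume "t < dim_vec v"
      then have t: "t < r" using v by (auto simp: coord_subspace_def)
      have "vsum r (\<lambda>t. v $ t \<cdot>\<^sub>v unit_vec r t) (coords r U) $ t = (\<Sum>s\<in>coords r U. if s = t then v $ t else 0)"
        unfolding vsum_index[OF t] using t by (intro sum.cong) (auto simp: unit_vec_def)
      also have "\<dots> = v $ t" using fin v t by (auto simp: coord_subspace_def)
      finally show "vsum r (\<lambda>t. v $ t \<cdot>\<^sub>v unit_vec r t) (coords r U) $ t = v $ t" .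
    qed (use v in \<open>auto simp: coord_subspace_def\<close>)
    moreover have "vsum r (\<lambda>t. v $ t \<cdot>\<^sub>v unit_vec r t) (coords r U) \<in> U"
      using U fin by (intro subspace_vsum_closed) (auto simp: is_subspace_iff coords_def)
    ultimately show "v \<in> U" by simp
  qed
  have "inj_on (unit_vec r :: nat \<Rightarrow> complex vec) (coords r U)"
    by (rule inj_onI) (auto simp: coords_def)
  then have "card ?B = card (coords r U)" by (rule card_image)
  then show "sub_dim r U = card (coords r U)"
    using vectorspace.dim_basis[OF vs _ basis] fin by simp
qed

text \<open>Each fibre of \<open>f\<close> is moved into \<open>N\<close> by left multiplication
  with the inverse of one of its members. Finiteness of \<open>P\<close> is part of the conclusion,
  which is how finiteness passes from \<open>K\<close> to larger groups.\<close>

lemma card_le_image_times_kernel: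
  fixes P N :: "complex mat set"
  assumes P: "P \<subseteq> carrier_mat n n"
    and inv: "\<And>g. g \<in> P \<Longrightarrow> \<exists>h\<in>P. h * g = 1\<^sub>m n \<and> g * h = 1\<^sub>m n"
    and N: "finite N" "\<And>g g' h. g \<in> P \<Longrightarrow> g' \<in> P \<Longrightarrow> h \<in> P \<Longrightarrow> f g = f g' \<Longrightarrow> h * g = 1\<^sub>m n \<Longrightarrow>
        g * h = 1\<^sub>m n \<Longrightarrow> h * g' \<in> N"
    and fin: "finite (f ` P)"
  shows "finite P \<and> card P \<le> card (f ` P) * card N"
proof -
  define fib where "fib y = {g \<in> P. f g = y}" for y
  have fib: "finite (fib y) \<and> card (fib y) \<le> card N" if y: "y \<in> f ` P" for y
  proof -
    obtain g where g: "g \<in> P" "y = f g" using y by blast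
    obtain h where h: "h \<in> P" "h * g = 1\<^sub>m n" "g * h = 1\<^sub>m n" using inv[OF g(1)] by blast
    have c: "g \<in> carrier_mat n n" "h \<in> carrier_mat n n" using g h P by auto
    have "inj_on (\<lambda>x. h * x) (fib y)"
    proof (rule inj_onI)
      fix x x' assume x: "x \<in> fib y" "x' \<in> fib y" and eq: "h * x = h * x'"
      have xc: "x \<in> carrier_mat n n" "x' \<in> carrier_mat n n" using x P by (auto simp: fib_def)
      have "g * (h * x) = x" using assoc_mult_mat[OF c xc(1)] unfolding h(3) left_mult_one_mat[OF xc(1)] by (rule sym)
      moreover have "g * (h * x') = x'"
        using assoc_mult_mat[OF c xc(2)] unfolding h(3) left_mult_one_mat[OF xc(2)] by (rule sym)
      ultimately show "x = x'" unfolding eq by simp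
    qed
    moreover have "(\<lambda>x. h * x) ` fib y \<subseteq> N"
    proof (rule image_subsetI)
      fix x assume "x \<in> fib y"
      then have "x \<in> P" "f g = f x" using g(2) by (simp_all add: fib_def)
      then show "h * x \<in> N" by (intro N(2)[OF g(1) _ h(1) _ h(2,3)])
    qed
    ultimately show ?thesis using N(1) inj_on_finite card_inj_on_le by blast
  qed
  have PU: "P = (\<Union>y\<in>f ` P. fib y)" by (auto simp: fib_def)
  have "finite (\<Union>y\<in>f ` P. fib y)" using fin fib by blast
  moreover have "card (\<Union>y\<in>f ` P. fib y) \<le> (\<Sum>y\<in>f ` P. card (fib y))" using fin by (rule card_UN_le)
  moreover have "(\<Sum>y\<in>f ` P. card (fib y)) \<le> (\<Sum>y\<in>f ` P. card N)" using fib by (intro sum_mono) blast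
  ultimately show ?thesis using PU by simp
qed

section \<open>Factorials and the subdegree sequence\<close>

lemma prod_fact_le_fact_sum: "finite I \<Longrightarrow> (\<Prod>i\<in>I. fact (k i)) \<le> (fact (\<Sum>i\<in>I. k i) :: nat)"
proof (induction I rule: finite_induct)
  case (insert i I)
  have "fact (k i) * (\<Prod>i\<in>I. fact (k i)) \<le> fact (k i) * (fact (\<Sum>i\<in>I. k i) :: nat)"
    using insert.IH by (rule mult_le_mono2)
  also have "\<dots> \<le> fact (k i + (\<Sum>i\<in>I. k i))"
    by (rule dvd_imp_le[OF fact_fact_dvd_fact]) simp
  finally show ?case using insert.hyps by simp
qed simp

text \<open>The list that \<open>subdegree_sequence\<close> sorts, for a general function of the two
  indices.\<close>

definition block_list :: "nat \<Rightarrow> (nat \<Rightarrow> nat) \<Rightarrow> (nat \<Rightarrow> nat \<Rightarrow> nat) \<Rightarrow> nat list" where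
  "block_list m k f = concat (map (\<lambda>i. map (f i) [1..<Suc (k i)]) [1..<Suc m])"

lemma sum_list_block_list: "sum_list (map h (block_list m k f)) = (\<Sum>i=1..m. \<Sum>j=1..k i. h (f i j) :: nat)"
proof -
  have inner: "sum_list (map h (map g [1..<Suc n])) = (\<Sum>j=1..n. h (g j))" for g n
    by (induction n) (simp_all add: sum.nat_ivl_Suc')
  have "sum_list (map h (concat (map (\<lambda>i. map (f i) [1..<Suc (k i)]) [1..<Suc n]))) =
      (\<Sum>i=1..n. \<Sum>j=1..k i. h (f i j))" for n
  proof (induction n)
    case (Suc n)
    have "[1..<Suc (Suc n)] = [1..<Suc n] @ [Suc n]" by simp
    then show ?case using Suc inner[of "f (Suc n)" "k (Suc n)"]
      by (simp add: sum.nat_ivl_Suc' del: upt_Suc)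
  qed simp
  then show ?thesis by (simp add: block_list_def)
qed

lemma prod_list_block_list: "prod_list (map h (block_list m k f)) = (\<Prod>i=1..m. \<Prod>j=1..k i. h (f i j) :: real)"
proof -
  have inner: "prod_list (map h (map g [1..<Suc n])) = (\<Prod>j=1..n. h (g j))" for g n
    by (induction n) (simp_all add: prod.nat_ivl_Suc' mult.commute)
  have "prod_list (map h (concat (map (\<lambda>i. map (f i) [1..<Suc (k i)]) [1..<Suc n]))) =
      (\<Prod>i=1..n. \<Prod>j=1..k i. h (f i j))" for n
  proof (induction n)
    case (Suc n)
    have "[1..<Suc (Suc n)] = [1..<Suc n] @ [Suc n]" by simp
    then show ?case using Suc inner[of "f (Suc n)" "k (Suc n)"]
      by (simp add: prod.nat_ivl_Suc' mult.commute del: upt_Suc)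
  qed simp
  then show ?thesis by (simp add: block_list_def)
qed

lemma length_block_list: "length (block_list m k f) = (\<Sum>i=1..m. k i)"
  using sum_list_block_list[of "\<lambda>_. 1"] by (simp add: sum_list_triv)

lemma count_block_list: "count_list (block_list m k f) y = (\<Sum>i=1..m. \<Sum>j=1..k i. if f i j = y then 1 else 0)"
proof -
  have "count_list xs y = sum_list (map (\<lambda>x. if x = y then 1 else 0) xs)" for xs :: "nat list"
    by (induction xs) auto
  then show ?thesis using sum_list_block_list by simp
qed

text \<open>The ratio depends only on the multiset of entries, so sorting is invisible, and the
  denominator is multiplied away.\<close>

lemma Fermat_ratio_rev_sort_block_list:
  assumes "d > 0" "sum_list (block_list m k f) = r"
  shows "Fermat_ratio (rev (sort (block_list m k f))) d * real d ^ r * fact r =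
    real d ^ (\<Sum>i=1..m. k i) * (\<Prod>i=1..m. \<Prod>j=1..k i. real (JC (f i j))) *
    (\<Prod>y\<in>set (block_list m k f). fact (count_list (block_list m k f) y))"
proof -
  let ?l = "rev (sort (block_list m k f))"
  have ms: "mset ?l = mset (block_list m k f)" by simp
  have "sum_list ?l = r"
    using assms(2) unfolding sum_mset_sum_list[symmetric] ms .
  moreover have "length ?l = (\<Sum>i=1..m. k i)" by (simp add: length_block_list)
  moreover have "(\<Prod>x\<leftarrow>?l. real (JC x)) = (\<Prod>x\<leftarrow>block_list m k f. real (JC x))"
    unfolding prod_mset_prod_list[symmetric] mset_map ms ..
  moreover have "set ?l = set (block_list m k f)" by simp
  moreover have "count_list ?l y = count_list (block_list m k f) y" for y
    unfolding count_mset[symmetric] ms ..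
  ultimately have "Fermat_ratio ?l d =
    (real d ^ (\<Sum>i=1..m. k i) * (\<Prod>i=1..m. \<Prod>j=1..k i. real (JC (f i j))) *
    (\<Prod>y\<in>set (block_list m k f). fact (count_list (block_list m k f) y))) / (real d ^ r * fact r)"
    unfolding Fermat_ratio_def by (simp add: prod_list_block_list)
  then show ?thesis using assms(1) by simp
qed

text \<open>Different summands may have blocks of the same dimension \<open>y\<close>. Their numbers
  of blocks add up to the multiplicity of \<open>y\<close>, and a product of factorials is at most
  the factorial of the sum. Positivity of \<open>k i\<close> ensures that every value
  \<open>x i\<close> occurs in the list.\<close>

lemma prod_fact_le_prod_count:
  assumes "\<And>i j. i \<in> {1..m} \<Longrightarrow> j \<in> {1..k i} \<Longrightarrow> f i j = x i" "\<And>i. i \<in> {1..m} \<Longrightarrow> k i \<ge> 1"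
  shows "(\<Prod>i=1..m. fact (k i)) \<le> (\<Prod>y\<in>set (block_list m k f). fact (count_list (block_list m k f) y) :: nat)"
proof -
  have set: "set (block_list m k f) = x ` {1..m}"
  proof -
    have "set (block_list m k f) = (\<Union>i\<in>{1..m}. f i ` {1..k i})"
      by (simp add: block_list_def atLeastLessThanSuc_atLeastAtMost del: upt_Suc)
    also have "\<dots> = (\<Union>i\<in>{1..m}. {x i})"
    proof (rule SUP_cong[OF refl])
      fix i assume i: "i \<in> {1..m}"
      then have "1 \<in> {1..k i}" using assms(2)[OF i] by simp
      then show "f i ` {1..k i} = {x i}" using assms(1)[OF i] by (auto intro: image_eqI[of _ _ 1])
    qed
    finally show ?thesis by auto
  qed
  have cnt: "count_list (block_list m k f) y = (\<Sum>i\<in>{i \<in> {1..m}. x i = y}. k i)" for y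
  proof -
    have "count_list (block_list m k f) y = (\<Sum>i=1..m. if x i = y then k i else 0)"
      unfolding count_block_list using assms(1) by (intro sum.cong) auto
    then show ?thesis using sum.inter_filter[of "{1..m}" k "\<lambda>i. x i = y"] by (simp only: finite_atLeastAtMost)
  qed
  have "(\<Prod>i=1..m. fact (k i) :: nat) = (\<Prod>y\<in>x ` {1..m}. \<Prod>i\<in>{i \<in> {1..m}. x i = y}. fact (k i))"
    by (rule prod.image_gen) simp
  also have "\<dots> \<le> (\<Prod>y\<in>x ` {1..m}. fact (count_list (block_list m k f) y))"
    unfolding cnt by (intro prod_mono conjI prod_fact_le_fact_sum) auto
  finally show ?thesis unfolding set .
qed

section \<open>The action on the blocks\<close>

locale form_decomposition =
  fixes r d m :: nat and F :: cpoly and G :: "complex mat set"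
    and V :: "nat \<Rightarrow> complex vec set" and k :: "nat \<Rightarrow> nat"
    and W :: "nat \<Rightarrow> nat \<Rightarrow> complex vec set"
  assumes d3: "d \<ge> 3" and form: "is_form r d F" and smooth: "smooth_form r F"
    and G: "subgroup G (GL r)" and Aut: "G \<subseteq> Aut_form r F"
    and decomp: "decomposition_data r G m V k W"
    and compat: "compatible_basis r m k W"
begin

lemmas GD = subgroup_GL_D[OF G]

definition blocks :: "(nat \<times> nat) set" where
  "blocks = Sigma {1..m} (\<lambda>i. {1..k i})"

definition U :: "nat \<times> nat \<Rightarrow> complex vec set" where
  "U b = W (fst b) (snd b)"

definition T :: "nat \<times> nat \<Rightarrow> nat set" where
  "T b = coords r (U b)"

definition H :: "nat \<times> nat \<Rightarrow> (complex vec \<Rightarrow> complex vec) set set" where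
  "H b = H_group G W (fst b) (snd b)"

section \<open>Blocks as a partition of the coordinates\<close>

lemma finite_blocks: "finite blocks"
  and card_blocks: "card blocks = (\<Sum>i=1..m. k i)"
  by (simp_all add: blocks_def)

lemma decompD:
  assumes "i \<in> {1..m}"
  shows "internal_direct_sum r (V i) {1..k i} (W i)" "permutes_subspaces G {1..k i} (W i)"
    "\<And>j j'. j \<in> {1..k i} \<Longrightarrow> j' \<in> {1..k i} \<Longrightarrow> \<exists>g\<in>G. image_under g (W i j) = W i j'"
    "\<And>j. j \<in> {1..k i} \<Longrightarrow> acts_primitively r (stabilizer G (W i j)) (W i j)"
    "acts_irreducibly r G (V i)"
  using decomp assms unfolding decomposition_data_def by blast+

lemma U_primitive: "b \<in> blocks \<Longrightarrow> acts_primitively r (stabilizer G (U b)) (U b)"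
  using decompD(4) by (auto simp: blocks_def U_def)

lemma U_subspace: "b \<in> blocks \<Longrightarrow> is_subspace r (U b)"
  using U_primitive unfolding acts_primitively_def acts_irreducibly_def by blast

lemma U_carrier: "b \<in> blocks \<Longrightarrow> u \<in> U b \<Longrightarrow> u \<in> carrier_vec r"
  using U_subspace unfolding is_subspace_iff by blast

lemma U_nonzero: "b \<in> blocks \<Longrightarrow> \<exists>u\<in>U b. u \<noteq> 0\<^sub>v r"
proof -
  assume b: "b \<in> blocks"
  have "U b \<noteq> {0\<^sub>v r}" using U_primitive[OF b] unfolding acts_primitively_def acts_irreducibly_def by blast
  moreover have "0\<^sub>v r \<in> U b" using U_subspace[OF b] unfolding is_subspace_iff by blast
  ultimately show ?thesis by blast
qed

lemma U_coord_subspace: "b \<in> blocks \<Longrightarrow> U b = coord_subspace r (T b)"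
  and dim_U: "b \<in> blocks \<Longrightarrow> sub_dim r (U b) = card (T b)"
proof -
  assume b: "b \<in> blocks"
  have "vectorspace.basis class_ring (sub_vs r (U b)) (unit_vec r ` coords r (U b))"
    using compat b unfolding compatible_basis_def blocks_def U_def by auto
  from basis_unit_vecs_coord_subspace[OF U_subspace[OF b] this]
  show "U b = coord_subspace r (T b)" "sub_dim r (U b) = card (T b)" by (simp_all add: T_def)
qed

lemma T_subset: "T b \<subseteq> {..<r}"
  by (auto simp: T_def coords_def)

lemma unit_vec_U: "t \<in> T b \<Longrightarrow> unit_vec r t \<in> U b"
  by (simp add: T_def coords_def)

text \<open>The lexicographic order condition would make a common index smaller than itself.\<close>

lemma T_disjoint:
  assumes b: "b \<in> blocks" "b' \<in> blocks" and t: "t \<in> T b" "t \<in> T b'"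
  shows "b = b'"
proof (rule ccontr)
  assume "b \<noteq> b'"
  then have lt: "(fst b < fst b' \<or> fst b = fst b' \<and> snd b < snd b') \<or>
      (fst b' < fst b \<or> fst b' = fst b \<and> snd b' < snd b)"
    using prod_eq_iff[of b b'] by arith
  have mem: "fst b \<in> {1..m}" "snd b \<in> {1..k (fst b)}" "fst b' \<in> {1..m}" "snd b' \<in> {1..k (fst b')}"
    using b by (auto simp: blocks_def)
  have ord: "\<forall>i\<in>{1..m}. \<forall>j\<in>{1..k i}. \<forall>i'\<in>{1..m}. \<forall>j'\<in>{1..k i'}.
        i < i' \<or> i = i' \<and> j < j' \<longrightarrow>
          (\<forall>t\<in>coords r (W i j). \<forall>t'\<in>coords r (W i' j'). t < t')"
    using compat unfolding compatible_basis_def by blast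
  have "t < t"
    using lt
  proof
    assume "fst b < fst b' \<or> fst b = fst b' \<and> snd b < snd b'"
    then show "t < t" using ord[rule_format, OF mem] t unfolding T_def U_def by blast
  next
    assume "fst b' < fst b \<or> fst b' = fst b \<and> snd b' < snd b"
    then show "t < t" using ord[rule_format, OF mem(3,4,1,2)] t unfolding T_def U_def by blast
  qed
  then show False by simp
qed

lemma T_cover:
  assumes t: "t < r"
  shows "\<exists>b\<in>blocks. t \<in> T b"
proof -
  have "internal_direct_sum r (carrier_vec r) {1..m} V" using decomp by (simp add: decomposition_data_def)
  then obtain v where v: "\<forall>i\<in>{1..m}. v i \<in> V i" "unit_vec r t = vsum r v {1..m}"
    unfolding internal_direct_sum_iff using unit_vec_carrier[of r t] by blast
  have "(\<Sum>i\<in>{1..m}. v i $ t) = unit_vec r t $ t" unfolding v(2) using t by simp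
  then have "(\<Sum>i\<in>{1..m}. v i $ t) \<noteq> 0" using t by simp
  then obtain i where i: "i \<in> {1..m}" "v i $ t \<noteq> 0" by (metis (no_types, lifting) sum.neutral)
  then obtain w where w: "\<forall>j\<in>{1..k i}. w j \<in> W i j" "v i = vsum r w {1..k i}"
    using decompD(1)[OF i(1)] v(1) unfolding internal_direct_sum_iff by blast
  have "(\<Sum>j\<in>{1..k i}. w j $ t) \<noteq> 0" using i(2) t unfolding w(2) by simp
  then obtain j where j: "j \<in> {1..k i}" "w j $ t \<noteq> 0" by (metis (no_types, lifting) sum.neutral)
  have b: "(i, j) \<in> blocks" using i j by (simp add: blocks_def)
  have "w j \<in> coord_subspace r (T (i, j))" using U_coord_subspace[OF b] w(1)[rule_format, OF j(1)] by (simp add: U_def)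
  then have "t \<in> T (i, j)" using j(2) t unfolding coord_subspace_def by blast
  then show ?thesis using b by blast
qed

lemma T_nonempty: "b \<in> blocks \<Longrightarrow> T b \<noteq> {}"
proof
  assume b: "b \<in> blocks" and e: "T b = {}"
  obtain u where u: "u \<in> U b" "u \<noteq> 0\<^sub>v r" using U_nonzero[OF b] by blast
  have "u = 0\<^sub>v r"
    using u(1) unfolding U_coord_subspace[OF b] e coord_subspace_def by (intro eq_vecI) auto
  then show False using u(2) by simp
qed

lemma U_inj: "b \<in> blocks \<Longrightarrow> b' \<in> blocks \<Longrightarrow> U b = U b' \<Longrightarrow> b = b'"
  using T_nonempty[of b] T_disjoint[of b b'] by (auto simp: T_def)

lemma sum_card_T: "(\<Sum>b\<in>blocks. card (T b)) = r"
proof -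
  have "card (\<Union>b\<in>blocks. T b) = (\<Sum>b\<in>blocks. card (T b))"
    using T_disjoint finite_blocks finite_subset[OF T_subset]
    by (intro card_UN_disjoint) blast+
  moreover have "(\<Union>b\<in>blocks. T b) = {..<r}" using T_cover T_subset by blast
  ultimately show ?thesis by simp
qed

text \<open>Both sides are the trace of a product of the two rectangular blocks of \<open>g\<close> and its inverse.\<close>

lemma card_T_eq:
  assumes b: "b \<in> blocks" "b' \<in> blocks" and g: "g \<in> G" "image_under g (U b) = U b'"
  shows "card (T b) = card (T b')"
proof -
  obtain h where h: "h \<in> G" "h * g = 1\<^sub>m r" "g * h = 1\<^sub>m r" using GD(4)[OF g(1)] by blast
  have c: "g \<in> carrier_mat r r" "h \<in> carrier_mat r r" using g h GD(1) by auto
  have hU: "h *\<^sub>v u \<in> U b" if u: "u \<in> U b'" for u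
  proof -
    obtain w where w: "w \<in> U b" "u = g *\<^sub>v w" using u unfolding g(2)[symmetric] by blast
    have "h *\<^sub>v u = w"
      unfolding w(2) using assoc_mult_mat_vec[OF c(2,1) U_carrier[OF b(1) w(1)]] h(2) U_carrier[OF b(1) w(1)] by simp
    then show ?thesis using w(1) by simp
  qed
  \<comment> \<open>A diagonal entry of \<open>x * y'\<close>: only the terms over
    \<open>T y\<close> survive, because column \<open>s\<close> of \<open>y'\<close> lies in the
    block \<open>U y\<close>.\<close>
  have partial: "(\<Sum>t\<in>T y. x $$ (s, t) * y' $$ (t, s)) = 1"
    if x: "x \<in> carrier_mat r r" "y' \<in> carrier_mat r r" "x * y' = 1\<^sub>m r" and y: "y \<in> blocks" and s: "s < r"
      and img: "y' *\<^sub>v unit_vec r s \<in> U y" for x y' :: "complex mat" and y s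
  proof -
    have z: "y' $$ (t, s) = 0" if "t < r" "t \<notin> T y" for t
    proof -
      have "(y' *\<^sub>v unit_vec r s) $ t = 0" using img that unfolding U_coord_subspace[OF y] coord_subspace_def by blast
      then show ?thesis using mult_mat_unit_vec[OF x(2) s] x(2) that s by simp
    qed
    have "(\<Sum>t\<in>T y. x $$ (s, t) * y' $$ (t, s)) = (\<Sum>t<r. x $$ (s, t) * y' $$ (t, s))"
      using T_subset[of y] z by (intro sum.mono_neutral_left) auto
    also have "\<dots> = (x * y') $$ (s, s)"
      using x(1,2) s by (auto simp: scalar_prod_def atLeast0LessThan intro!: sum.cong)
    also have "\<dots> = 1" unfolding x(3) using s by simp
    finally show ?thesis .
  qed
  have 1: "(\<Sum>t\<in>T b. g $$ (s, t) * h $$ (t, s)) = 1" if s: "s \<in> T b'" for s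
    using partial[OF c h(3) b(1) _ hU[OF unit_vec_U[OF s]]] s T_subset[of b'] by blast
  have 2: "(\<Sum>s\<in>T b'. h $$ (t, s) * g $$ (s, t)) = 1" if t: "t \<in> T b" for t
  proof -
    have "g *\<^sub>v unit_vec r t \<in> U b'" unfolding g(2)[symmetric] using unit_vec_U[OF t] by (rule imageI)
    then show ?thesis using partial[OF c(2,1) h(2) b(2), of t] t T_subset[of b] by blast
  qed
  have "complex_of_nat (card (T b')) = (\<Sum>s\<in>T b'. \<Sum>t\<in>T b. g $$ (s, t) * h $$ (t, s))"
    using 1 by simp
  also have "\<dots> = (\<Sum>t\<in>T b. \<Sum>s\<in>T b'. h $$ (t, s) * g $$ (s, t))"
    by (subst sum.swap) (simp add: mult.commute)
  also have "\<dots> = complex_of_nat (card (T b))" using 2 by simp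
  finally show ?thesis by simp
qed

text \<open>The choice is unique, since distinct blocks are distinct subspaces and
  \<open>permutes\<close> fixes all other indices. Hence \<open>perm\<close> turns products into
  compositions exactly.\<close>

definition perm :: "complex mat \<Rightarrow> nat \<Rightarrow> nat \<Rightarrow> nat" where
  "perm g i = (SOME p. p permutes {1..k i} \<and> (\<forall>j\<in>{1..k i}. image_under g (W i j) = W i (p j)))"

lemma perm:
  assumes "g \<in> G" "i \<in> {1..m}"
  shows "perm g i permutes {1..k i}" "j \<in> {1..k i} \<Longrightarrow> image_under g (W i j) = W i (perm g i j)"
proof -
  have "\<exists>p. p permutes {1..k i} \<and> (\<forall>j\<in>{1..k i}. image_under g (W i j) = W i (p j))"
    using decompD(2)[OF assms(2)] assms(1) unfolding permutes_subspaces_def by blast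
  then have "perm g i permutes {1..k i} \<and> (\<forall>j\<in>{1..k i}. image_under g (W i j) = W i (perm g i j))"
    unfolding perm_def by (rule someI_ex)
  then show "perm g i permutes {1..k i}" "j \<in> {1..k i} \<Longrightarrow> image_under g (W i j) = W i (perm g i j)"
    by blast+
qed

lemma perm_in: "g \<in> G \<Longrightarrow> i \<in> {1..m} \<Longrightarrow> j \<in> {1..k i} \<Longrightarrow> perm g i j \<in> {1..k i}"
  using permutes_in_image[OF perm(1)] by blast

lemma perm_U: "g \<in> G \<Longrightarrow> i \<in> {1..m} \<Longrightarrow> j \<in> {1..k i} \<Longrightarrow> image_under g (U (i, j)) = U (i, perm g i j)"
  using perm(2) by (simp add: U_def)

lemma image_under_mult:
  assumes "g \<in> G" "h \<in> G" "X \<subseteq> carrier_vec r"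
  shows "image_under (g * h) X = image_under g (image_under h X)"
  unfolding image_image using assms(3) GD(1)[OF assms(1)] GD(1)[OF assms(2)]
  by (intro image_cong refl assoc_mult_mat_vec) auto

lemma perm_unique:
  assumes "g \<in> G" "i \<in> {1..m}" "j \<in> {1..k i}" "j' \<in> {1..k i}" "image_under g (U (i, j)) = U (i, j')"
  shows "perm g i j = j'"
proof -
  have "U (i, perm g i j) = U (i, j')" using perm_U[OF assms(1-3)] assms(5) by simp
  then have "(i, perm g i j) = (i, j')"
    using perm_in[OF assms(1-3)] assms(2,4) by (intro U_inj) (auto simp: blocks_def)
  then show ?thesis by simp
qed

lemma perm_mult:
  assumes g: "g \<in> G" "h \<in> G" and i: "i \<in> {1..m}"
  shows "perm (g * h) i = perm g i \<circ> perm h i"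
proof
  fix j
  show "perm (g * h) i j = (perm g i \<circ> perm h i) j"
  proof (cases "j \<in> {1..k i}")
    case True
    have b: "(i, j) \<in> blocks" using i True by (simp add: blocks_def)
    have "image_under (g * h) (U (i, j)) = image_under g (image_under h (U (i, j)))"
      using U_carrier[OF b] by (intro image_under_mult g) blast
    also have "\<dots> = U (i, perm g i (perm h i j))"
      using perm_U[OF g(2) i True] perm_U[OF g(1) i perm_in[OF g(2) i True]] by simp
    finally show ?thesis
      using perm_unique[OF GD(3)[OF g] i True perm_in[OF g(1) i perm_in[OF g(2) i True]]] by simp
  next
    case False
    then show ?thesis using perm(1)[OF g(1) i] perm(1)[OF g(2) i] perm(1)[OF GD(3)[OF g] i]
      by (simp add: permutes_not_in)
  qed
qed

lemma perm_one: "i \<in> {1..m} \<Longrightarrow> perm (1\<^sub>m r) i = id"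
proof
  fix j assume i: "i \<in> {1..m}"
  show "perm (1\<^sub>m r) i j = id j"
  proof (cases "j \<in> {1..k i}")
    case True
    have b: "(i, j) \<in> blocks" using i True by (simp add: blocks_def)
    have "image_under (1\<^sub>m r) (U (i, j)) = (\<lambda>v. v) ` U (i, j)"
      using U_carrier[OF b] by (intro image_cong) auto
    then show ?thesis using perm_unique[OF GD(2) i True True] by simp
  next
    case False
    then show ?thesis using perm(1)[OF GD(2) i] by (simp add: permutes_not_in)
  qed
qed

section \<open>Block-preserving and block-scalar elements\<close>

definition N :: "complex mat set" where
  "N = {g \<in> G. \<forall>b\<in>blocks. image_under g (U b) = U b}"

definition scal :: "complex mat \<Rightarrow> nat \<times> nat \<Rightarrow> bool" where
  "scal g b \<longleftrightarrow> (\<exists>c. \<forall>w\<in>U b. g *\<^sub>v w = c \<cdot>\<^sub>v w)"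

definition K :: "complex mat set" where
  "K = {g \<in> G. \<forall>b\<in>blocks. scal g b}"

definition lam :: "complex mat \<Rightarrow> nat \<times> nat \<Rightarrow> complex" where
  "lam g b = (SOME c. \<forall>w\<in>U b. g *\<^sub>v w = c \<cdot>\<^sub>v w)"

lemma lam: "scal g b \<Longrightarrow> w \<in> U b \<Longrightarrow> g *\<^sub>v w = lam g b \<cdot>\<^sub>v w"
  unfolding scal_def lam_def by (drule someI_ex) blast

lemma inverse_apply:
  "g \<in> G \<Longrightarrow> h \<in> G \<Longrightarrow> h * g = 1\<^sub>m r \<Longrightarrow> v \<in> carrier_vec r \<Longrightarrow> h *\<^sub>v (g *\<^sub>v v) = v"
  using assoc_mult_mat_vec[OF GD(1) GD(1), of h g v] by simp

lemma mult_smult_apply: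
  "g \<in> G \<Longrightarrow> v \<in> carrier_vec r \<Longrightarrow> g *\<^sub>v (c \<cdot>\<^sub>v v) = c \<cdot>\<^sub>v (g *\<^sub>v v)"
  by (rule mult_mat_vec[OF GD(1)])

lemma lam_nonzero:
  assumes "g \<in> G" "b \<in> blocks" "scal g b"
  shows "lam g b \<noteq> 0"
proof
  assume z: "lam g b = 0"
  obtain u where u: "u \<in> U b" "u \<noteq> 0\<^sub>v r" using U_nonzero[OF assms(2)] by blast
  have uc: "u \<in> carrier_vec r" using U_carrier[OF assms(2) u(1)] .
  obtain h where h: "h \<in> G" "h * g = 1\<^sub>m r" using GD(4)[OF assms(1)] by blast
  have "g *\<^sub>v u = 0\<^sub>v r" using lam[OF assms(3) u(1)] uc unfolding z by (auto intro: eq_vecI)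
  then have "u = 0\<^sub>v r" using inverse_apply[OF assms(1) h uc] mult_mat_zero_vec[OF GD(1)[OF h(1)]] by simp
  then show False using u(2) by simp
qed

lemma polar_G:
  "g \<in> G \<Longrightarrow> v \<in> carrier_vec r \<Longrightarrow> w \<in> carrier_vec r \<Longrightarrow>
    polar r F (g *\<^sub>v v) (g *\<^sub>v w) = polar r F v w"
  using Aut GD(1) by (intro polar_invariant[OF form]) (auto simp: Aut_form_def)

text \<open>
  For \<open>b \<noteq> c\<close> this says that \<open>F\<close> has a non-zero component in \<open>S\<^sup>d\<^sup>-\<^sup>1(U\<^sub>b\<^sup>*) \<otimes> U\<^sub>c\<^sup>*\<close>.
\<close>

definition linked :: "nat \<times> nat \<Rightarrow> nat \<times> nat \<Rightarrow> bool" where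
  "linked b c \<longleftrightarrow> (\<exists>v\<in>U b. \<exists>w\<in>U c. polar r F v w \<noteq> 0)"

lemma linked_perm:
  assumes g: "g \<in> G" and i: "i \<in> {1..m}" and jl: "j \<in> {1..k i}" "l \<in> {1..k i}" and "linked (i, j) (i, l)"
  shows "linked (i, perm g i j) (i, perm g i l)"
proof -
  obtain v w where vw: "v \<in> U (i, j)" "w \<in> U (i, l)" "polar r F v w \<noteq> 0"
    using assms(5) unfolding linked_def by blast
  have b: "(i, j) \<in> blocks" "(i, l) \<in> blocks" using i jl by (auto simp: blocks_def)
  have "polar r F (g *\<^sub>v v) (g *\<^sub>v w) \<noteq> 0"
    using polar_G[OF g U_carrier[OF b(1) vw(1)] U_carrier[OF b(2) vw(2)]] vw(3) by simp
  moreover have "g *\<^sub>v v \<in> U (i, perm g i j)" using perm_U[OF g i jl(1)] vw(1) by blast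
  moreover have "g *\<^sub>v w \<in> U (i, perm g i l)" using perm_U[OF g i jl(2)] vw(2) by blast
  ultimately show ?thesis unfolding linked_def by blast
qed

text \<open>In the invariance of the polar form the two scalars come out with the degrees
  \<open>d - 1\<close> and 1, next to a non-zero value. For \<open>b = c\<close> the relation says
  that the \<open>d\<close>-th power of the scalar is one.\<close>

lemma torus_relation:
  assumes g: "g \<in> G" "scal g b" "scal g c" and b: "b \<in> blocks" "c \<in> blocks" and "linked b c"
  shows "lam g b ^ (d - 1) * lam g c = 1"
proof -
  obtain v w where vw: "v \<in> U b" "w \<in> U c" "polar r F v w \<noteq> 0"
    using assms(6) unfolding linked_def by blast
  have c: "v \<in> carrier_vec r" "w \<in> carrier_vec r" using U_carrier b vw by auto
  have "polar r F v w = polar r F (lam g b \<cdot>\<^sub>v v) (lam g c \<cdot>\<^sub>v w)"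
    using polar_G[OF g(1) c] lam[OF g(2) vw(1)] lam[OF g(3) vw(2)] by simp
  also have "\<dots> = lam g b ^ (d - 1) * lam g c * polar r F v w"
    unfolding polar_smult_left[OF form c(1)] polar_smult_right[OF c(2)] by simp
  finally show ?thesis using vw(3) by simp
qed

text \<open>At a non-zero point of the block some partial derivative does not vanish, and its
  variable belongs to some block, possibly \<open>b\<close> itself.\<close>

lemma ex_linked: "b \<in> blocks \<Longrightarrow> \<exists>c\<in>blocks. linked b c"
proof -
  assume b: "b \<in> blocks"
  obtain v where v: "v \<in> U b" "v \<noteq> 0\<^sub>v r" using U_nonzero[OF b] by blast
  obtain u where u: "u < r" "polar r F v (unit_vec r u) \<noteq> 0"
    using smooth_form_polar[OF smooth U_carrier[OF b v(1)] v(2)] by blast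
  obtain c where "c \<in> blocks" "u \<in> T c" using T_cover[OF u(1)] by blast
  then show ?thesis using u(2) v(1) unit_vec_U unfolding linked_def by blast
qed

text \<open>An element of \<open>K\<close> is determined by its scalars, and the links give one
  equation for each. \<open>A\<close> is a set of blocks on which the scalars agree, represented by
  the single variable \<open>b0\<close>. A singleton \<open>A\<close> gives one factor
  \<open>d\<close> for every block; a larger one saves \<open>d\<close> for each further
  member.\<close>

lemma card_K_le:
  assumes A: "A \<subseteq> blocks" "b0 \<in> A" and const: "\<And>g b. g \<in> K \<Longrightarrow> b \<in> A \<Longrightarrow> lam g b = lam g b0"
  shows "finite K \<and> card K \<le> d ^ (card (blocks - A) + 1)"
proof -
  obtain \<phi> where \<phi>: "\<And>b. b \<in> blocks \<Longrightarrow> \<phi> b \<in> blocks \<and> linked b (\<phi> b)" using ex_linked by metis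
  define S where "S = insert b0 (blocks - A)"
  \<comment> \<open>Links into \<open>A\<close> are redirected to its representative, which carries
    the same scalar.\<close>
  define \<psi> where "\<psi> b = (if \<phi> b \<in> A then b0 else \<phi> b)" for b
  have SB: "S \<subseteq> blocks" using A by (auto simp: S_def)
  have finS: "finite S" using SB finite_blocks finite_subset by blast
  have KD: "g \<in> G" "b \<in> blocks \<Longrightarrow> scal g b" if "g \<in> K" for g b using that by (simp_all add: K_def)
  define Z where "Z = {l \<in> S \<rightarrow>\<^sub>E - {0::complex}. \<forall>b\<in>S. l b powi (int d - 1) * l (\<psi> b) = 1}"
  have \<psi>S: "\<psi> b \<in> S" if "b \<in> S" for b using \<phi>[of b] SB that by (auto simp: \<psi>_def S_def)
  \<comment> \<open>All exponents are \<open>d - 1\<close>, which is at least 2 because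
    \<open>d\<close> is at least 3, so each variable contributes \<open>d - 1 + 1\<close>.\<close>
  have Z: "finite Z \<and> card Z \<le> (\<Prod>b\<in>S. nat \<bar>int d - 1\<bar> + 1)"
    unfolding Z_def using finS \<psi>S d3 by (intro card_torus_solutions_le) auto
  have "inj_on (\<lambda>g. restrict (lam g) S) K"
  proof (rule inj_onI)
    fix g g' assume g: "g \<in> K" "g' \<in> K" and eq: "restrict (lam g) S = restrict (lam g') S"
    have lamS: "lam g b = lam g' b" if "b \<in> S" for b using fun_cong[OF eq, of b] that by simp
    have lameq: "lam g b = lam g' b" if "b \<in> blocks" for b
    proof (cases "b \<in> A")
      case True
      then show ?thesis using const[OF g(1)] const[OF g(2)] lamS[of b0] by (simp add: S_def)
    qed (use that lamS in \<open>simp add: S_def\<close>)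
    have gc: "g \<in> carrier_mat r r" "g' \<in> carrier_mat r r" using KD(1) GD(1) g by auto
    show "g = g'"
    proof (rule mat_col_eqI)
      fix t assume "t < dim_col g'"
      then have t: "t < r" using gc by simp
      obtain b where b: "b \<in> blocks" "t \<in> T b" using T_cover[OF t] by blast
      have "col g t = g *\<^sub>v unit_vec r t" by (rule mult_mat_unit_vec[OF gc(1) t, symmetric])
      also have "\<dots> = g' *\<^sub>v unit_vec r t"
        using lam[OF KD(2)[OF g(1) b(1)] unit_vec_U[OF b(2)]] lam[OF KD(2)[OF g(2) b(1)] unit_vec_U[OF b(2)]]
          lameq[OF b(1)] by simp
      also have "\<dots> = col g' t" by (rule mult_mat_unit_vec[OF gc(2) t])
      finally show "col g t = col g' t" .
    qed (use gc in auto)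
  qed
  moreover have "(\<lambda>g. restrict (lam g) S) ` K \<subseteq> Z"
  proof (rule image_subsetI)
    fix g assume g: "g \<in> K"
    have "lam g b powi (int d - 1) * lam g (\<psi> b) = 1" if b: "b \<in> S" for b
    proof -
      have bB: "b \<in> blocks" using b SB by blast
      have "lam g (\<psi> b) = lam g (\<phi> b)" using const[OF g] by (simp add: \<psi>_def)
      moreover have "lam g b powi (int d - 1) = lam g b ^ (d - 1)"
        using d3 by (simp add: power_int_def nat_diff_distrib')
      ultimately show ?thesis
        using torus_relation[OF KD(1)[OF g] KD(2)[OF g bB] KD(2)[OF g] bB] \<phi>[OF bB] by simp
    qed
    then show "restrict (lam g) S \<in> Z"
      unfolding Z_def using \<psi>S lam_nonzero[OF KD(1)[OF g] _ KD(2)[OF g]] SB by (auto simp: PiE_iff)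
  qed
  ultimately have "finite K \<and> card K \<le> card Z" using Z inj_on_finite card_inj_on_le by blast
  moreover have "(\<Prod>b\<in>S. nat \<bar>int d - 1\<bar> + 1) = d ^ card S" using d3 by (simp add: nat_diff_distrib')
  moreover have "card S = card (blocks - A) + 1" using A finite_blocks by (simp add: S_def)
  ultimately show ?thesis using Z by simp
qed

text \<open>Projective classes are recorded only on the blocks in \<open>S\<close>. Under
  \<open>ext\<close>, elements with trivial classes there are scalar on all blocks. The condition is
  immediate for \<open>S = blocks\<close>; whenever a block can be omitted from \<open>S\<close>,
  its factor disappears.\<close>

lemma card_N_le:
  assumes S: "S \<subseteq> blocks" "\<And>b. b \<in> S \<Longrightarrow> finite (H b)" and K: "finite K"
    and ext: "\<And>g b. g \<in> N \<Longrightarrow> (\<And>c. c \<in> S \<Longrightarrow> scal g c) \<Longrightarrow> b \<in> blocks \<Longrightarrow> scal g b"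
  shows "finite N \<and> card N \<le> (\<Prod>b\<in>S. card (H b)) * card K"
proof -
  have finS: "finite S" using S(1) finite_blocks finite_subset by blast
  define f where "f g = (\<lambda>b\<in>S. proj_class (U b) g)" for g
  have NG: "N \<subseteq> G" by (auto simp: N_def)
  have N_mult: "g * h \<in> N" if "g \<in> N" "h \<in> N" for g h
  proof -
    have gh: "g \<in> G" "h \<in> G" using that NG by auto
    have "image_under (g * h) (U b) = U b" if b: "b \<in> blocks" for b
      using image_under_mult[OF gh, of "U b"] U_carrier[OF b] \<open>g \<in> N\<close> \<open>h \<in> N\<close> b by (simp add: N_def subset_iff)
    then show ?thesis using GD(3)[OF gh] by (simp add: N_def)
  qed
  have N_inv: "\<exists>h\<in>N. h * g = 1\<^sub>m r \<and> g * h = 1\<^sub>m r" if g: "g \<in> N" for g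
  proof -
    have gG: "g \<in> G" using g NG by auto
    obtain h where h: "h \<in> G" "h * g = 1\<^sub>m r" "g * h = 1\<^sub>m r" using GD(4)[OF gG] by blast
    have "image_under h (U b) = U b" if b: "b \<in> blocks" for b
    proof -
      have "image_under h (image_under g (U b)) = (\<lambda>v. v) ` U b"
        unfolding image_image using inverse_apply[OF gG h(1,2)] U_carrier[OF b] by (intro image_cong) auto
      then show ?thesis using g b by (simp add: N_def)
    qed
    then have "h \<in> N" using h(1) by (simp add: N_def)
    then show ?thesis using h by blast
  qed
  have im: "f ` N \<subseteq> (\<Pi>\<^sub>E b\<in>S. H b)"
  proof (rule image_subsetI)
    fix g assume g: "g \<in> N"
    have "proj_class (U b) g \<in> H b" if "b \<in> S" for b
    proof -
      have "g \<in> stabilizer G (W (fst b) (snd b))" using g that S(1) by (auto simp: stabilizer_def N_def U_def)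
      then show ?thesis unfolding H_def H_group_def projective_image_eq U_def by (rule imageI)
    qed
    then show "f g \<in> (\<Pi>\<^sub>E b\<in>S. H b)" by (simp add: f_def)
  qed
  have finPi: "finite (\<Pi>\<^sub>E b\<in>S. H b)" using finS S(2) by (intro finite_PiE)
  have "finite N \<and> card N \<le> card (f ` N) * card K"
  proof (rule card_le_image_times_kernel[of N r])
    show "N \<subseteq> carrier_mat r r" using NG GD(1) by blast
    show "\<exists>h\<in>N. h * g = 1\<^sub>m r \<and> g * h = 1\<^sub>m r" if "g \<in> N" for g by (rule N_inv[OF that])
    show "finite K" by (rule K)
    show "finite (f ` N)" by (rule finite_subset[OF im finPi])
  next
    fix g g' h assume g: "g \<in> N" "g' \<in> N" "h \<in> N" and eq: "f g = f g'" and h: "h * g = 1\<^sub>m r" "g * h = 1\<^sub>m r"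
    have gG: "g \<in> G" "g' \<in> G" "h \<in> G" using g NG by auto
    have "scal (h * g') b" if b: "b \<in> S" for b
    proof -
      have bB: "b \<in> blocks" using b S(1) by blast
      have "proj_class (U b) g' = proj_class (U b) g" using fun_cong[OF eq, of b] b by (simp add: f_def)
      then obtain c where c: "\<forall>w\<in>U b. g' *\<^sub>v w = c \<cdot>\<^sub>v (g *\<^sub>v w)" unfolding proj_class_eq_iff by blast
      have "(h * g') *\<^sub>v w = c \<cdot>\<^sub>v w" if w: "w \<in> U b" for w
      proof -
        have wc: "w \<in> carrier_vec r" by (rule U_carrier[OF bB w])
        have "(h * g') *\<^sub>v w = h *\<^sub>v (g' *\<^sub>v w)" by (rule assoc_mult_mat_vec[OF GD(1)[OF gG(3)] GD(1)[OF gG(2)] wc])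
        also have "\<dots> = c \<cdot>\<^sub>v (h *\<^sub>v (g *\<^sub>v w))"
          using c w mult_smult_apply[OF gG(3) mult_mat_vec_carrier[OF GD(1)[OF gG(1)] wc]] by simp
        finally show ?thesis using inverse_apply[OF gG(1,3) h(1) wc] by simp
      qed
      then show ?thesis unfolding scal_def by blast
    qed
    then show "h * g' \<in> K"
      unfolding K_def using ext[OF N_mult[OF g(3,2)]] GD(3)[OF gG(3,2)] by blast
  qed
  moreover have "card (f ` N) \<le> (\<Prod>b\<in>S. card (H b))"
    using card_mono[OF finPi im] by (simp add: card_PiE[OF finS])
  ultimately show ?thesis using mult_le_mono1 order_trans by blast
qed

definition perms :: "complex mat \<Rightarrow> nat \<Rightarrow> nat \<Rightarrow> nat" where
  "perms g = (\<lambda>i\<in>{1..m}. perm g i)"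

lemma perms_in: "perms ` G \<subseteq> (\<Pi>\<^sub>E i\<in>{1..m}. {p. p permutes {1..k i}})"
  using perm(1) by (auto simp: perms_def)

lemma finite_perms: "finite (perms ` G)"
  by (rule finite_subset[OF perms_in]) (auto intro!: finite_PiE finite_permutations)

lemma card_G_le:
  assumes "finite N"
  shows "finite G \<and> card G \<le> card (perms ` G) * card N"
proof (rule card_le_image_times_kernel[of G r])
  show "G \<subseteq> carrier_mat r r" using GD(1) by blast
  show "\<exists>h\<in>G. h * g = 1\<^sub>m r \<and> g * h = 1\<^sub>m r" if "g \<in> G" for g by (rule GD(4)[OF that])
  show "finite N" by (rule assms)
  show "finite (perms ` G)" by (rule finite_perms)
next
  fix g g' h assume g: "g \<in> G" "g' \<in> G" "h \<in> G" and eq: "perms g = perms g'"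
    and h: "h * g = 1\<^sub>m r" "g * h = 1\<^sub>m r"
  have "image_under (h * g') (U b) = U b" if b: "b \<in> blocks" for b
  proof -
    obtain i j where ij: "b = (i, j)" "i \<in> {1..m}" "j \<in> {1..k i}" using b by (auto simp: blocks_def)
    have "perm g i = perm g' i" using fun_cong[OF eq, of i] ij(2) by (simp add: perms_def)
    then have "perm (h * g') i = perm (h * g) i" using perm_mult g ij(2) by simp
    then have "perm (h * g') i j = j" using perm_one[OF ij(2)] h(1) by simp
    then show ?thesis using perm_U[OF GD(3)[OF g(3,2)] ij(2,3)] ij(1) by simp
  qed
  then show "h * g' \<in> N" using GD(3)[OF g(3,2)] by (simp add: N_def)
qed

lemma stabilizer_subgroup:
  assumes b: "b \<in> blocks"
  shows "subgroup (stabilizer G (U b)) (GL r)"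
  unfolding subgroup_GL_iff
proof (intro conjI ballI)
  have Uc: "U b \<subseteq> carrier_vec r" using U_carrier[OF b] by blast
  show "stabilizer G (U b) \<subseteq> carrier_mat r r" using GD(1) by (auto simp: stabilizer_def)
  have "image_under (1\<^sub>m r) (U b) = (\<lambda>v. v) ` U b" using Uc by (intro image_cong) auto
  then show "1\<^sub>m r \<in> stabilizer G (U b)" using GD(2) by (simp add: stabilizer_def)
  show "g * h \<in> stabilizer G (U b)" if "g \<in> stabilizer G (U b)" "h \<in> stabilizer G (U b)" for g h
    using that image_under_mult[of g h "U b"] Uc GD(3)[of g h] by (simp add: stabilizer_def)
  show "\<exists>h\<in>stabilizer G (U b). h * g = 1\<^sub>m r \<and> g * h = 1\<^sub>m r" if "g \<in> stabilizer G (U b)" for g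
  proof -
    have gG: "g \<in> G" and gU: "image_under g (U b) = U b" using that by (simp_all add: stabilizer_def)
    obtain h where h: "h \<in> G" "h * g = 1\<^sub>m r" "g * h = 1\<^sub>m r" using GD(4)[OF gG] by blast
    have "image_under h (image_under g (U b)) = (\<lambda>v. v) ` U b"
      unfolding image_image using inverse_apply[OF gG h(1,2)] Uc by (intro image_cong) auto
    then have "h \<in> stabilizer G (U b)" using h gU by (simp add: stabilizer_def)
    then show ?thesis using h by blast
  qed
qed

lemma card_H_le_JC:
  assumes b: "b \<in> blocks" and fin: "finite G"
  shows "card (H b) \<le> JC (sub_dim r (U b))"
proof -
  have "H b = projective_image (coord_subspace r (T b)) (stabilizer G (U b))"
    unfolding H_def H_group_def U_coord_subspace[OF b, symmetric] by (simp add: U_def)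
  moreover have "card \<dots> \<le> JC (card (T b))"
  proof (rule card_projective_image_le_JC[OF stabilizer_subgroup[OF b]])
    show "finite (stabilizer G (U b))" using fin by (simp add: stabilizer_def)
    show "image_under g (coord_subspace r (T b)) = coord_subspace r (T b)" if "g \<in> stabilizer G (U b)" for g
      using that U_coord_subspace[OF b] by (simp add: stabilizer_def)
    show "acts_primitively r (stabilizer G (U b)) (coord_subspace r (T b))"
      using U_primitive[OF b] U_coord_subspace[OF b] by simp
  qed (rule T_subset)
  ultimately show ?thesis using dim_U[OF b] by simp
qed

text \<open>
  The elements of \<open>N\<close> that are scalar on all the other blocks of \<open>V i\<close> form a normal subgroup of the
  stabilizer of \<open>U (i, 1)\<close>, and invariance of the polar form makes them commute on \<open>U (i, 1)\<close>.
\<close>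

lemma scal_first_block:
  assumes fin: "finite G" and i: "i \<in> {1..m}" "1 \<in> {1..k i}"
    and j0: "j0 \<in> {1..k i}" "j0 \<noteq> 1" "linked (i, j0) (i, 1)"
    and n: "n \<in> N" "\<And>j. j \<in> {1..k i} \<Longrightarrow> j \<noteq> 1 \<Longrightarrow> scal n (i, j)"
  shows "scal n (i, 1)"
proof -
  let ?b = "(i, 1::nat)"
  have b: "?b \<in> blocks" using i by (simp add: blocks_def)
  define S where "S = stabilizer G (U ?b)"
  have S: "subgroup S (GL r)" unfolding S_def by (rule stabilizer_subgroup[OF b])
  have SG: "S \<subseteq> G" by (auto simp: S_def stabilizer_def)
  have finS: "finite S" using SG fin finite_subset by blast
  have prim: "acts_primitively r S (U ?b)" unfolding S_def by (rule U_primitive[OF b])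
  have irr: "X = {0\<^sub>v r} \<or> X = U ?b" if "is_subspace r X" "X \<subseteq> U ?b" "stable S X" for X
    using prim that unfolding acts_primitively_def acts_irreducibly_def by blast
  define J where "J = {j \<in> {1..k i}. j \<noteq> 1}"
  have Jb: "(i, j) \<in> blocks" if "j \<in> J" for j using that i by (simp add: J_def blocks_def)
  define A where "A = {n \<in> N. \<forall>j\<in>J. scal n (i, j)}"
  have AN: "a \<in> N" "j \<in> J \<Longrightarrow> scal a (i, j)" if "a \<in> A" for a j using that by (simp_all add: A_def)
  have NG: "a \<in> G" if "a \<in> N" for a using that by (simp add: N_def)
  have AS: "A \<subseteq> S" using b by (auto simp: A_def N_def S_def stabilizer_def)
  have S_perm1: "perm s i 1 = 1" if "s \<in> S" for s
    using perm_unique[OF _ i(1,2,2)] that by (simp add: S_def stabilizer_def)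
  have S_permJ: "perm s i j \<in> J" if s: "s \<in> S" and j: "j \<in> J" for s j
  proof -
    have sG: "s \<in> G" using s SG by blast
    have "perm s i j \<in> {1..k i}" using perm_in[OF sG i(1)] j by (simp add: J_def)
    moreover have "perm s i j \<noteq> perm s i 1"
      using permutes_inj[OF perm(1)[OF sG i(1)]] j by (auto simp: J_def dest: injD)
    ultimately show ?thesis using S_perm1[OF s] by (simp add: J_def)
  qed
  \<comment> \<open>The preimage of \<open>v\<close> under \<open>a\<close> is a multiple of
    \<open>v\<close>, so invariance shows that \<open>a\<close> multiplies the functional
    \<open>polar r F v\<close> by a number independent of \<open>w\<close>.\<close>
  have polar_A: "polar r F v (a *\<^sub>v w) = inverse (lam a (i, j)) ^ (d - 1) * polar r F v w"
    if a: "a \<in> A" and j: "j \<in> J" and v: "v \<in> U (i, j)" and w: "w \<in> carrier_vec r" for a j v w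
  proof -
    have aG: "a \<in> G" using NG[OF AN(1)[OF a]] .
    have vc: "v \<in> carrier_vec r" by (rule U_carrier[OF Jb[OF j] v])
    let ?c = "lam a (i, j)"
    have c0: "?c \<noteq> 0" by (rule lam_nonzero[OF aG Jb[OF j] AN(2)[OF a j]])
    have "a *\<^sub>v (inverse ?c \<cdot>\<^sub>v v) = inverse ?c \<cdot>\<^sub>v (?c \<cdot>\<^sub>v v)"
      using mult_smult_apply[OF aG vc] lam[OF AN(2)[OF a j] v] by simp
    also have "\<dots> = v" using c0 by (simp add: smult_smult_assoc)
    finally have "polar r F v (a *\<^sub>v w) = polar r F (a *\<^sub>v (inverse ?c \<cdot>\<^sub>v v)) (a *\<^sub>v w)" by simp
    also have "\<dots> = polar r F (inverse ?c \<cdot>\<^sub>v v) w" using vc w by (intro polar_G aG) auto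
    also have "\<dots> = inverse ?c ^ (d - 1) * polar r F v w" by (rule polar_smult_left[OF form vc])
    finally show ?thesis .
  qed
  \<comment> \<open>The common kernel of these functionals on the first block. \<open>S\<close>
    permutes the other blocks, so \<open>X\<close> is stable; the link from \<open>j0\<close> makes
    it proper, and irreducibility leaves only zero.\<close>
  define X where "X = {u \<in> U ?b. \<forall>j\<in>J. \<forall>v\<in>U (i, j). polar r F v u = 0}"
  have X0: "X = {0\<^sub>v r}"
  proof -
    have "is_subspace r X"
    proof -
      have "\<forall>c. \<forall>u\<in>U ?b. c \<cdot>\<^sub>v u \<in> U ?b" "\<forall>u\<in>U ?b. \<forall>v\<in>U ?b. u + v \<in> U ?b" "0\<^sub>v r \<in> U ?b"
        using U_subspace[OF b] unfolding is_subspace_iff by blast+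
      moreover have "polar r F v (0\<^sub>v r) = 0" for v by (simp add: polar_def)
      ultimately show ?thesis
        unfolding is_subspace_iff X_def using U_carrier[OF b]
        by (auto simp: polar_add_right polar_smult_right)
    qed
    moreover have "stable S X"
      unfolding stable_def
    proof (intro ballI image_subsetI)
      fix s u assume s: "s \<in> S" and u: "u \<in> X"
      have sG: "s \<in> G" using s SG by blast
      obtain t where t: "t \<in> S" "t * s = 1\<^sub>m r" "s * t = 1\<^sub>m r" using subgroup_GL_D(4)[OF S s] by blast
      have tG: "t \<in> G" using t SG by blast
      have uU: "u \<in> U ?b" using u by (simp add: X_def)
      have uc: "u \<in> carrier_vec r" by (rule U_carrier[OF b uU])
      have "s *\<^sub>v u \<in> U ?b" using s uU by (auto simp: S_def stabilizer_def)
      moreover have "polar r F v (s *\<^sub>v u) = 0" if j: "j \<in> J" and v: "v \<in> U (i, j)" for j v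
      proof -
        have vc: "v \<in> carrier_vec r" by (rule U_carrier[OF Jb[OF j] v])
        have "t *\<^sub>v v \<in> U (i, perm t i j)" using perm_U[OF tG i(1), of j] j v by (auto simp: J_def)
        then have "polar r F (t *\<^sub>v v) u = 0" using u S_permJ[OF t(1) j] by (simp add: X_def)
        moreover have "polar r F (t *\<^sub>v v) u = polar r F (t *\<^sub>v v) (t *\<^sub>v (s *\<^sub>v u))"
          using inverse_apply[OF sG tG t(2) uc] by simp
        moreover have "\<dots> = polar r F v (s *\<^sub>v u)"
          by (rule polar_G[OF tG vc mult_mat_vec_carrier[OF GD(1)[OF sG] uc]])
        ultimately show ?thesis by simp
      qed
      ultimately show "s *\<^sub>v u \<in> X" by (simp add: X_def)
    qed
    moreover have "X \<subseteq> U ?b" by (auto simp: X_def)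
    moreover have "X \<noteq> U ?b"
    proof
      assume eq: "X = U ?b"
      obtain v w where vw: "v \<in> U (i, j0)" "w \<in> U ?b" "polar r F v w \<noteq> 0" using j0(3) unfolding linked_def by blast
      have "w \<in> X" using vw(2) eq by simp
      then show False using vw j0 by (auto simp: X_def J_def)
    qed
    ultimately show ?thesis using irr by blast
  qed
  have "\<exists>c. \<forall>w\<in>U ?b. n *\<^sub>v w = c \<cdot>\<^sub>v w"
  proof (rule primitive_commuting_scalar[OF S finS prim AS])
    show "n \<in> A" using n by (simp add: A_def J_def)
  next
    fix g h a :: "complex mat" assume g: "g \<in> S" "h \<in> S" "h * g = 1\<^sub>m r" and a: "a \<in> A"
    have G': "g \<in> G" "h \<in> G" "a \<in> G" using g SG NG[OF AN(1)[OF a]] by auto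
    have gc: "g \<in> carrier_mat r r" "h \<in> carrier_mat r r" "a \<in> carrier_mat r r" using GD(1) G' by auto
    have gh: "g * h = 1\<^sub>m r" by (rule mat_mult_left_right_inverse[OF gc(2,1) g(3)])
    have app: "(h * a * g) *\<^sub>v w = h *\<^sub>v (a *\<^sub>v (g *\<^sub>v w))" if w: "w \<in> carrier_vec r" for w
    proof -
      have "(h * a * g) *\<^sub>v w = (h * a) *\<^sub>v (g *\<^sub>v w)"
        by (rule assoc_mult_mat_vec[OF mult_carrier_mat[OF gc(2,3)] gc(1) w])
      also have "\<dots> = h *\<^sub>v (a *\<^sub>v (g *\<^sub>v w))"
        by (rule assoc_mult_mat_vec[OF gc(2,3) mult_mat_vec_carrier[OF gc(1) w]])
      finally show ?thesis .
    qed
    have hag: "h * a * g \<in> G" using GD(3) G' by blast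
    have "image_under (h * a * g) (U c) = U c" if c: "c \<in> blocks" for c
    proof -
      obtain i' j where ij: "c = (i', j)" "i' \<in> {1..m}" "j \<in> {1..k i'}" using c by (auto simp: blocks_def)
      have "perm a i' = id"
      proof
        fix l show "perm a i' l = id l"
        proof (cases "l \<in> {1..k i'}")
          case True
          then have "(i', l) \<in> blocks" using ij(2) by (simp add: blocks_def)
          then have "image_under a (U (i', l)) = U (i', l)" using AN(1)[OF a] by (simp add: N_def)
          then show ?thesis using perm_unique[OF G'(3) ij(2) True True] by simp
        next
          case False
          then show ?thesis using perm(1)[OF G'(3) ij(2)] by (simp add: permutes_not_in)
        qed
      qed
      then have "perm (h * a * g) i' = perm (h * g) i'"
        using perm_mult[OF GD(3)[OF G'(2,3)] G'(1) ij(2)] perm_mult[OF G'(2,3) ij(2)] perm_mult[OF G'(2,1) ij(2)] by simp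
      then have "perm (h * a * g) i' j = j" using perm_one[OF ij(2)] g(3) by simp
      then show ?thesis using perm_U[OF hag ij(2,3)] ij(1) by simp
    qed
    then have "h * a * g \<in> N" using hag by (simp add: N_def)
    moreover have "scal (h * a * g) (i, j)" if j: "j \<in> J" for j
    proof -
      \<comment> \<open>On block \<open>j\<close> the conjugate acts by the scalar of
        \<open>a\<close> on the block to which \<open>g\<close> moves it.\<close>
      have pj: "perm g i j \<in> J" by (rule S_permJ[OF g(1) j])
      have "(h * a * g) *\<^sub>v w = lam a (i, perm g i j) \<cdot>\<^sub>v w" if w: "w \<in> U (i, j)" for w
      proof -
        have wc: "w \<in> carrier_vec r" by (rule U_carrier[OF Jb[OF j] w])
        have "g *\<^sub>v w \<in> U (i, perm g i j)" using perm_U[OF G'(1) i(1), of j] j w by (auto simp: J_def)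
        then have "a *\<^sub>v (g *\<^sub>v w) = lam a (i, perm g i j) \<cdot>\<^sub>v (g *\<^sub>v w)" by (rule lam[OF AN(2)[OF a pj]])
        then show ?thesis
          unfolding app[OF wc]
          using mult_smult_apply[OF G'(2) mult_mat_vec_carrier[OF gc(1) wc]] inverse_apply[OF G'(1,2) g(3) wc] by simp
      qed
      then show ?thesis unfolding scal_def by blast
    qed
    ultimately show "h * a * g \<in> A" by (simp add: A_def)
  next
    fix a a' and w :: "complex vec" assume a: "a \<in> A" "a' \<in> A" and w: "w \<in> U ?b"
    have aG: "a \<in> G" "a' \<in> G" using NG AN(1) a by auto
    have aU: "x *\<^sub>v u \<in> U ?b" if "x \<in> A" "u \<in> U ?b" for x u
      using that AS by (auto simp: S_def stabilizer_def)
    have wc: "w \<in> carrier_vec r" by (rule U_carrier[OF b w])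
    let ?p = "a *\<^sub>v (a' *\<^sub>v w)" and ?q = "a' *\<^sub>v (a *\<^sub>v w)"
    have pq: "?p \<in> U ?b" "?q \<in> U ?b" using aU a w by blast+
    have pqc: "?p \<in> carrier_vec r" "?q \<in> carrier_vec r" using U_carrier[OF b] pq by blast+
    \<comment> \<open>Each functional takes the same value on both products, since its multipliers
      under \<open>a\<close> and \<open>a'\<close> are numbers and commute. The difference lies in
      the common kernel.\<close>
    have "?p + (-1) \<cdot>\<^sub>v ?q \<in> X"
    proof -
      have "?p + (-1) \<cdot>\<^sub>v ?q \<in> U ?b" using U_subspace[OF b] pq unfolding is_subspace_iff by blast
      moreover have "polar r F v (?p + (-1) \<cdot>\<^sub>v ?q) = 0" if j: "j \<in> J" and v: "v \<in> U (i, j)" for j v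
      proof -
        have "polar r F v (?p + (-1) \<cdot>\<^sub>v ?q) = polar r F v ?p - polar r F v ?q"
          using pqc by (simp add: polar_add_right polar_smult_right)
        moreover have "polar r F v ?p = polar r F v ?q"
          using polar_A[OF a(1) j v mult_mat_vec_carrier[OF GD(1)[OF aG(2)] wc]] polar_A[OF a(2) j v wc]
            polar_A[OF a(2) j v mult_mat_vec_carrier[OF GD(1)[OF aG(1)] wc]] polar_A[OF a(1) j v wc] by simp
        ultimately show ?thesis by simp
      qed
      ultimately show ?thesis by (simp add: X_def)
    qed
    then have z: "?p + (-1) \<cdot>\<^sub>v ?q = 0\<^sub>v r" using X0 by simp
    show "?p = ?q"
    proof (rule eq_vecI)
      fix t assume "t < dim_vec ?q"
      then have t: "t < r" using pqc(2) by (simp only: carrier_vecD[OF pqc(2)])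
      have "(?p + (-1) \<cdot>\<^sub>v ?q) $ t = ?p $ t - ?q $ t"
        using t carrier_vecD[OF pqc(1)] carrier_vecD[OF pqc(2)] by (simp del: index_mult_mat_vec dim_mult_mat_vec)
      then show "?p $ t = ?q $ t" unfolding z using t by (simp del: index_mult_mat_vec dim_mult_mat_vec)
    qed (use carrier_vecD[OF pqc(1)] carrier_vecD[OF pqc(2)] in simp)
  qed
  then show ?thesis by (simp add: scal_def)
qed

end

section \<open>The bounds\<close>

lemma ex_permutes_pair:
  assumes "j \<in> S" "l \<in> S" "j \<noteq> l" "x \<in> S" "y \<in> S" "x \<noteq> y"
  shows "\<exists>p. p permutes S \<and> p x = j \<and> p y = l"
proof -
  define q where "q = transpose x j"
  \<comment> \<open>After \<open>q\<close> has sent \<open>x\<close> to \<open>j\<close>, the second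
    transposition moves the image of \<open>y\<close> to \<open>l\<close>; it fixes
    \<open>j\<close>, as neither \<open>q y\<close> nor \<open>l\<close> equals
    \<open>j\<close>.\<close>
  define p where "p = transpose (q y) l \<circ> q"
  have q: "q permutes S" "q x = j" unfolding q_def using assms by (auto intro: permutes_swap_id)
  have qy: "q y \<in> S" "q y \<noteq> j"
    using permutes_in_image[OF q(1)] assms q(2) permutes_inj[OF q(1)] by (auto dest: injD)
  have "p permutes S" unfolding p_def using q(1) qy(1) assms by (intro permutes_compose permutes_swap_id) auto
  moreover have "p x = j" using q(2) qy(2) assms by (simp add: p_def)
  moreover have "p y = l" by (simp add: p_def)
  ultimately show ?thesis by blast
qed

lemma (in form_decomposition) k_pos: "i \<in> {1..m} \<Longrightarrow> k i \<ge> 1"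
proof (rule ccontr)
  assume i: "i \<in> {1..m}" and "\<not> k i \<ge> 1"
  then have e: "{1..k i} = {}" by simp
  have "V i \<subseteq> {0\<^sub>v r}"
    using decompD(1)[OF i] unfolding internal_direct_sum_iff e by auto
  moreover have "0\<^sub>v r \<in> V i" "V i \<noteq> {0\<^sub>v r}"
    using decompD(5)[OF i] unfolding acts_irreducibly_def is_subspace_iff by blast+
  ultimately show False by blast
qed

lemma (in form_decomposition) canonical_bound_eq:
  "canonical_bound d G m k W = d ^ card blocks * (\<Prod>b\<in>blocks. card (H b)) * (\<Prod>i=1..m. fact (k i))"
proof -
  have "(\<Prod>i=1..m. \<Prod>j=1..k i. card (H_group G W i j)) = (\<Prod>b\<in>blocks. card (H b))"
    unfolding blocks_def H_def by (subst prod.Sigma) (auto simp: case_prod_beta)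
  then show ?thesis unfolding canonical_bound_def card_blocks by simp
qed

text \<open>The witness \<open>c\<close> is the product of the factorials of the multiplicities. Its
  lower bound settles the factorials, which reduces the comparison of the two bounds to
  \<open>H\<close> against \<open>JC\<close>.\<close>

lemma (in form_decomposition) Fermat_ratio_eq:
  "\<exists>c. (\<Prod>i=1..m. fact (k i)) \<le> c \<and>
    Fermat_ratio (subdegree_sequence r m k W) d * real d ^ r * fact r =
      real d ^ card blocks * (\<Prod>b\<in>blocks. real (JC (sub_dim r (U b)))) * real c"
proof -
  define f where "f i j = sub_dim r (W i j)" for i j
  define L where "L = block_list m k f"
  define c where "c = (\<Prod>y\<in>set L. fact (count_list L y) :: nat)"
  have fT: "f i j = card (T (i, j))" if "(i, j) \<in> blocks" for i j
    using dim_U[OF that] by (simp add: f_def U_def)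
  \<comment> \<open>Blocks of one summand have equal dimension because \<open>G\<close> permutes
    them transitively.\<close>
  have "f i j = f i 1" if i: "i \<in> {1..m}" and j: "j \<in> {1..k i}" for i j
  proof -
    have b: "(i, 1) \<in> blocks" "(i, j) \<in> blocks" using i j by (auto simp: blocks_def)
    have "1 \<in> {1..k i}" using k_pos[OF i] by simp
    then obtain g where "g \<in> G" "image_under g (W i 1) = W i j"
      using decompD(3)[OF i _ j] by blast
    then show ?thesis using card_T_eq[OF b, of g] fT[OF b(1)] fT[OF b(2)] by (simp add: U_def)
  qed
  then have "(\<Prod>i=1..m. fact (k i)) \<le> c"
    unfolding c_def L_def using k_pos by (intro prod_fact_le_prod_count) blast+
  moreover have "sum_list L = r"
  proof -
    have "sum_list L = (\<Sum>i=1..m. \<Sum>j=1..k i. f i j)"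
      unfolding L_def using sum_list_block_list[of "\<lambda>x. x" m k f] by simp
    also have "\<dots> = (\<Sum>b\<in>blocks. f (fst b) (snd b))"
      unfolding blocks_def by (subst sum.Sigma) (auto simp: case_prod_beta)
    also have "\<dots> = (\<Sum>b\<in>blocks. card (T b))" by (intro sum.cong refl) (metis fT prod.collapse)
    finally show ?thesis using sum_card_T by simp
  qed
  moreover have "subdegree_sequence r m k W = rev (sort L)"
    by (simp add: subdegree_sequence_def L_def block_list_def f_def[abs_def])
  moreover have "(\<Prod>i=1..m. \<Prod>j=1..k i. real (JC (f i j))) = (\<Prod>b\<in>blocks. real (JC (sub_dim r (U b))))"
    unfolding blocks_def U_def f_def by (subst prod.Sigma) (auto simp: case_prod_beta)
  ultimately show ?thesis
    using Fermat_ratio_rev_sort_block_list[of d m k f r] d3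
    by (intro exI[of _ c]) (simp add: L_def c_def card_blocks)
qed

lemma (in form_decomposition) finite_H_imp_finite_G:
  assumes "\<And>b. b \<in> blocks \<Longrightarrow> finite (H b)" "b0 \<in> blocks"
  shows "finite G"
proof -
  have "finite K" using card_K_le[of "{b0}" b0] assms(2) by blast
  then have "finite N" using card_N_le[OF order_refl assms(1)] by blast
  then show ?thesis using card_G_le by blast
qed

text \<open>An inequality of natural numbers without division: the factor of block
  \<open>(a, 1)\<close> is left out of the product and the 2 stands on the left. The 2 is gained
  either in the image of \<open>G\<close> in the symmetric group of the blocks of \<open>V a\<close>
  or in \<open>K\<close>.\<close>

theorem (in form_decomposition) card_G_le_canonical_bound:
  assumes fin: "\<And>b. b \<in> blocks \<Longrightarrow> finite (H b)"
    and a: "a \<in> {1..m}" "k a \<ge> 2" and lnk: "linked (a, 1) (a, 2)"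
  shows "card G * (if k a = 2 then 1 else 2) \<le>
    d ^ card blocks * (\<Prod>b\<in>blocks - {(a, 1)}. card (H b)) * (\<Prod>i=1..m. fact (k i))"
proof -
  have in12: "1 \<in> {1..k a}" "2 \<in> {1..k a}" using a(2) by auto
  have b1: "(a, 1) \<in> blocks" using a in12 by (simp add: blocks_def)
  have finG: "finite G" using finite_H_imp_finite_G[OF fin b1] .
  \<comment> \<open>The given link leads from block 1 to block 2. An element of \<open>G\<close>
    moving block 2 to block 1 turns it into a link into block 1.\<close>
  obtain j0 where j0: "j0 \<in> {1..k a}" "j0 \<noteq> 1" "linked (a, j0) (a, 1)"
  proof -
    obtain g where g: "g \<in> G" "image_under g (W a 2) = W a 1" using decompD(3)[OF a(1) in12(2,1)] by blast
    have p2: "perm g a 2 = 1" using perm_unique[OF g(1) a(1) in12(2,1)] g(2) by (simp add: U_def)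
    have "perm g a 1 \<noteq> perm g a 2"
      using injD[OF permutes_inj[OF perm(1)[OF g(1) a(1)]], of 1 2] by auto
    then show ?thesis
      using that[of "perm g a 1"] perm_in[OF g(1) a(1) in12(1)] linked_perm[OF g(1) a(1) in12 lnk] p2 by simp
  qed
  define X where "X = (\<Prod>b\<in>blocks - {(a, 1)}. card (H b))"
  have finK: "finite K" using card_K_le[of "{(a, 1)}" "(a, 1)"] b1 by blast
  have N: "finite N \<and> card N \<le> X * card K"
    unfolding X_def
  proof (rule card_N_le)
    fix g b assume g: "g \<in> N" "\<And>c. c \<in> blocks - {(a, 1)} \<Longrightarrow> scal g c" and b: "b \<in> blocks"
    have "scal g (a, 1)"
      using g a(1) by (intro scal_first_block[OF finG a(1) in12(1) j0 g(1)] g(2)) (auto simp: blocks_def)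
    then show "scal g b" using g(2)[of b] b by blast
  qed (use fin finK in auto)
  have cardG: "card G \<le> card (perms ` G) * (X * card K)"
    using card_G_le N mult_le_mono2 order_trans by blast
  define Q where "Q = (\<Prod>i\<in>{1..m} - {a}. fact (k i) :: nat)"
  define R where "R = (\<lambda>g. perm g a) ` G"
  have finP: "finite {p. p permutes {1..k a}}" by (rule finite_permutations) simp
  have RP: "R \<subseteq> {p. p permutes {1..k a}}" using perm(1) a(1) by (auto simp: R_def)
  have finR: "finite R" by (rule finite_subset[OF RP finP])
  have factP: "card {p. p permutes {1..k i}} = fact (k i)" for i by (rule card_permutations) simp_all
  have perms_le: "card (perms ` G) \<le> card R * Q"
  proof -
    \<comment> \<open>The factor at \<open>a\<close> is kept as the actual image \<open>R\<close>,
      where a factor 2 may be saved.\<close>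
    define D where "D i = (if i = a then R else {p. p permutes {1..k i}})" for i
    have "perms ` G \<subseteq> (\<Pi>\<^sub>E i\<in>{1..m}. D i)" using perm(1) by (auto simp: perms_def D_def R_def)
    moreover have "finite (\<Pi>\<^sub>E i\<in>{1..m}. D i)" using finR by (intro finite_PiE) (auto simp: D_def finite_permutations)
    ultimately have "card (perms ` G) \<le> (\<Prod>i=1..m. card (D i))" using card_mono by (metis card_PiE finite_atLeastAtMost)
    also have "\<dots> = card (D a) * (\<Prod>i\<in>{1..m} - {a}. card (D i))" using a(1) by (intro prod.remove) auto
    also have "(\<Prod>i\<in>{1..m} - {a}. card (D i)) = Q" unfolding Q_def D_def using factP by (intro prod.cong refl) (simp del: One_nat_def)
    finally show ?thesis by (simp add: D_def)
  qed
  have Rle: "card R \<le> fact (k a)" using card_mono[OF finP RP] factP by simp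
  have prodf: "(\<Prod>i=1..m. fact (k i)) = fact (k a) * Q" unfolding Q_def using a(1) by (intro prod.remove) auto
  have Kle: "card K \<le> d ^ card blocks"
  proof -
    have "finite K \<and> card K \<le> d ^ (card (blocks - {(a, 1)}) + 1)"
      by (rule card_K_le) (use b1 in simp_all)
    moreover have "card blocks = card (blocks - {(a, 1)}) + 1" using card.remove[OF finite_blocks b1] by simp
    ultimately show ?thesis by simp
  qed
  have "card R * card K * (if k a = 2 then 1 else 2) \<le> fact (k a) * d ^ card blocks"
  proof (cases "k a = 2")
    case True
    then show ?thesis using Rle Kle mult_le_mono by auto
  next
    case False
    show ?thesis
    proof (cases "R = {p. p permutes {1..k a}}")
      case False
      \<comment> \<open>\<open>R\<close> is a group, so its translate by a missing permutation is
        disjoint from it and has the same size.\<close>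
      then obtain \<sigma> where \<sigma>: "\<sigma> permutes {1..k a}" "\<sigma> \<notin> R" using RP by blast
      have "inj_on (\<lambda>p. \<sigma> \<circ> p) R"
      proof (intro inj_onI ext)
        fix p q x assume "\<sigma> \<circ> p = \<sigma> \<circ> q"
        from fun_cong[OF this, of x] show "p x = q x" using injD[OF permutes_inj[OF \<sigma>(1)]] by simp
      qed
      moreover have "(\<lambda>p. \<sigma> \<circ> p) ` R \<subseteq> {p. p permutes {1..k a}} - R"
      proof (rule image_subsetI)
        fix p assume p: "p \<in> R"
        have "\<sigma> \<circ> p \<notin> R"
        proof
          assume "\<sigma> \<circ> p \<in> R"
          then obtain g g' where g: "g \<in> G" "g' \<in> G" "p = perm g a" "\<sigma> \<circ> p = perm g' a" using p unfolding R_def by blast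
          obtain h where h: "h \<in> G" "h * g = 1\<^sub>m r" "g * h = 1\<^sub>m r" using GD(4)[OF g(1)] by blast
          have "perm g a \<circ> perm h a = id" using perm_mult[OF g(1) h(1) a(1)] perm_one[OF a(1)] h(3) by simp
          then have "\<sigma> = (\<sigma> \<circ> p) \<circ> perm h a" unfolding g(3) by (simp add: comp_assoc)
          also have "\<dots> = perm (g' * h) a" unfolding g(4) using perm_mult[OF g(2) h(1) a(1)] by simp
          finally show False using \<sigma>(2) GD(3)[OF g(2) h(1)] by (auto simp: R_def)
        qed
        moreover have "(\<sigma> \<circ> p) permutes {1..k a}" using permutes_compose[OF _ \<sigma>(1)] p RP by blast
        ultimately show "\<sigma> \<circ> p \<in> {p. p permutes {1..k a}} - R" by blast
      qed
      ultimately have "card R \<le> card ({p. p permutes {1..k a}} - R)"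
        using finP by (intro card_inj_on_le[of "\<lambda>p. \<sigma> \<circ> p"]) auto
      also have "\<dots> = fact (k a) - card R" using card_Diff_subset[OF finR RP] factP by simp
      finally have "2 * card R \<le> fact (k a)" using Rle by simp
      then have "2 * card R * card K \<le> fact (k a) * d ^ card blocks" using Kle by (rule mult_le_mono)
      then show ?thesis using \<open>k a \<noteq> 2\<close> by (simp add: mult_ac)
    next
      case True
      \<comment> \<open>The full symmetric group is doubly transitive, so one link produces all
        links between distinct blocks of \<open>V a\<close>.\<close>
      have full: "linked (a, j) (a, l)" if jl: "j \<in> {1..k a}" "l \<in> {1..k a}" "j \<noteq> l" for j l
      proof -
        obtain p where p: "p permutes {1..k a}" "p 1 = j" "p 2 = l"
          using ex_permutes_pair[OF jl in12] by auto
        then have "p \<in> R" using True by simp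
        then obtain g where "g \<in> G" "p = perm g a" unfolding R_def by blast
        then show ?thesis using linked_perm[OF _ a(1) in12 lnk, of g] p by simp
      qed
      define A where "A = {a} \<times> {1..k a}"
      have AB: "A \<subseteq> blocks" using a(1) by (auto simp: A_def blocks_def)
      have const: "lam g b = lam g (a, 1)" if g: "g \<in> K" and b: "b \<in> A" for g b
      proof -
        obtain j where j: "b = (a, j)" "j \<in> {1..k a}" using b by (auto simp: A_def)
        \<comment> \<open>A block different from \<open>j\<close> and 1, available because
          \<open>k a\<close> is at least 3. Its relations with these two blocks share the factor
          \<open>lam g (a, e) ^ (d - 1)\<close>, so the two scalars agree.\<close>
        obtain e where e: "e \<in> {1..k a}" "e \<noteq> j" "e \<noteq> 1"
        proof -
          have "3 \<in> {1..k a}" using a(2) False by auto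
          then show ?thesis using that[of 2] that[of 3] in12 by (cases "j = 2") auto
        qed
        have gG: "g \<in> G" and sc: "scal g c" if "c \<in> blocks" for c using g that by (simp_all add: K_def)
        have bl: "(a, e) \<in> blocks" "(a, j) \<in> blocks" using a(1) e(1) j(2) by (auto simp: blocks_def)
        have "lam g (a, e) ^ (d - 1) * lam g (a, j) = 1"
          by (rule torus_relation[OF gG[OF b1] sc[OF bl(1)] sc[OF bl(2)] bl full[OF e(1) j(2) e(2)]])
        moreover have "lam g (a, e) ^ (d - 1) * lam g (a, 1) = 1"
          by (rule torus_relation[OF gG[OF b1] sc[OF bl(1)] sc[OF b1] bl(1) b1 full[OF e(1) in12(1) e(3)]])
        ultimately show ?thesis unfolding j(1) by (metis mult.commute mult.left_commute mult.right_neutral)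
      qed
      have "(a, 1) \<in> A" using in12(1) by (simp add: A_def)
      then have "card K \<le> d ^ (card (blocks - A) + 1)"
        using card_K_le[OF AB _ const] by blast
      moreover have "card blocks = card (blocks - A) + k a"
        using card_Diff_subset[OF finite_subset[OF AB finite_blocks] AB] card_mono[OF finite_blocks AB]
        by (simp add: A_def)
      \<comment> \<open>Collapsing at least two variables to one saves a factor \<open>d\<close>,
        which exceeds 2.\<close>
      moreover have "d ^ (card (blocks - A) + 1) * 2 \<le> d ^ (card (blocks - A) + k a)"
      proof -
        have "d ^ (card (blocks - A) + 1) * 2 \<le> d ^ (card (blocks - A) + 1) * d" using d3 by (intro mult_le_mono2) simp
        also have "\<dots> = d ^ (card (blocks - A) + 2)" by simp
        also have "\<dots> \<le> d ^ (card (blocks - A) + k a)" using d3 a(2) by (intro power_increasing) auto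
        finally show ?thesis .
      qed
      ultimately have "card K * 2 \<le> d ^ card blocks" by (metis mult_le_mono1 order_trans)
      then have "card R * (card K * 2) \<le> fact (k a) * d ^ card blocks" using Rle by (intro mult_le_mono)
      then show ?thesis using False by (simp add: mult_ac)
    qed
  qed
  then have "(card R * card K * (if k a = 2 then 1 else 2)) * (Q * X) \<le> (fact (k a) * d ^ card blocks) * (Q * X)"
    by (rule mult_le_mono1)
  moreover have "card G \<le> (card R * Q) * (X * card K)"
    using cardG mult_le_mono1[OF perms_le] order_trans by blast
  then have "card G * (if k a = 2 then 1 else 2) \<le> (card R * Q) * (X * card K) * (if k a = 2 then 1 else 2)"
    by (rule mult_le_mono1)
  ultimately show ?thesis unfolding prodf X_def[symmetric] by (simp only: mult_ac)
qed

theorem lemma5p5: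
  fixes r d m a :: nat and F :: cpoly and G :: "complex mat set"
    and V :: "nat \<Rightarrow> complex vec set" and k :: "nat \<Rightarrow> nat"
    and W :: "nat \<Rightarrow> nat \<Rightarrow> complex vec set"
  assumes "r \<ge> 3" and "d \<ge> 3"
    and "is_form r d F" and "smooth_form r F"
    and "subgroup G (GL r)" and "G \<subseteq> Aut_form r F"
    and "decomposition_data r G m V k W"
    and "compatible_basis r m k W"
    and "1 \<le> a" and "a \<le> m" and "k a \<ge> 2"
    and "\<exists>\<mu>\<in>Poly_Mapping.keys F. monomial_in_Sym_tensor_Sym r (d - 1) (W a 1) 1 (W a 2) \<mu>"
  shows
    "(k a = 2 \<and>
      real (card G) \<le> real (canonical_bound d G m k W) / real (card (H_group G W a 1)) \<and>
      real (canonical_bound d G m k W) / real (card (H_group G W a 1))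
        \<le> Fermat_ratio (subdegree_sequence r m k W) d * real d ^ r * fact r
            / real (JC (sub_dim r (W a 1)))) \<or>
     (k a \<ge> 3 \<and>
      real (card G) \<le> real (canonical_bound d G m k W) / (2 * real (card (H_group G W a 1))) \<and>
      real (canonical_bound d G m k W) / (2 * real (card (H_group G W a 1)))
        \<le> Fermat_ratio (subdegree_sequence r m k W) d * real d ^ r * fact r
            / (2 * real (JC (sub_dim r (W a 1)))))"
proof -
  interpret form_decomposition r d m F G V k W
    by (rule form_decomposition.intro) (fact assms)+
  have a: "a \<in> {1..m}" using assms by simp
  have b: "(a, 1) \<in> blocks" "(a, 2) \<in> blocks" using a assms(11) by (auto simp: blocks_def)
  obtain \<mu> where \<mu>: "\<mu> \<in> Poly_Mapping.keys F" "monomial_in_Sym_tensor_Sym r (d - 1) (U (a, 1)) 1 (U (a, 2)) \<mu>"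
    using assms(12) by (auto simp: U_def)
  have lnk: "linked (a, 1) (a, 2)"
  proof -
    obtain v u where v: "v \<in> carrier_vec r" "u \<in> T (a, 2)" "\<forall>i<r. i \<notin> T (a, 1) \<longrightarrow> v $ i = 0"
      "polar r F v (unit_vec r u) \<noteq> 0"
      using monomial_polar_nonzero[OF form \<mu>] unfolding T_def by blast
    have "v \<in> U (a, 1)" unfolding U_coord_subspace[OF b(1)] coord_subspace_def using v by blast
    then show ?thesis unfolding linked_def using v unit_vec_U by blast
  qed
  \<comment> \<open>With this divisor both alternatives become the same chain of
    inequalities.\<close>
  define c where "c = (if k a = 2 then 1 else 2 :: nat)"
  define h where "h = card (H (a, 1))"
  define J where "J = JC (sub_dim r (U (a, 1)))"
  define B where "B = canonical_bound d G m k W"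
  obtain q where q: "(\<Prod>i=1..m. fact (k i)) \<le> q"
    "Fermat_ratio (subdegree_sequence r m k W) d * real d ^ r * fact r =
      real d ^ card blocks * (\<Prod>b\<in>blocks. real (JC (sub_dim r (U b)))) * real q"
    using Fermat_ratio_eq by blast
  define Y where "Y = real d ^ card blocks * (\<Prod>b\<in>blocks. real (JC (sub_dim r (U b)))) * real q"
  have main: "real (card G) \<le> real B / (real c * real h) \<and> real B / (real c * real h) \<le> Y / (real c * real J)"
  proof (cases "\<forall>b\<in>blocks. finite (H b)")
    case False
    then obtain b' where b': "b' \<in> blocks" "infinite (H b')" by blast
    have "card (H b') = 0" using b'(2) by simp
    then have "(\<Prod>b\<in>blocks. card (H b)) = 0" using b'(1) by (intro prod_zero[OF finite_blocks]) blast
    then have "B = 0" by (simp add: B_def canonical_bound_eq)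
    moreover have "infinite G"
    proof
      assume "finite G"
      then have "finite (H b')" by (simp add: H_def H_group_def projective_image_def stabilizer_def)
      then show False using b' by simp
    qed
    \<comment> \<open>The other two terms are zero here, so non-negativity of the last one is all
      that remains.\<close>
    moreover have "Y \<ge> 0" unfolding Y_def by (intro mult_nonneg_nonneg prod_nonneg) auto
    ultimately show ?thesis by simp
  next
    case True
    then have fin: "\<And>b. b \<in> blocks \<Longrightarrow> finite (H b)" by blast
    have finG: "finite G" using finite_H_imp_finite_G[OF fin b(1)] .
    have Hpos: "card (H b) > 0" if "b \<in> blocks" for b
    proof -
      have "1\<^sub>m r \<in> stabilizer G (U b)" using subgroup_GL_D(2)[OF stabilizer_subgroup[OF that]] .
      then have "H b \<noteq> {}" unfolding H_def H_group_def projective_image_def U_def by blast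
      then show ?thesis using fin[OF that] by (simp add: card_gt_0_iff)
    qed
    define X where "X = (\<Prod>b\<in>blocks - {(a, 1)}. card (H b))"
    define Z where "Z = (\<Prod>b\<in>blocks - {(a, 1)}. JC (sub_dim r (U b)))"
    have hpos: "h > 0" unfolding h_def using Hpos[OF b(1)] .
    have hJ: "h \<le> J" unfolding h_def J_def using card_H_le_JC[OF b(1) finG] .
    have "(\<Prod>b\<in>blocks. card (H b)) = h * X" unfolding h_def X_def using finite_blocks b(1) by (rule prod.remove)
    then have B: "B = h * (d ^ card blocks * X * (\<Prod>i=1..m. fact (k i)))" unfolding B_def canonical_bound_eq by simp
    have "(\<Prod>b\<in>blocks. JC (sub_dim r (U b))) = J * Z" unfolding J_def Z_def using finite_blocks b(1) by (rule prod.remove)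
    then have Y: "Y = real J * real (d ^ card blocks * Z * q)" unfolding Y_def by (simp flip: of_nat_prod)
    have XZ: "X \<le> Z" unfolding X_def Z_def using card_H_le_JC finG by (intro prod_mono) auto
    have "card G * c \<le> d ^ card blocks * X * (\<Prod>i=1..m. fact (k i))"
      unfolding c_def X_def by (rule card_G_le_canonical_bound[OF fin a assms(11) lnk])
    then have 1: "real (card G) * real c \<le> real (d ^ card blocks * X * (\<Prod>i=1..m. fact (k i)))"
      by (metis of_nat_le_iff of_nat_mult)
    have 2: "real (d ^ card blocks * X * (\<Prod>i=1..m. fact (k i))) \<le> real (d ^ card blocks * Z * q)"
      using XZ q(1) by (intro of_nat_mono mult_le_mono) auto
    have c: "real c > 0" by (simp add: c_def)
    have e1: "real B / (real c * real h) = real (d ^ card blocks * X * (\<Prod>i=1..m. fact (k i))) / real c"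
      unfolding B of_nat_mult[of h] using hpos by (simp add: field_simps)
    \<comment> \<open>\<open>J\<close> cancels because \<open>0 < h\<close> and
      \<open>h \<le> J\<close>.\<close>
    have e2: "Y / (real c * real J) = real (d ^ card blocks * Z * q) / real c"
      unfolding Y using hpos hJ by (simp add: field_simps)
    show ?thesis unfolding e1 e2 using 1 2 c by (auto simp: pos_le_divide_eq intro: divide_right_mono)
  qed
  show ?thesis
  proof (cases "k a = 2")
    case True
    then show ?thesis using main q(2) by (simp add: c_def h_def J_def B_def Y_def H_def U_def)
  next
    case False
    then have "k a \<ge> 3" using assms(11) by simp
    then show ?thesis using main q(2) by (simp add: c_def h_def J_def B_def Y_def H_def U_def)
  qed
qed

end
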